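(* There exists a non-trivial, non-negative function $\tilde W\in L^1(\mathbb{R}^2)$ such that $R_1^2(\tilde W)$ is non-negative on the support of $\tilde W$.
   Context: $R_1$ denotes the first component of the Riesz transform on $\mathbb{R}^2$, i.e., the Fourier multiplier with symbol $-i\xi_1/|\xi|$; thus $R_1^2$ is the Fourier multiplier with symbol $-\xi_1^2/|\xi|^2$, and $R_1^2$ denotes the composition of $R_1$ with itself. *)

theory Defs
  imports "HOL-Analysis.Analysis"
begin

definition fourier2 :: "(real^2 \<Rightarrow> complex) \<Rightarrow> real^2 \<Rightarrow> complex" where
  "fourier2 f \<xi> = (\<integral>x. f x * cis (- (x \<bullet> \<xi>)) \<partial>lborel)"

definition riesz1_sq_symbol :: "real^2 \<Rightarrow> complex" where
  "riesz1_sq_symbol \<xi> = (- \<i> * complex_of_real (\<xi>$1 / norm \<xi>))^2"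

definition riesz1_sq_test :: "(real^2 \<Rightarrow> real) \<Rightarrow> real^2 \<Rightarrow> complex" where
  "riesz1_sq_test \<phi> x = complex_of_real (1 / (4 * pi^2)) *
     (\<integral>\<xi>. riesz1_sq_symbol \<xi> * fourier2 (\<lambda>y. complex_of_real (\<phi> y)) \<xi> * cis (x \<bullet> \<xi>) \<partial>lborel)"

text \<open>Test functions: continuous, compactly supported, with integrable Fourier transform
  (this class contains all smooth compactly supported functions).\<close>
definition test_fun2 :: "(real^2 \<Rightarrow> real) \<Rightarrow> bool" where
  "test_fun2 \<phi> \<longleftrightarrow> continuous_on UNIV \<phi> \<and> compact (closure {x. \<phi> x \<noteq> 0})
     \<and> integrable lborel (fourier2 (\<lambda>y. complex_of_real (\<phi> y)))"

text \<open>g is (a representative of) R_1^2 W, in the sense of distributions, for W in L^1: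
  g locally integrable and pairing with test functions agrees with W paired with R_1^2 phi
  (R_1^2 is self-adjoint since its symbol is real and even).\<close>
definition is_riesz1_sq :: "(real^2 \<Rightarrow> real) \<Rightarrow> (real^2 \<Rightarrow> real) \<Rightarrow> bool" where
  "is_riesz1_sq W g \<longleftrightarrow> g \<in> borel_measurable lborel
     \<and> (\<forall>K. compact K \<longrightarrow> set_integrable lborel K g)
     \<and> (\<forall>\<phi>. test_fun2 \<phi> \<longrightarrow>
          (\<integral>x. complex_of_real (g x * \<phi> x) \<partial>lborel)
          = (\<integral>x. complex_of_real (W x) * riesz1_sq_test \<phi> x \<partial>lborel))"

definition ess_support :: "(real^2 \<Rightarrow> real) \<Rightarrow> (real^2) set" where
  "ess_support W = {x. \<forall>e>0. emeasure lborel {y \<in> ball x e. W y \<noteq> 0} > 0}"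

end

theory Submission
  imports Defs "HOL-Probability.Probability" "HOL-Real_Asymp.Real_Asymp"
begin

text \<open>
  If \<open>W\<close> is the Laplacian of \<open>u\<close>, then \<open>R\<^sub>1\<^sup>2 W = - \<partial>\<^sub>1\<^sup>2 u\<close>. So one looks for a potential \<open>u\<close> whose Laplacian
  is non-negative and integrable, with \<open>\<partial>\<^sub>1\<^sup>2 u \<le> 0\<close> wherever the Laplacian does not vanish.
  The function \<open>log \<bar>1 + sqrt (- i z)\<bar>\<close> on the upper half-plane, reflected in the real axis, is harmonic off
  the axis, its Laplacian is a positive measure on the axis with a density of size \<open>\<bar>x\<bar> powr (-1/2)\<close> at \<open>0\<close>
  and \<open>\<bar>x\<bar> powr (-3/2)\<close> at infinity, and \<open>\<partial>\<^sub>1\<^sup>2 u < 0\<close> on the axis. With \<open>r = \<bar>z\<bar>\<close> it is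
  \<open>1/2 log (1 + sqrt (2 (r + \<bar>y\<bar>)) + r)\<close>; replacing \<open>\<bar>y\<bar>\<close> by a homogeneous \<open>C\<^sup>1\<close> function in the wedge
  \<open>\<bar>y\<bar> \<le> r/4\<close> spreads the measure over the wedge and keeps both signs. The result is not in \<open>L\<^sup>2\<close>, and
  cannot be, since \<open>R\<^sub>1\<^sup>2\<close> is a negative operator there.

  The distributional identity is obtained by damping the symbol with \<open>exp (- t \<bar>\<xi>\<bar>\<^sup>2)\<close>: by the heat equation and
  an integration by parts, the \<open>t\<close>-derivatives of the two sides agree, and both sides tend to \<open>0\<close> as \<open>t\<close>
  tends to infinity.
\<close>

section \<open>Lebesgue integration over the plane\<close>

text \<open>The summand 1 in the potential reconciles two scales. The real part of
  \<open>sqrt (- i z)\<close> alone has degree 1/2, so its Laplacian, once spread over the wedge,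
  has degree -3/2: integrable at the origin but not at infinity. Under the logarithm the potential
  becomes \<open>log r / 2\<close> plus a term of degree -1/2 for large r, and since
  \<open>log r\<close> is harmonic the Laplacian decays like \<open>r powr (-5/2)\<close>. The
  second derivative \<open>\<partial>\<^sub>1\<^sup>2 u\<close> does see the logarithm: it decays
  only like 1/r^2 and is not integrable. The decay needed as t tends to infinity must therefore come
  from the heat kernel, which is why weights occur. Test functions are merely continuous, so no
  derivative can be moved onto them. The damped symbol carries the derivatives instead: one
  t-derivative multiplies it by \<open>- \<bar>\<xi>\<bar>\<^sup>2\<close>, the singular denominator
  cancels, and a second derivative of a Gaussian with an explicit kernel remains. For the opening
  1/4 both signs reduce to polynomial inequalities in the square of the sine of the polar angle,
  which is at most 1/16.\<close>

definition vec2 :: "real \<times> real \<Rightarrow> real^2" where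
  "vec2 p = vector [fst p, snd p]"

lemma vec2_nth [simp]: "vec2 (x, y) $ 1 = x" "vec2 (x, y) $ 2 = y"
  by (auto simp: vec2_def)

lemma norm_sq_vec2: "(norm (v::real^2))^2 = (v$1)^2 + (v$2)^2"
  unfolding power2_norm_eq_inner by (simp add: inner_vec_def sum_2 power2_eq_square)

lemma borel_measurable_vec2 [measurable]: "vec2 \<in> borel_measurable borel"
proof -
  have "vec2 = (\<lambda>p. fst p *\<^sub>R axis 1 1 + snd p *\<^sub>R axis 2 1)"
    by (auto simp: fun_eq_iff vec2_def vec_eq_iff forall_2 axis_def)
  moreover have "\<dots> \<in> borel_measurable borel"
    by (intro borel_measurable_continuous_onI continuous_intros)
  ultimately show ?thesis by simp
qed

lemma measurable_vec_nth [measurable]: "(\<lambda>v. v $ i) \<in> borel_measurable (borel :: (real^2) measure)"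
  by (intro borel_measurable_continuous_onI continuous_intros)

lemma Basis_vec2: "(Basis :: (real^2) set) = {axis 1 1, axis 2 1}"
  by (auto simp: Basis_vec_def UNIV_2)

text \<open>Fubini is formulated for pairs. Boxes correspond under \<open>vec2\<close> with equal
  volume, which transports Lebesgue measure, and with it iterated integration, to
  \<open>real^2\<close>.\<close>

lemma lborel_vec2: "(lborel :: (real^2) measure) = distr lborel borel vec2"
proof (rule lborel_eqI)
  fix l u :: "real^2"
  assume le: "\<And>b. b \<in> Basis \<Longrightarrow> l \<bullet> b \<le> u \<bullet> b"
  have le': "l$1 \<le> u$1" "l$2 \<le> u$2"
    using le[of "axis 1 1"] le[of "axis 2 1"] by (auto simp: Basis_vec2 inner_axis)
  have ne: "axis (1::2) (1::real) \<noteq> axis 2 1" by (simp add: axis_eq_axis)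
  have "vec2 -` box l u \<inter> space lborel = box (l$1, l$2) (u$1, u$2)"
    by (auto simp: mem_box Basis_vec2 inner_axis Basis_prod_def)
  then have "emeasure (distr lborel borel vec2) (box l u)
      = emeasure lborel (box (l$1, l$2) (u$1, u$2))"
    by (subst emeasure_distr) auto
  also have "\<dots> = ennreal (\<Prod>b\<in>Basis. ((u$1, u$2) - (l$1, l$2)) \<bullet> b)"
    using le' by (subst emeasure_lborel_box) (auto simp: Basis_prod_def)
  also have "(\<Prod>b\<in>Basis. ((u$1, u$2) - (l$1, l$2)) \<bullet> b) = (u$1 - l$1) * (u$2 - l$2)"
    by (simp add: Basis_prod_def)
  also have "\<dots> = prod ((\<bullet>) (u - l)) Basis"
    using ne by (simp add: Basis_vec2 inner_axis)
  finally show "emeasure (distr lborel borel vec2) (box l u) = ennreal (prod ((\<bullet>) (u - l)) Basis)" .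
qed simp

lemma integral_vec2:
  fixes f :: "real^2 \<Rightarrow> 'a::{banach, second_countable_topology}"
  assumes [measurable]: "f \<in> borel_measurable borel"
  shows "(\<integral>v. f v \<partial>lborel) = (\<integral>p. f (vec2 p) \<partial>lborel)"
  by (subst lborel_vec2, rule integral_distr) auto

lemma integrable_vec2_iff:
  fixes f :: "real^2 \<Rightarrow> 'a::{banach, second_countable_topology}"
  assumes [measurable]: "f \<in> borel_measurable borel"
  shows "integrable lborel f \<longleftrightarrow> integrable lborel (\<lambda>p. f (vec2 p))"
  by (subst lborel_vec2, rule integrable_distr_eq) auto

lemma
  fixes a b :: "real \<Rightarrow> 'a::{real_normed_field, banach, second_countable_topology}"
  assumes a: "integrable lborel a" and b: "integrable lborel b"
  shows integrable_vec2_product: "integrable lborel (\<lambda>v::real^2. a (v$1) * b (v$2))"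
    and integral_vec2_product:
      "(\<integral>v. a ((v::real^2)$1) * b (v$2) \<partial>lborel) = (\<integral>x. a x \<partial>lborel) * (\<integral>y. b y \<partial>lborel)"
proof -
  have [measurable]: "a \<in> borel_measurable borel" "b \<in> borel_measurable borel"
    using a b by auto
  have i: "integrable (lborel \<Otimes>\<^sub>M lborel) (\<lambda>(x, y). a x * b y)"
    by (rule lborel_pair.Fubini_integrable) (use a b in \<open>auto simp: norm_mult\<close>)
  show "integrable lborel (\<lambda>v::real^2. a (v$1) * b (v$2))"
    using i by (subst integrable_vec2_iff) (auto simp: lborel_prod case_prod_unfold vec2_def)
  have "(\<integral>v. a ((v::real^2)$1) * b (v$2) \<partial>lborel) = (\<integral>p. (\<lambda>(x, y). a x * b y) p \<partial>lborel)"
    by (subst integral_vec2) (auto simp: case_prod_unfold vec2_def)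
  also have "\<dots> = (\<integral>x. \<integral>y. a x * b y \<partial>lborel \<partial>lborel)"
    using lborel_pair.integral_fst'[OF i] by (simp add: lborel_prod)
  also have "\<dots> = (\<integral>x. a x \<partial>lborel) * (\<integral>y. b y \<partial>lborel)"
    by simp
  finally show "(\<integral>v. a ((v::real^2)$1) * b (v$2) \<partial>lborel)
      = (\<integral>x. a x \<partial>lborel) * (\<integral>y. b y \<partial>lborel)" .
qed

text \<open>The fundamental theorem on [-n, n] followed by dominated convergence. The finite
  exceptional set \<open>X\<close> admits the kinks of the first derivatives of the potential at the
  edges of the wedge.\<close>

lemma integral_derivative_eq_0:
  fixes F f :: "real \<Rightarrow> 'a::euclidean_space"
  assumes X: "finite X"
    and D: "\<And>x. x \<notin> X \<Longrightarrow> (F has_vector_derivative f x) (at x)"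
    and C: "continuous_on UNIV F"
    and I: "integrable lborel f"
    and lim: "(F \<longlongrightarrow> 0) at_top" "(F \<longlongrightarrow> 0) at_bot"
  shows "(\<integral>x. f x \<partial>lborel) = 0"
proof -
  have si: "set_integrable lborel A f" if "A \<in> sets borel" for A
    unfolding set_integrable_def using I that by (intro integrable_mult_indicator) auto
  have eq: "(LINT x:{- real n..real n}|lborel. f x) = F (real n) - F (- real n)" for n
  proof -
    have "(f has_integral (F (real n) - F (- real n))) {- real n..real n}"
      by (rule fundamental_theorem_of_calculus_interior_strong[OF X])
         (auto intro!: D continuous_on_subset[OF C])
    then show ?thesis
      using set_borel_integral_eq_integral[OF si[of "{- real n..real n}"]]
      by (simp add: integral_unique)
  qed
  have "(\<lambda>n. (\<integral>x. indicator {- real n..real n} x *\<^sub>R f x \<partial>lborel)) \<longlonglongrightarrow> (\<integral>x. f x \<partial>lborel)"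
  proof (rule integral_dominated_convergence[where w="\<lambda>x. norm (f x)"])
    show "AE x in lborel. (\<lambda>n. indicat_real {- real n..real n} x *\<^sub>R f x) \<longlonglongrightarrow> f x"
    proof (rule AE_I2, rule tendsto_eventually)
      fix x :: real
      have "\<forall>\<^sub>F n in sequentially. \<bar>x\<bar> \<le> real n"
        by (rule eventually_mono[OF eventually_ge_at_top[of "nat \<lceil>\<bar>x\<bar>\<rceil>"]]) linarith
      then show "\<forall>\<^sub>F n in sequentially. indicat_real {- real n..real n} x *\<^sub>R f x = f x"
        by eventually_elim (auto simp: indicator_def)
    qed
  qed (use I in \<open>auto simp: indicator_def\<close>)
  moreover have "(\<lambda>n. F (real n) - F (- real n)) \<longlonglongrightarrow> 0 - 0"
    by (intro tendsto_diff filterlim_compose[OF lim(1)] filterlim_compose[OF lim(2)]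
         filterlim_real_sequentially
         filterlim_compose[OF filterlim_uminus_at_bot_at_top filterlim_real_sequentially])
  ultimately show ?thesis
    unfolding eq[unfolded set_lebesgue_integral_def] by (simp add: LIMSEQ_unique)
qed

section \<open>The heat kernel\<close>

definition heat :: "real \<Rightarrow> real \<Rightarrow> real" where
  "heat t x = exp (- (x^2) / (4*t)) / sqrt (4*pi*t)"

definition dheat :: "real \<Rightarrow> real \<Rightarrow> real" where
  "dheat t x = - x / (2*t) * heat t x"

definition ddheat :: "real \<Rightarrow> real \<Rightarrow> real" where
  "ddheat t x = (x^2 / (4*t^2) - 1 / (2*t)) * heat t x"

lemma heat_measurable [measurable (raw)]:
  assumes [measurable]: "f \<in> borel_measurable M" "g \<in> borel_measurable M"
  shows "(\<lambda>p. heat (f p) (g p)) \<in> borel_measurable M"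
    "(\<lambda>p. ddheat (f p) (g p)) \<in> borel_measurable M"
  unfolding heat_def ddheat_def by measurable

lemma heat_nonneg [simp]: "t > 0 \<Longrightarrow> heat t x \<ge> 0"
  by (simp add: heat_def)

lemma heat_minus [simp]: "heat t (- x) = heat t x" "ddheat t (- x) = ddheat t x"
  by (simp_all add: heat_def ddheat_def)

lemma heat_diff_commute: "heat t (x - y) = heat t (y - x)" "ddheat t (x - y) = ddheat t (y - x)"
  using heat_minus[of t "x - y"] by simp_all

lemma heat_eq_normal: "t > 0 \<Longrightarrow> heat t = normal_density 0 (sqrt (2*t))"
  by (auto simp: heat_def normal_density_def fun_eq_iff)

lemma heat_deriv:
  assumes "t > 0"
  shows "(heat t has_real_derivative dheat t x) (at x)"
    "(dheat t has_real_derivative ddheat t x) (at x)"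
proof -
  show *: "(heat t has_real_derivative dheat t x) (at x)" for x
    unfolding heat_def dheat_def using assms
    by (auto intro!: derivative_eq_intros simp: field_simps)
  have "((\<lambda>x. - x / (2*t) * heat t x) has_real_derivative
      (- 1 / (2*t) * heat t x + dheat t x * (- x / (2*t)))) (at x)"
    using assms by (auto intro!: derivative_eq_intros * simp: field_simps)
  then show "(dheat t has_real_derivative ddheat t x) (at x)"
    using assms unfolding dheat_def[abs_def] ddheat_def
    by (simp add: dheat_def add_divide_distrib diff_divide_distrib algebra_simps power2_eq_square)
qed

text \<open>The heat equation, in the normalisation whose Fourier multiplier is
  \<open>exp (- t * \<xi>^2)\<close>.\<close>

lemma heat_deriv_time:
  assumes "t > 0"
  shows "((\<lambda>t. heat t x) has_real_derivative ddheat t x) (at t)"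
proof -
  have s: "sqrt (4*pi*t) > 0" "sqrt (4*pi*t) * sqrt (4*pi*t) = 4*pi*t" using assms by auto
  have 1: "((\<lambda>t. exp (- (x^2) / (4*t))) has_real_derivative x^2 / (4*t^2) * exp (- (x^2) / (4*t))) (at t)"
    using assms by (auto intro!: derivative_eq_intros simp: field_simps power2_eq_square)
  have 2: "((\<lambda>t. sqrt (4*pi*t)) has_real_derivative (sqrt (4*pi*t) / (2*t))) (at t)"
  proof -
    have "((\<lambda>t. sqrt (4*pi*t)) has_real_derivative (inverse (sqrt (4*pi*t)) / 2 * (4*pi))) (at t)"
      using assms by (auto intro!: derivative_eq_intros simp: mult_less_0_iff)
    moreover have "inverse (sqrt (4*pi*t)) / 2 * (4*pi) = sqrt (4*pi*t) / (2*t)"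
      using s(2) assms by (simp add: field_simps)
    ultimately show ?thesis by simp
  qed
  have "((\<lambda>t. exp (- (x^2) / (4*t)) / sqrt (4*pi*t)) has_real_derivative
     ((x^2 / (4*t^2) * exp (- (x^2) / (4*t))) * sqrt (4*pi*t) - exp (- (x^2) / (4*t)) * (sqrt (4*pi*t) / (2*t)))
       / (sqrt (4*pi*t) * sqrt (4*pi*t))) (at t)"
    by (rule DERIV_divide[OF 1 2]) (use s in auto)
  moreover have "((x^2 / (4*t^2) * exp (- (x^2) / (4*t))) * sqrt (4*pi*t) - exp (- (x^2) / (4*t)) * (sqrt (4*pi*t) / (2*t)))
       / (sqrt (4*pi*t) * sqrt (4*pi*t)) = ddheat t x"
  proof -
    have "((A * E) * r - E * (r / (2*t))) / (r * r) = (A - 1 / (2*t)) * (E / r)" if "r > 0" for A E r :: real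
      using that assms by (simp add: field_simps)
    from this[OF s(1)] show ?thesis unfolding ddheat_def heat_def .
  qed
  ultimately show ?thesis unfolding heat_def[abs_def] by simp
qed

lemma
  assumes "0 < t"
  shows heat_integrable: "integrable lborel (\<lambda>x. heat t (x - a))"
    and heat_integral: "(\<integral>x. heat t (x - a) \<partial>lborel) = 1"
proof -
  have eq: "heat t (x - a) = normal_density a (sqrt (2*t)) x" for x
    using assms by (simp add: heat_eq_normal normal_density_def)
  show "integrable lborel (\<lambda>x. heat t (x - a))" "(\<integral>x. heat t (x - a) \<partial>lborel) = 1"
    unfolding eq using assms by (auto intro: integrable_normal_density integral_normal_density)
qed

lemma
  assumes "0 < s" "0 < t"
  shows heat_conv_integrable: "integrable lborel (\<lambda>y. heat s (x - y) * heat t y)"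
    and heat_conv: "(\<integral>y. heat s (x - y) * heat t y \<partial>lborel) = heat (s + t) x"
proof -
  have "(\<integral>\<^sup>+y. ennreal (heat s (x - y) * heat t y) \<partial>lborel) = ennreal (heat (s + t) x)"
    using fun_cong[OF conv_normal_density_zero_mean[of "sqrt (2 * s)" "sqrt (2*t)"], of x] assms
    by (simp add: heat_eq_normal distrib_left)
  then have "has_bochner_integral lborel (\<lambda>y. heat s (x - y) * heat t y) (heat (s + t) x)"
    using assms by (intro has_bochner_integral_nn_integral) auto
  then show "integrable lborel (\<lambda>y. heat s (x - y) * heat t y)"
    "(\<integral>y. heat s (x - y) * heat t y \<partial>lborel) = heat (s + t) x"
    by (auto simp: has_bochner_integral_iff)
qed

text \<open>On a bounded time interval all kernels are dominated by a multiple of the latest one,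
  which supplies majorants independent of the time.\<close>

lemma heat_mono_time:
  assumes "0 < t" "t \<le> T"
  shows "heat t x \<le> T / t * heat T x"
proof -
  have "exp (- (x^2) / (4*t)) \<le> exp (- (x^2) / (4*T))"
    using assms by (simp add: divide_left_mono)
  moreover have "1 / sqrt (4*pi*t) = sqrt (T/t) / sqrt (4*pi*T)"
    using assms by (simp add: real_sqrt_mult real_sqrt_divide field_simps)
  ultimately have "exp (- (x^2) / (4*t)) * (1 / sqrt (4*pi*t)) \<le> exp (- (x^2) / (4*T)) * (sqrt (T/t) / sqrt (4*pi*T))"
    using assms by (intro mult_mono) auto
  then have "heat t x \<le> exp (- (x^2) / (4*T)) * (sqrt (T/t) / sqrt (4*pi*T))"
    by (simp add: heat_def)
  also have "\<dots> = sqrt (T/t) * heat T x" by (simp add: heat_def)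
  also have "\<dots> \<le> T / t * heat T x"
  proof (rule mult_right_mono)
    have "1 \<le> T/t" using assms by simp
    then show "sqrt (T/t) \<le> T/t"
      using mult_left_mono[of 1 "T/t" "T/t"] by (intro real_le_lsqrt) (auto simp: power2_eq_square)
  qed (use assms in auto)
  finally show ?thesis .
qed

text \<open>A polynomial factor is paid for by doubling the time: with
  \<open>w = x^2 / (8*t)\<close> the kernel at time t is \<open>exp (-w) * sqrt 2\<close> times the
  kernel at time 2t, and \<open>exp (-w)\<close> absorbs the factor that is linear in w.\<close>

lemma abs_ddheat_le:
  assumes "0 < t"
  shows "\<bar>ddheat t x\<bar> \<le> 4 / t * heat (2*t) x"
proof -
  define w where "w = x^2 / (8*t)"
  have w: "w \<ge> 0" using assms by (simp add: w_def)
  have "\<bar>ddheat t x\<bar> = \<bar>2*w - 1/2\<bar> / t * heat t x"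
  proof -
    have "x^2 / (4*t^2) - 1 / (2*t) = (2*w - 1/2) / t"
      using assms by (simp add: w_def field_simps power2_eq_square)
    then show ?thesis using assms by (simp add: ddheat_def abs_mult)
  qed
  also have "heat t x = exp (-w) * (sqrt 2 * heat (2*t) x)"
  proof -
    have "exp (- (x^2) / (4*t)) = exp (-w) * exp (- (x^2) / (4 * (2 * t)))"
      using assms by (simp add: w_def field_simps flip: exp_add)
    moreover have "sqrt (4 * pi * (2 * t)) = sqrt 2 * sqrt (4*pi*t)"
      using real_sqrt_mult[of 2 "4*pi*t"] by (simp add: mult_ac)
    ultimately show ?thesis by (simp add: heat_def)
  qed
  also have "\<bar>2*w - 1/2\<bar> / t * (exp (-w) * (sqrt 2 * heat (2*t) x))
      = (\<bar>2*w - 1/2\<bar> * exp (-w) * sqrt 2) * (1 / t * heat (2*t) x)" by simp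
  also have "\<dots> \<le> 4 * (1 / t * heat (2*t) x)"
  proof (rule mult_right_mono)
    have "\<bar>2*w - 1/2\<bar> \<le> 2 * exp w" using exp_ge_add_one_self[of w] w by linarith
    then have "\<bar>2*w - 1/2\<bar> * exp (-w) \<le> 2" by (simp add: exp_minus field_simps)
    moreover have "sqrt 2 \<le> 2" by (simp add: real_le_lsqrt)
    ultimately show "\<bar>2*w - 1/2\<bar> * exp (-w) * sqrt 2 \<le> 4"
      using mult_mono[of "\<bar>2*w - 1/2\<bar> * exp (-w)" 2 "sqrt 2" 2] by simp
  qed (use assms in auto)
  finally show ?thesis by simp
qed

text \<open>A compromise between decay in time and in space. Two coordinates together give
  \<open>s powr (-1/2)\<close>, which sends the pairing with h to 0, and the exponent -1/2 in space
  makes \<open>\<bar>x\<bar> powr (-3/4)\<close> integrable at infinity. Fourth powers clear both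
  fractional exponents.\<close>

lemma heat_decay:
  assumes "1 \<le> s"
  shows "heat s x \<le> s powr (-1/4) * (1 + \<bar>x\<bar>) powr (-1/2)"
proof -
  have s: "s > 0" using assms by simp
  have "heat s x ^ 4 \<le> (s powr (-1/4) * (1 + \<bar>x\<bar>) powr (-1/2)) ^ 4"
  proof -
    have "(1 + \<bar>x\<bar>)^2 \<le> 2 * (1 + x^2)"
      using zero_le_power2[of "\<bar>x\<bar> - 1"] by (simp add: power2_eq_square algebra_simps)
    also have "\<dots> \<le> 2 * (s * exp (x^2 / s))"
    proof -
      have "1 + x^2 \<le> s * (1 + x^2 / s)" using assms by (simp add: field_simps)
      also have "\<dots> \<le> s * exp (x^2 / s)" using s by (intro mult_left_mono) (auto simp: exp_ge_add_one_self)
      finally show ?thesis by simp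
    qed
    also have "\<dots> \<le> (4 * pi)^2 * (s * exp (x^2 / s))"
    proof (rule mult_right_mono)
      have "2 \<le> (4*3::real)^2" by simp
      also have "\<dots> \<le> (4*pi)^2" using pi_gt3 by (intro power_mono) auto
      finally show "2 \<le> (4*pi)^2" .
    qed (use s in auto)
    finally have "1 / ((4*pi)^2 * (s * exp (x^2 / s))) \<le> 1 / (1 + \<bar>x\<bar>)^2"
      using s by (intro divide_left_mono) (auto intro!: mult_pos_pos)
    then have "1 / ((4*pi)^2 * (s * exp (x^2 / s))) * (1/s) \<le> 1 / (1 + \<bar>x\<bar>)^2 * (1/s)"
      using s by (intro mult_right_mono) auto
    moreover have "heat s x ^ 4 = 1 / ((4*pi)^2 * (s * exp (x^2 / s))) * (1/s)"
    proof -
      have "exp (- (x^2) / (4 * s)) ^ 4 = exp (- (x^2 / s))"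
        using s by (simp flip: exp_of_nat_mult)
      moreover have "sqrt (4*pi * s) ^ 4 = (4*pi * s)^2"
        using s by (simp add: numeral_eq_Suc power2_eq_square)
      ultimately show ?thesis
        using s by (simp add: heat_def power_divide exp_minus power2_eq_square field_simps)
    qed
    moreover have "(s powr (-1/4) * (1 + \<bar>x\<bar>) powr (-1/2)) ^ 4 = 1 / (1 + \<bar>x\<bar>)^2 * (1/s)"
    proof -
      have "(s powr (-1/4)) ^ 4 = s powr (-1)" "((1 + \<bar>x\<bar>) powr (-1/2)) ^ 4 = (1 + \<bar>x\<bar>) powr (-2)"
        using s by (simp_all add: powr_power)
      moreover have "s powr (-1) = 1 / s" using s by (simp add: powr_minus_divide)
      moreover have "(1 + \<bar>x\<bar>) powr (-2) = 1 / (1 + \<bar>x\<bar>)^2"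
        using powr_realpow[of "1 + \<bar>x\<bar>" 2] unfolding powr_minus_divide by simp
      ultimately show ?thesis unfolding power_mult_distrib by simp
    qed
    ultimately show ?thesis by simp
  qed
  then show ?thesis by (rule power_le_imp_le_base[of _ 3, simplified]) simp
qed

text \<open>The characteristic function of the standard normal distribution after the substitution
  \<open>z = sqrt (2*t) * \<xi>\<close>.\<close>

lemma heat_fourier:
  assumes "0 < t"
  shows "integrable lborel (\<lambda>\<xi>. complex_of_real (exp (- t * \<xi>^2)) * cis (x * \<xi>))"
    and "(\<integral>\<xi>. complex_of_real (exp (- t * \<xi>^2)) * cis (x * \<xi>) \<partial>lborel) = of_real (2 * pi * heat t x)"
proof -
  have s: "sqrt (2*t) > 0" using assms by simp
  show i: "integrable lborel (\<lambda>\<xi>. complex_of_real (exp (- t * \<xi>^2)) * cis (x * \<xi>))"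
  proof (rule Bochner_Integration.integrable_bound)
    have "exp (- t * \<xi>^2) = sqrt (pi / t) * heat (1/(4*t)) (\<xi> - 0)" for \<xi>
      using assms by (simp add: heat_def)
    then show "integrable lborel (\<lambda>\<xi>. exp (- t * \<xi>^2))"
      using heat_integrable[of "1/(4*t)" 0] assms by simp
    show "(\<lambda>\<xi>. complex_of_real (exp (- t * \<xi>^2)) * cis (x * \<xi>)) \<in> borel_measurable lborel"
      unfolding cis_conv_exp by measurable
  qed (auto simp: norm_mult)
  have "complex_of_real (exp (- (x / sqrt (2*t))\<^sup>2 / 2)) =
     (\<integral>z. std_normal_density z *\<^sub>R iexp (x / sqrt (2*t) * z) \<partial>lborel)"
    unfolding char_std_normal_distribution[THEN fun_cong, symmetric] char_def
    by (subst integral_density) auto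
  also have "\<dots> = sqrt (2*t) *\<^sub>R (\<integral>\<xi>. std_normal_density (0 + sqrt (2*t) * \<xi>) *\<^sub>R iexp (x / sqrt (2*t) * (0 + sqrt (2*t) * \<xi>)) \<partial>lborel)"
    by (subst lborel_integral_real_affine[where c="sqrt (2*t)" and t=0]) (use s in auto)
  also have "(\<lambda>\<xi>. std_normal_density (0 + sqrt (2*t) * \<xi>) *\<^sub>R iexp (x / sqrt (2*t) * (0 + sqrt (2*t) * \<xi>)))
     = (\<lambda>\<xi>. (1 / sqrt (2*pi)) *\<^sub>R (complex_of_real (exp (- t * \<xi>^2)) * cis (x * \<xi>)))"
    using s assms by (auto simp: fun_eq_iff std_normal_density_def power_mult_distrib cis_conv_exp scaleR_conv_of_real)
  also have "sqrt (2*t) *\<^sub>R (\<integral>\<xi>. (1 / sqrt (2*pi)) *\<^sub>R (complex_of_real (exp (- t * \<xi>^2)) * cis (x * \<xi>)) \<partial>lborel)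
     = of_real (sqrt (t / pi)) * (\<integral>\<xi>. complex_of_real (exp (- t * \<xi>^2)) * cis (x * \<xi>) \<partial>lborel)"
    using assms by (simp add: scaleR_conv_of_real real_sqrt_mult real_sqrt_divide)
  finally have "of_real (sqrt (t / pi)) * (\<integral>\<xi>. complex_of_real (exp (- t * \<xi>^2)) * cis (x * \<xi>) \<partial>lborel)
     = complex_of_real (exp (- (x / sqrt (2*t))\<^sup>2 / 2))" ..
  also have "exp (- (x / sqrt (2*t))\<^sup>2 / 2) = sqrt (t / pi) * (2 * pi * heat t x)"
  proof -
    have "sqrt (t / pi) * (2 * pi) / sqrt (4*pi*t) = 1"
      using assms by (simp add: real_sqrt_mult real_sqrt_divide field_simps)
    then show ?thesis
      using assms by (simp add: heat_def power_divide mult.assoc field_simps)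
  qed
  finally show "(\<integral>\<xi>. complex_of_real (exp (- t * \<xi>^2)) * cis (x * \<xi>) \<partial>lborel) = of_real (2 * pi * heat t x)"
    using assms by (simp add: of_real_mult)
qed

lemma square_mult_exp_le:
  fixes t \<xi> :: real
  assumes "0 < t"
  shows "\<xi>^2 * exp (- t * \<xi>^2) \<le> 2 / t * exp (- (t/2) * \<xi>^2)"
proof -
  have "t/2 * \<xi>^2 \<le> exp (t/2 * \<xi>^2)"
    using exp_ge_add_one_self[of "t/2 * \<xi>^2"] by linarith
  then have "(t/2 * \<xi>^2) * exp (- t * \<xi>^2) \<le> exp (t/2 * \<xi>^2) * exp (- t * \<xi>^2)"
    by (intro mult_right_mono) auto
  also have "\<dots> = exp (- (t/2) * \<xi>^2)"
    by (simp flip: exp_add)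
  finally show ?thesis using assms by (simp add: field_simps)
qed

lemma integrable_exp_square:
  fixes t :: real
  assumes "0 < t"
  shows "integrable lborel (\<lambda>\<xi>. exp (- t * \<xi>^2))"
    and "integrable lborel (\<lambda>\<xi>. \<xi>^2 * exp (- t * \<xi>^2))"
proof -
  have *: "integrable lborel (\<lambda>\<xi>. exp (- t * \<xi>^2))" if "0 < t" for t :: real
    using integrable_norm[OF heat_fourier(1)[OF that, of 0]] by (simp add: norm_mult)
  show "integrable lborel (\<lambda>\<xi>. exp (- t * \<xi>^2))" using *[OF assms] .
  show "integrable lborel (\<lambda>\<xi>. \<xi>^2 * exp (- t * \<xi>^2))"
  proof (rule Bochner_Integration.integrable_bound)
    show "integrable lborel (\<lambda>\<xi>. 2 / t * exp (- (t/2) * \<xi>^2))"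
      using *[of "t/2"] assms by simp
  qed (use square_mult_exp_le[OF assms] assms in auto)
qed

text \<open>The derivatives of \<open>e\<close> and of \<open>\<xi> * e\<close> integrate to 0. The
  first relation expresses the first moment by the integral of \<open>e\<close>, the second then
  gives the second moment; this replaces differentiation in x under the integral sign.\<close>

lemma heat_fourier_second_moment:
  assumes "0 < t"
  shows "integrable lborel (\<lambda>\<xi>. complex_of_real (\<xi>^2 * exp (- t * \<xi>^2)) * cis (x * \<xi>))"
    and "(\<integral>\<xi>. complex_of_real (\<xi>^2 * exp (- t * \<xi>^2)) * cis (x * \<xi>) \<partial>lborel)
      = of_real (- 2 * pi * ddheat t x)"
proof -
  define e where "e \<xi> = complex_of_real (exp (- t * \<xi>^2)) * cis (x * \<xi>)" for \<xi>
  have [measurable]: "e \<in> borel_measurable borel"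
    unfolding e_def cis_conv_exp by measurable
  have ne: "norm (e \<xi>) = exp (- t * \<xi>^2)" for \<xi> by (simp add: e_def norm_mult)
  have i0: "integrable lborel e"
    using heat_fourier(1)[OF assms] by (simp add: e_def[abs_def])
  have i2: "integrable lborel (\<lambda>\<xi>. of_real (\<xi>^2) * e \<xi>)"
    by (rule Bochner_Integration.integrable_bound[OF integrable_exp_square(2)[OF assms]])
       (auto simp: norm_mult ne norm_power)
  have i1: "integrable lborel (\<lambda>\<xi>. of_real \<xi> * e \<xi>)"
  proof (rule Bochner_Integration.integrable_bound)
    show "integrable lborel (\<lambda>\<xi>. exp (- t * \<xi>^2) + \<xi>^2 * exp (- t * \<xi>^2))"
      using integrable_exp_square[OF assms] by auto
    have "\<bar>\<xi>\<bar> \<le> 1 + \<xi>^2" for \<xi> :: real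
      using zero_le_power2[of "\<bar>\<xi>\<bar> - 1"] by (simp add: power2_eq_square algebra_simps)
    then have "\<bar>\<xi>\<bar> * exp (- t * \<xi>^2) \<le> (1 + \<xi>^2) * exp (- t * \<xi>^2)" for \<xi> :: real
      by (intro mult_right_mono) auto
    then show "AE \<xi> in lborel. norm (of_real \<xi> * e \<xi>) \<le> norm (exp (- t * \<xi>^2) + \<xi>^2 * exp (- t * \<xi>^2))"
      by (auto simp: norm_mult ne algebra_simps)
  qed simp
  show "integrable lborel (\<lambda>\<xi>. complex_of_real (\<xi>^2 * exp (- t * \<xi>^2)) * cis (x * \<xi>))"
    using i2 by (simp add: e_def mult_ac)
  have de: "(e has_vector_derivative (of_real (- 2 * t * \<xi>) + \<i> * of_real x) * e \<xi>) (at \<xi>)" for \<xi>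
  proof -
    have "e = (\<lambda>\<xi>. exp (of_real (- t * \<xi>^2) + \<i> * of_real (x * \<xi>)))"
      by (simp add: e_def fun_eq_iff cis_conv_exp algebra_simps flip: exp_of_real exp_add)
    then show ?thesis
      by (auto intro!: derivative_eq_intros has_vector_derivative_real_field simp: field_simps)
  qed
  have ce: "continuous_on UNIV e"
    using de by (meson continuous_at_imp_continuous_on has_vector_derivative_continuous)
  have lim: "((\<lambda>\<xi>. exp (- t * \<xi>^2)) \<longlongrightarrow> 0) at_top" "((\<lambda>\<xi>. exp (- t * \<xi>^2)) \<longlongrightarrow> 0) at_bot"
     "((\<lambda>\<xi>. \<xi> * exp (- t * \<xi>^2)) \<longlongrightarrow> 0) at_top" "((\<lambda>\<xi>. \<xi> * exp (- t * \<xi>^2)) \<longlongrightarrow> 0) at_bot"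
    using assms by real_asymp+
  have m1: "(\<integral>\<xi>. (of_real (- 2 * t * \<xi>) + \<i> * of_real x) * e \<xi> \<partial>lborel) = 0"
  proof (rule integral_derivative_eq_0[OF _ de ce])
    have "integrable lborel (\<lambda>\<xi>. of_real (- 2 * t) * (of_real \<xi> * e \<xi>) + (\<i> * of_real x) * e \<xi>)"
      using i0 i1 by (intro Bochner_Integration.integrable_add integrable_mult_right) auto
    then show "integrable lborel (\<lambda>\<xi>. (of_real (- 2 * t * \<xi>) + \<i> * of_real x) * e \<xi>)"
      by (simp add: algebra_simps)
  qed (use lim in \<open>auto simp: tendsto_norm_zero_iff[symmetric, of e] ne\<close>)
  then have m1': "(\<integral>\<xi>. of_real \<xi> * e \<xi> \<partial>lborel) = \<i> * of_real (x / (2*t)) * (\<integral>\<xi>. e \<xi> \<partial>lborel)"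
  proof -
    have "(\<integral>\<xi>. (of_real (- 2 * t * \<xi>) + \<i> * of_real x) * e \<xi> \<partial>lborel)
       = (\<integral>\<xi>. of_real (- 2 * t) * (of_real \<xi> * e \<xi>) + (\<i> * of_real x) * e \<xi> \<partial>lborel)"
      by (simp add: algebra_simps)
    also have "\<dots> = of_real (- 2 * t) * (\<integral>\<xi>. of_real \<xi> * e \<xi> \<partial>lborel) + (\<i> * of_real x) * (\<integral>\<xi>. e \<xi> \<partial>lborel)"
      using i0 i1 by (subst Bochner_Integration.integral_add) auto
    finally show ?thesis using m1 assms by (simp add: field_simps)
  qed
  have m2: "(\<integral>\<xi>. e \<xi> + of_real \<xi> * ((of_real (- 2 * t * \<xi>) + \<i> * of_real x) * e \<xi>) \<partial>lborel) = 0"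
  proof (rule integral_derivative_eq_0[of "{}" "\<lambda>\<xi>. of_real \<xi> * e \<xi>"])
    show "((\<lambda>\<xi>. of_real \<xi> * e \<xi>) has_vector_derivative
        e \<xi> + of_real \<xi> * ((of_real (- 2 * t * \<xi>) + \<i> * of_real x) * e \<xi>)) (at \<xi>)" for \<xi>
      by (rule has_vector_derivative_eq_rhs[OF has_vector_derivative_mult[OF _ de]])
         (auto intro!: derivative_eq_intros)
    show "continuous_on UNIV (\<lambda>\<xi>. of_real \<xi> * e \<xi>)"
      by (intro continuous_intros ce)
    have "integrable lborel (\<lambda>\<xi>. e \<xi> + (of_real (- 2 * t) * (of_real (\<xi>^2) * e \<xi>) + \<i> * of_real x * (of_real \<xi> * e \<xi>)))"
      using i0 i1 i2 by (intro Bochner_Integration.integrable_add integrable_mult_right) auto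
    then show "integrable lborel (\<lambda>\<xi>. e \<xi> + of_real \<xi> * ((of_real (- 2 * t * \<xi>) + \<i> * of_real x) * e \<xi>))"
      by (simp add: algebra_simps power2_eq_square)
    have n: "norm (of_real \<xi> * e \<xi>) = \<bar>\<xi> * exp (- t * \<xi>^2)\<bar>" for \<xi>
      by (simp add: norm_mult ne abs_mult)
    show "((\<lambda>\<xi>. of_real \<xi> * e \<xi>) \<longlongrightarrow> 0) at_top" "((\<lambda>\<xi>. of_real \<xi> * e \<xi>) \<longlongrightarrow> 0) at_bot"
      using lim(3,4) by (auto simp: tendsto_norm_zero_iff[symmetric, of "\<lambda>\<xi>. of_real \<xi> * e \<xi>"] n
          intro: tendsto_rabs_zero simp del: norm_mult)
  qed simp
  have "(\<integral>\<xi>. e \<xi> + of_real \<xi> * ((of_real (- 2 * t * \<xi>) + \<i> * of_real x) * e \<xi>) \<partial>lborel)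
     = (\<integral>\<xi>. e \<xi> + (of_real (- 2 * t) * (of_real (\<xi>^2) * e \<xi>) + \<i> * of_real x * (of_real \<xi> * e \<xi>)) \<partial>lborel)"
    by (simp add: algebra_simps power2_eq_square)
  also have "\<dots> = (\<integral>\<xi>. e \<xi> \<partial>lborel) + (of_real (- 2 * t) * (\<integral>\<xi>. of_real (\<xi>^2) * e \<xi> \<partial>lborel)
      + \<i> * of_real x * (\<integral>\<xi>. of_real \<xi> * e \<xi> \<partial>lborel))"
    using i0 i1 i2 by (subst Bochner_Integration.integral_add | simp)+
  finally have "of_real (2 * t) * (\<integral>\<xi>. of_real (\<xi>^2) * e \<xi> \<partial>lborel)
     = (1 - of_real (x^2 / (2*t))) * (\<integral>\<xi>. e \<xi> \<partial>lborel)"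
    unfolding m2 m1' by (simp add: algebra_simps power2_eq_square)
  also have "(\<integral>\<xi>. e \<xi> \<partial>lborel) = of_real (2 * pi * heat t x)"
    using heat_fourier(2)[OF assms] by (simp add: e_def)
  finally have "(\<integral>\<xi>. of_real (\<xi>^2) * e \<xi> \<partial>lborel)
      = of_real ((1 - x^2 / (2*t)) * (2 * pi * heat t x) / (2 * t))"
    using assms by (simp add: field_simps)
  also have "(1 - x^2 / (2*t)) * (2 * pi * heat t x) / (2 * t) = - 2 * pi * ddheat t x"
    using assms by (simp add: ddheat_def field_simps power2_eq_square)
  finally show "(\<integral>\<xi>. complex_of_real (\<xi>^2 * exp (- t * \<xi>^2)) * cis (x * \<xi>) \<partial>lborel)
      = of_real (- 2 * pi * ddheat t x)"
    by (simp add: e_def mult_ac)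
qed

section \<open>The heat kernel in the plane\<close>

definition heat2 :: "real \<Rightarrow> real^2 \<Rightarrow> real" where
  "heat2 t v = heat t (v$1) * heat t (v$2)"

definition heat2_11 :: "real \<Rightarrow> real^2 \<Rightarrow> real" where
  "heat2_11 t v = ddheat t (v$1) * heat t (v$2)"

text \<open>By the heat equation the time derivative of the kernel is also its Laplacian.\<close>

definition heat2_time :: "real \<Rightarrow> real^2 \<Rightarrow> real" where
  "heat2_time t v = ddheat t (v$1) * heat t (v$2) + heat t (v$1) * ddheat t (v$2)"

lemma measurable_vec_nth' [measurable (raw)]:
  assumes [measurable]: "f \<in> borel_measurable M"
  shows "(\<lambda>v. (f v :: real^2) $ i) \<in> borel_measurable M"
  by (rule measurable_compose[OF assms measurable_vec_nth])

lemma heat2_measurable [measurable (raw)]: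
  assumes [measurable]: "f \<in> borel_measurable M" "g \<in> borel_measurable M"
  shows "(\<lambda>p. heat2 (f p) (g p)) \<in> borel_measurable M"
    "(\<lambda>p. heat2_11 (f p) (g p)) \<in> borel_measurable M"
    "(\<lambda>p. heat2_time (f p) (g p)) \<in> borel_measurable M"
  unfolding heat2_def heat2_11_def heat2_time_def by measurable

lemma heat2_nonneg [simp]: "t > 0 \<Longrightarrow> heat2 t v \<ge> 0"
  by (simp add: heat2_def)

lemma heat2_deriv_time:
  "t > 0 \<Longrightarrow> ((\<lambda>t. heat2 t v) has_real_derivative heat2_time t v) (at t)"
  unfolding heat2_def heat2_time_def
  by (auto intro!: derivative_eq_intros heat_deriv_time)

lemma heat2_integrable: "0 < t \<Longrightarrow> integrable lborel (\<lambda>y. heat2 t (x - y))"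
  unfolding heat2_def using integrable_vec2_product[OF heat_integrable[of t "x$1"] heat_integrable[of t "x$2"]]
  by (simp add: heat_diff_commute[of t "x$_"])

lemma heat2_integral: "0 < t \<Longrightarrow> (\<integral>y. heat2 t (x - y) \<partial>lborel) = 1"
  unfolding heat2_def using integral_vec2_product[OF heat_integrable[of t "x$1"] heat_integrable[of t "x$2"]]
  by (simp add: heat_diff_commute[of t "x$_"] heat_integral)

lemma
  assumes "0 < s" "0 < t"
  shows heat2_conv_integrable: "integrable lborel (\<lambda>y. heat2 s (x - y) * heat2 t y)"
    and heat2_conv: "(\<integral>y. heat2 s (x - y) * heat2 t y \<partial>lborel) = heat2 (s + t) x"
proof -
  have eq: "heat2 s (x - y) * heat2 t y
     = (heat s (x$1 - y$1) * heat t (y$1)) * (heat s (x$2 - y$2) * heat t (y$2))" for y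
    by (simp add: heat2_def)
  show "integrable lborel (\<lambda>y. heat2 s (x - y) * heat2 t y)"
    unfolding eq using assms by (intro integrable_vec2_product heat_conv_integrable)
  show "(\<integral>y. heat2 s (x - y) * heat2 t y \<partial>lborel) = heat2 (s + t) x"
    unfolding eq using assms
    by (subst integral_vec2_product) (auto simp: heat_conv_integrable heat_conv heat2_def)
qed

lemma heat2_mono_time:
  assumes "0 < t" "t \<le> T"
  shows "heat2 t v \<le> (T / t)^2 * heat2 T v"
proof -
  have "heat2 t v \<le> (T / t * heat T (v$1)) * (T / t * heat T (v$2))"
    unfolding heat2_def using assms by (intro mult_mono heat_mono_time) auto
  then show ?thesis by (simp add: heat2_def power2_eq_square mult_ac)
qed

lemma abs_heat2_11_le:
  assumes "0 < t"
  shows "\<bar>heat2_11 t v\<bar> \<le> 8 / t * heat2 (2*t) v"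
    and "\<bar>heat2_time t v\<bar> \<le> 16 / t * heat2 (2*t) v"
proof -
  have h: "heat t x \<le> 2 * heat (2*t) x" for x
    using heat_mono_time[of t "2*t" x] assms by simp
  have *: "\<bar>ddheat t x * heat t y\<bar> \<le> (4 / t * heat (2*t) x) * (2 * heat (2*t) y)" for x y
    unfolding abs_mult using assms h abs_ddheat_le[OF assms] by (intro mult_mono) auto
  show "\<bar>heat2_11 t v\<bar> \<le> 8 / t * heat2 (2*t) v"
    using *[of "v$1" "v$2"] by (simp add: heat2_11_def heat2_def mult_ac)
  show "\<bar>heat2_time t v\<bar> \<le> 16 / t * heat2 (2*t) v"
    using *[of "v$1" "v$2"] *[of "v$2" "v$1"]
    by (simp add: heat2_time_def heat2_def mult_ac)
qed

lemma heat2_decay: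
  assumes "1 \<le> s"
  shows "heat2 s v \<le> s powr (-1/2) * ((1 + \<bar>v$1\<bar>) powr (-1/2) * (1 + \<bar>v$2\<bar>) powr (-1/2))"
proof -
  have "heat2 s v \<le> (s powr (-1/4) * (1 + \<bar>v$1\<bar>) powr (-1/2)) * (s powr (-1/4) * (1 + \<bar>v$2\<bar>) powr (-1/2))"
    unfolding heat2_def using assms by (intro mult_mono heat_decay) auto
  also have "\<dots> = (s powr (-1/4) * s powr (-1/4)) * ((1 + \<bar>v$1\<bar>) powr (-1/2) * (1 + \<bar>v$2\<bar>) powr (-1/2))"
    by (simp only: mult_ac)
  also have "s powr (-1/4) * s powr (-1/4) = s powr (-1/2)"
    by (simp flip: powr_add)
  finally show ?thesis .
qed

text \<open>The multiplier \<open>- ((\<xi>$1)^2)\<close> is the symbol of the second derivative in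
  the first variable. The Gaussian factors over the coordinates, so a second moment in one variable
  meets a plain Gaussian in the other.\<close>

lemma heat2_fourier_11:
  assumes "0 < t"
  shows "integrable lborel (\<lambda>\<xi>::real^2. complex_of_real (- ((\<xi>$1)^2) * exp (- t * (norm \<xi>)^2)) * cis (x \<bullet> \<xi>))"
    and "(\<integral>\<xi>. complex_of_real (- ((\<xi>$1)^2) * exp (- t * (norm \<xi>)^2)) * cis (x \<bullet> \<xi>) \<partial>lborel)
      = of_real (4 * pi^2 * heat2_11 t x)"
proof -
  have eq: "complex_of_real (- ((\<xi>$1)^2) * exp (- t * (norm \<xi>)^2)) * cis (x \<bullet> \<xi>) =
    - (complex_of_real ((\<xi>$1)^2 * exp (- t * (\<xi>$1)^2)) * cis (x$1 * \<xi>$1)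
      * (complex_of_real (exp (- t * (\<xi>$2)^2)) * cis (x$2 * \<xi>$2)))" for \<xi> :: "real^2"
  proof -
    have "exp (- t * (norm \<xi>)^2) = exp (- t * (\<xi>$1)^2) * exp (- t * (\<xi>$2)^2)"
      by (simp add: norm_sq_vec2 algebra_simps flip: exp_add)
    moreover have "cis (x \<bullet> \<xi>) = cis (x$1 * \<xi>$1) * cis (x$2 * \<xi>$2)"
      by (simp add: cis_mult inner_vec_def sum_2)
    ultimately show ?thesis by simp
  qed
  show "integrable lborel (\<lambda>\<xi>::real^2. complex_of_real (- ((\<xi>$1)^2) * exp (- t * (norm \<xi>)^2)) * cis (x \<bullet> \<xi>))"
    unfolding eq using assms
    by (intro Bochner_Integration.integrable_minus integrable_vec2_product heat_fourier heat_fourier_second_moment)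
  show "(\<integral>\<xi>. complex_of_real (- ((\<xi>$1)^2) * exp (- t * (norm \<xi>)^2)) * cis (x \<bullet> \<xi>) \<partial>lborel)
      = of_real (4 * pi^2 * heat2_11 t x)"
    unfolding eq Bochner_Integration.integral_minus
      integral_vec2_product[OF heat_fourier_second_moment(1)[OF assms] heat_fourier(1)[OF assms]]
      heat_fourier_second_moment(2)[OF assms] heat_fourier(2)[OF assms]
    by (simp add: heat2_11_def power2_eq_square)
qed

section \<open>Weights and Gaussian bounds\<close>

text \<open>The weight dominates the heat kernel at all times \<open>t \<ge> 1\<close>, uniformly in \<open>t\<close>. The spike dominates
  \<open>r powr (-3/2)\<close> off the coordinate axes; on the axes it is \<open>0\<close>, because \<open>0 powr a = 0\<close>.\<close>

definition weight1 :: "real \<Rightarrow> real" where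
  "weight1 t = (1 + \<bar>t\<bar>) powr (-1/2)"

definition weight :: "real^2 \<Rightarrow> real" where
  "weight v = weight1 (v$1) * weight1 (v$2)"

definition spike1 :: "real \<Rightarrow> real" where
  "spike1 t = \<bar>t\<bar> powr (-3/4)"

definition spike :: "real^2 \<Rightarrow> real" where
  "spike v = spike1 (v$1) * spike1 (v$2)"

lemma weight_measurable [measurable]:
  "weight1 \<in> borel_measurable borel" "spike1 \<in> borel_measurable borel"
  "weight \<in> borel_measurable borel" "spike \<in> borel_measurable borel"
  unfolding weight1_def[abs_def] spike1_def[abs_def] weight_def[abs_def] spike_def[abs_def]
  by measurable

lemma weight_pos [simp]: "weight1 t > 0" "weight v > 0"
  by (simp_all add: weight1_def weight_def)

lemma spike_nonneg [simp]: "spike1 t \<ge> 0" "spike v \<ge> 0"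
  by (simp_all add: spike1_def spike_def)

text \<open>The integrand is the derivative of \<open>- 1 / (1 + t powr (1/4))\<close>.\<close>

lemma set_integrable_spike_weight_aux:
  "set_integrable lborel {0<..} (\<lambda>t::real. t powr (-3/4) / (4 * (1 + t powr (1/4))^2))"
proof -
  have "set_integrable lborel (einterval 0 \<infinity>) (\<lambda>t::real. t powr (-3/4) / (4 * (1 + t powr (1/4))^2))"
  proof (rule interval_integral_FTC_nonneg(1)[where F="\<lambda>t. - 1 / (1 + t powr (1/4))" and A="-1" and B=0])
    fix t :: real assume "0 < ereal t"
    then have t: "t > 0" by simp
    then have p: "1 + t powr (1/4) > 0" by (simp add: add_pos_nonneg)
    show "((\<lambda>t. - 1 / (1 + t powr (1/4))) has_real_derivative
        t powr (-3/4) / (4 * (1 + t powr (1/4))^2)) (at t)"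
      using t p by (auto intro!: derivative_eq_intros simp: power2_eq_square divide_simps)
    show "isCont (\<lambda>t. t powr (-3/4) / (4 * (1 + t powr (1/4))^2)) t"
      using t p by (intro continuous_intros) auto
  next
    have "((\<lambda>t::real. - 1 / (1 + t powr (1/4))) \<longlongrightarrow> -1) (at_right 0)" by real_asymp
    then show "(((\<lambda>t. - 1 / (1 + t powr (1/4))) \<circ> real_of_ereal) \<longlongrightarrow> -1) (at_right 0)"
      by (simp add: ereal_tendsto_simps zero_ereal_def)
    have "((\<lambda>t::real. - 1 / (1 + t powr (1/4))) \<longlongrightarrow> 0) at_top" by real_asymp
    then show "(((\<lambda>t. - 1 / (1 + t powr (1/4))) \<circ> real_of_ereal) \<longlongrightarrow> 0) (at_left \<infinity>)"
      by (simp add: ereal_tendsto_simps)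
  qed auto
  moreover have "einterval 0 \<infinity> = {0<..}" by (auto simp: einterval_def)
  ultimately show ?thesis by simp
qed

text \<open>With \<open>a = t powr (1/4)\<close> the weight is at most \<open>4 / (1 + a)^2\<close>,
  which turns the product into a function with an elementary primitive.\<close>

lemma spike1_weight1_le:
  assumes "0 < t"
  shows "spike1 t * weight1 t \<le> 16 * (t powr (-3/4) / (4 * (1 + t powr (1/4))^2))"
proof -
  define a where "a = t powr (1/4)"
  have a: "a > 0" "a^2 = sqrt t" using assms by (simp_all add: a_def powr_power powr_half_sqrt)
  have "(1 + a)^2 \<le> 2 * (1 + a^2)"
    using zero_le_power2[of "a - 1"] by (simp add: power2_eq_square algebra_simps)
  also have "1 + a^2 \<le> 2 * sqrt (1 + t)"
    unfolding a(2) using real_sqrt_ge_one[of "1+t"] real_sqrt_le_mono[of t "1+t"] assms by linarith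
  finally have *: "(1 + a)^2 \<le> 4 * sqrt (1 + t)" by simp
  have "weight1 t = 1 / sqrt (1 + t)"
    using assms powr_minus_divide[of "1 + t" "1/2"] by (simp add: weight1_def powr_half_sqrt)
  also have "\<dots> \<le> 4 / (1 + a)^2"
    using * assms a by (simp add: field_simps add_pos_pos)
  finally have "spike1 t * weight1 t \<le> spike1 t * (4 / (1 + a)^2)"
    by (intro mult_left_mono) auto
  then show ?thesis using assms by (simp add: spike1_def a_def mult_ac)
qed

lemma integrable_spike1_weight1: "integrable lborel (\<lambda>t. spike1 t * weight1 t)"
proof -
  define f where "f t = indicator {0<..} t * (spike1 t * weight1 t)" for t :: real
  have [measurable]: "f \<in> borel_measurable borel" unfolding f_def by measurable
  have f: "integrable lborel f"
  proof (rule Bochner_Integration.integrable_bound)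
    show "integrable lborel (\<lambda>t::real. 16 * (indicator {0<..} t *\<^sub>R (t powr (-3/4) / (4 * (1 + t powr (1/4))^2))))"
      using set_integrable_spike_weight_aux unfolding set_integrable_def by (rule integrable_mult_right)
  qed (use spike1_weight1_le in \<open>auto simp: f_def indicator_def less_imp_le abs_mult\<close>)
  have "integrable lborel (\<lambda>t. f t + f (0 + (-1) * t))"
    using f lborel_integrable_real_affine[OF f, of "-1" 0] by auto
  moreover have "AE t in lborel. f t + f (0 + (-1) * t) = spike1 t * weight1 t"
    using AE_lborel_singleton[of 0]
    by eventually_elim (auto simp: f_def indicator_def spike1_def weight1_def)
  ultimately show ?thesis
    by (subst integrable_cong_AE[symmetric]) auto
qed

lemma integrable_spike_weight: "integrable lborel (\<lambda>v. spike v * weight v)"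
  using integrable_vec2_product[OF integrable_spike1_weight1 integrable_spike1_weight1]
  by (simp add: spike_def weight_def mult_ac)

text \<open>Differentiation under the integral sign in integrated form: the fundamental theorem for
  each z, then Fubini. Integrability of f itself enters only at the two end points.\<close>

lemma integral_diff_eq_integral_derivative:
  fixes f f' :: "real \<Rightarrow> 'b \<Rightarrow> 'a::euclidean_space"
  assumes M: "sigma_finite_measure M" and ab: "a \<le> b"
    and D: "\<And>t z. a \<le> t \<Longrightarrow> t \<le> b \<Longrightarrow> z \<in> space M \<Longrightarrow> ((\<lambda>t. f t z) has_vector_derivative f' t z) (at t)"
    and C: "\<And>z. z \<in> space M \<Longrightarrow> continuous_on {a..b} (\<lambda>t. f' t z)"
    and meas: "(\<lambda>p. f' (fst p) (snd p)) \<in> borel_measurable (borel \<Otimes>\<^sub>M M)"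
    and bound: "\<And>t z. a \<le> t \<Longrightarrow> t \<le> b \<Longrightarrow> z \<in> space M \<Longrightarrow> norm (f' t z) \<le> F z"
    and F: "integrable M F" and fa: "integrable M (f a)" and fb: "integrable M (f b)"
  shows "(\<integral>z. f b z \<partial>M) - (\<integral>z. f a z \<partial>M) = (LINT t:{a..b}|lborel. \<integral>z. f' t z \<partial>M)"
proof -
  interpret M: sigma_finite_measure M by fact
  interpret P: pair_sigma_finite lborel M ..
  note [measurable] = meas borel_measurable_integrable[OF F]
  have [measurable]: "(\<lambda>p. f' (fst p) (snd p)) \<in> borel_measurable (lborel \<Otimes>\<^sub>M M)"
    using meas by (simp cong: measurable_cong_sets sets_pair_measure_cong)
  have [simp]: "integrable lborel (indicat_real {a..b})"
    using ab by (intro integrable_real_indicator) (auto simp: emeasure_lborel_Icc)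
  have i: "integrable (lborel \<Otimes>\<^sub>M M) (\<lambda>(t, z). indicator {a..b} t *\<^sub>R f' t z)"
  proof (rule Bochner_Integration.integrable_bound)
    show "integrable (lborel \<Otimes>\<^sub>M M) (\<lambda>(t, z). indicat_real {a..b} t * F z)"
      by (rule P.Fubini_integrable) (use F in \<open>auto simp: abs_mult\<close>)
    have "AE p in lborel \<Otimes>\<^sub>M M. norm (indicator {a..b} (fst p) *\<^sub>R f' (fst p) (snd p)) \<le> norm (indicat_real {a..b} (fst p) * F (snd p))"
    proof (rule AE_I2)
      fix p :: "real \<times> 'b" assume "p \<in> space (lborel \<Otimes>\<^sub>M M)"
      then have "snd p \<in> space M" by (auto simp: space_pair_measure)
      then show "norm (indicator {a..b} (fst p) *\<^sub>R f' (fst p) (snd p)) \<le> norm (indicat_real {a..b} (fst p) * F (snd p))"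
        using bound[of "fst p" "snd p"] by (auto simp: indicator_def intro: order_trans)
    qed
    then show "AE p in lborel \<Otimes>\<^sub>M M. norm (case p of (t, z) \<Rightarrow> indicator {a..b} t *\<^sub>R f' t z)
       \<le> norm (case p of (t, z) \<Rightarrow> indicat_real {a..b} t * F z)"
      by (simp add: case_prod_unfold)
  qed (simp add: case_prod_unfold)
  have "(\<integral>z. f b z \<partial>M) - (\<integral>z. f a z \<partial>M) = (\<integral>z. f b z - f a z \<partial>M)"
    using fa fb by simp
  also have "\<dots> = (\<integral>z. (\<integral>t. indicator {a..b} t *\<^sub>R f' t z \<partial>lborel) \<partial>M)"
  proof (rule Bochner_Integration.integral_cong[OF refl])
    fix z assume z: "z \<in> space M"
    show "f b z - f a z = (\<integral>t. indicator {a..b} t *\<^sub>R f' t z \<partial>lborel)"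
      by (rule integral_FTC_Icc[OF ab has_vector_derivative_at_within[OF D[OF _ _ z]] C[OF z], symmetric]) auto
  qed
  also have "\<dots> = (\<integral>t. (\<integral>z. indicator {a..b} t *\<^sub>R f' t z \<partial>M) \<partial>lborel)"
    by (rule P.Fubini_integral[OF i])
  also have "\<dots> = (LINT t:{a..b}|lborel. \<integral>z. f' t z \<partial>M)"
    by (simp add: set_lebesgue_integral_def)
  finally show ?thesis .
qed

text \<open>The quotient of \<open>\<phi>\<close> by the Gaussian is continuous, hence bounded on
  the compact support. A Gaussian majorant is chosen because the heat semigroup reproduces it: after
  smoothing for time t the bound is \<open>M * heat2 (t + 1)\<close>, whose time stays above
  1.\<close>

lemma test_fun2_gaussian_bound:
  assumes "test_fun2 \<phi>"
  obtains M where "0 \<le> M" "\<And>v. \<bar>\<phi> v\<bar> \<le> M * heat2 1 v"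
proof -
  define K where "K = closure {x. \<phi> x \<noteq> 0}"
  have K: "compact K" and c: "continuous_on UNIV \<phi>" using assms by (auto simp: test_fun2_def K_def)
  have pos: "heat2 1 v > 0" for v by (simp add: heat2_def heat_def)
  have ch: "continuous_on UNIV (heat2 1)"
    unfolding heat2_def[abs_def] heat_def by (intro continuous_intros) auto
  have "compact ((\<lambda>v. \<bar>\<phi> v\<bar> / heat2 1 v) ` K)"
  proof (rule compact_continuous_image[OF _ K])
    have "continuous_on UNIV (\<lambda>v. \<bar>\<phi> v\<bar> / heat2 1 v)"
      using pos by (intro continuous_on_divide continuous_on_rabs c ch) (metis less_irrefl)
    then show "continuous_on K (\<lambda>v. \<bar>\<phi> v\<bar> / heat2 1 v)"
      by (rule continuous_on_subset) simp
  qed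
  then have "bounded ((\<lambda>v. \<bar>\<phi> v\<bar> / heat2 1 v) ` K)" by (rule compact_imp_bounded)
  then obtain M where "\<forall>y\<in>(\<lambda>v. \<bar>\<phi> v\<bar> / heat2 1 v) ` K. \<bar>y\<bar> \<le> M"
    unfolding bounded_real by blast
  then have M: "\<bar>\<phi> v\<bar> / heat2 1 v \<le> M" if "v \<in> K" for v
    using that abs_le_D1 by blast
  have "\<bar>\<phi> v\<bar> \<le> max M 0 * heat2 1 v" for v
  proof (cases "v \<in> K")
    case True
    then have "\<bar>\<phi> v\<bar> \<le> M * heat2 1 v" using M[OF True] pos[of v] by (simp add: field_simps)
    also have "\<dots> \<le> max M 0 * heat2 1 v" using pos[of v] by (intro mult_right_mono) auto
    finally show ?thesis .
  next
    case False
    then have "\<phi> v = 0" using closure_subset[of "{x. \<phi> x \<noteq> 0}"] by (auto simp: K_def)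
    then show ?thesis using pos[of v] by simp
  qed
  then show ?thesis by (intro that[of "max M 0"]) auto
qed

text \<open>Away from the origin the kernel is a small multiple of the kernel at double time, which
  still has integral 1. The factor of order t / d^2 gives the approximate identity property.\<close>

lemma heat2_tail:
  assumes "0 < t" "0 < d" "d \<le> norm z"
  shows "heat2 t z \<le> 16 * t / d^2 * heat2 (2 * t) z"
proof -
  define w where "w = (norm z)^2 / (8 * t)"
  have d: "d^2 \<le> (norm z)^2" using assms by (intro power_mono) auto
  have w: "d^2 / (8 * t) \<le> w" "w > 0"
    using d assms by (auto simp: w_def divide_right_mono intro!: divide_pos_pos)
  have h: "heat2 s z = exp (- ((norm z)^2) / (4 * s)) / (4 * pi * s)" if "s > 0" for s
  proof -
    have "sqrt (4 * pi * s) * sqrt (4 * pi * s) = 4 * pi * s" using that by simp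
    moreover have "exp (- ((norm z)^2) / (4 * s)) = exp (- ((z$1)^2) / (4 * s)) * exp (- ((z$2)^2) / (4 * s))"
      by (simp add: norm_sq_vec2 diff_divide_distrib flip: exp_add)
    ultimately show ?thesis by (simp add: heat2_def heat_def)
  qed
  have "heat2 t z = 2 * exp (- w) * heat2 (2 * t) z"
  proof -
    have "exp (- ((norm z)^2) / (4 * t)) = exp (- w) * exp (- ((norm z)^2) / (4 * (2 * t)))"
      using assms by (simp add: w_def field_simps flip: exp_add)
    then show ?thesis using assms by (simp add: h field_simps)
  qed
  also have "\<dots> \<le> (2 * (8 * t / d^2)) * heat2 (2 * t) z"
  proof (rule mult_right_mono)
    have "w \<le> exp w" using exp_ge_add_one_self[of w] by linarith
    then have "exp (- w) \<le> 1 / w" using w by (simp add: exp_minus field_simps)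
    also have "\<dots> \<le> 1 / (d^2 / (8 * t))" using w assms by (intro divide_left_mono) auto
    finally show "2 * exp (- w) \<le> 2 * (8 * t / d^2)" by simp
  qed (use assms in simp)
  finally show ?thesis by simp
qed

section \<open>From a heat kernel identity to the Riesz transform\<close>

text \<open>At frequency zero both sides are 0, by the convention for division by zero.\<close>

lemma riesz1_sq_symbol_eq: "riesz1_sq_symbol \<xi> = of_real (- ((\<xi>$1)^2 / (norm \<xi>)^2))"
  by (simp add: riesz1_sq_symbol_def power_mult_distrib power_divide)

lemma vec_nth_sq_le_norm_sq: "(v$1)^2 \<le> (norm (v::real^2))^2"
  by (simp add: norm_sq_vec2)

lemma norm_riesz1_sq_symbol_le: "norm (riesz1_sq_symbol \<xi>) \<le> 1"
  unfolding riesz1_sq_symbol_eq norm_of_real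
  using vec_nth_sq_le_norm_sq[of \<xi>] by (simp add: divide_le_eq)

lemma riesz1_sq_symbol_measurable [measurable]: "riesz1_sq_symbol \<in> borel_measurable borel"
  unfolding riesz1_sq_symbol_eq[abs_def] by measurable

lemma cis_measurable [measurable (raw)]:
  assumes [measurable]: "f \<in> borel_measurable M"
  shows "(\<lambda>p. cis (f p)) \<in> borel_measurable M"
  unfolding cis_conv_exp by measurable

text \<open>Here h stands for the second derivative of the potential in the first variable. The
  assumption \<open>heat_eq\<close> is the equation
  \<open>\<partial>\<^sub>1\<^sup>2 W = \<Delta> h\<close>, tested only on translates of heat
  kernels.\<close>

locale riesz_setup =
  fixes W h \<phi> :: "real^2 \<Rightarrow> real" and C M :: real
  assumes W: "integrable lborel W"
    and h_meas [measurable]: "h \<in> borel_measurable borel"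
    and h_le: "\<And>v. \<bar>h v\<bar> \<le> C * spike v"
    and heat_eq: "\<And>t y. 0 < t \<Longrightarrow>
       (\<integral>x. W x * heat2_11 t (x - y) \<partial>lborel) = (\<integral>x. h x * heat2_time t (x - y) \<partial>lborel)"
    and test: "test_fun2 \<phi>"
    and M: "0 \<le> M" "\<And>v. \<bar>\<phi> v\<bar> \<le> M * heat2 1 v"
begin

lemma W_meas [measurable]: "W \<in> borel_measurable borel"
  using W by auto

lemma phi_cont: "continuous_on UNIV \<phi>"
  using test by (simp add: test_fun2_def)

lemma phi_meas [measurable]: "\<phi> \<in> borel_measurable borel"
  using phi_cont by (rule borel_measurable_continuous_onI)

lemma phi_integrable: "integrable lborel \<phi>"
proof (rule Bochner_Integration.integrable_bound)
  show "integrable lborel (\<lambda>v. M * heat2 1 v)"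
    using heat2_integrable[of 1 0] by (simp add: heat2_def)
qed (use M in auto)

abbreviation phihat :: "real^2 \<Rightarrow> complex" where
  "phihat \<equiv> fourier2 (\<lambda>y. complex_of_real (\<phi> y))"

lemma phihat_integrable: "integrable lborel phihat"
  using test by (simp add: test_fun2_def)

lemma phihat_meas [measurable]: "phihat \<in> borel_measurable borel"
  using phihat_integrable by auto

lemma h_weight_integrable: "integrable lborel (\<lambda>x. \<bar>h x\<bar> * weight x)"
proof (rule Bochner_Integration.integrable_bound)
  show "integrable lborel (\<lambda>v. C * (spike v * weight v))"
    using integrable_spike_weight by simp
  have "\<bar>h v\<bar> * weight v \<le> \<bar>C * (spike v * weight v)\<bar>" for v
  proof -
    have "\<bar>h v\<bar> * weight v \<le> (C * spike v) * weight v"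
      by (intro mult_right_mono h_le) (simp add: less_imp_le)
    then show ?thesis unfolding mult.assoc by (rule order_trans) simp
  qed
  then show "AE v in lborel. norm (\<bar>h v\<bar> * weight v) \<le> norm (C * (spike v * weight v))"
    by (simp add: abs_mult less_imp_le)
qed simp

lemma heat2_le_weight: "1 \<le> s \<Longrightarrow> heat2 s x \<le> s powr (-1/2) * weight x"
  using heat2_decay[of s x] by (simp add: weight_def weight1_def)

lemma heat2_le_weight': "1 \<le> s \<Longrightarrow> heat2 s x \<le> weight x"
proof -
  assume s: "1 \<le> s"
  have "s powr (-1/2) \<le> 1" using powr_mono2'[of "-1/2" 1 s] s by simp
  then have "s powr (-1/2) * weight x \<le> 1 * weight x"
    by (intro mult_right_mono) (auto simp: less_imp_le)
  with heat2_le_weight[OF s, of x] show ?thesis by linarith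
qed

lemma h_heat2_integrable: "1 \<le> s \<Longrightarrow> integrable lborel (\<lambda>x. \<bar>h x\<bar> * heat2 s x)"
  by (rule Bochner_Integration.integrable_bound[OF h_weight_integrable])
     (auto simp: abs_mult intro!: mult_left_mono order_trans[OF heat2_le_weight'])

text \<open>Integrating in y first merges the two kernels into \<open>heat2 (t + 1)\<close>. Its
  time exceeds 1 for every positive t, so the weight controls the remaining integral.\<close>

lemma h_heat2_pair_integrable:
  assumes "0 < t"
  shows "integrable (lborel \<Otimes>\<^sub>M lborel) (\<lambda>(x, y). \<bar>h x\<bar> * (heat2 1 y * heat2 t (x - y)))"
proof (rule lborel_pair.Fubini_integrable)
  have *: "(\<integral>y. norm (\<bar>h x\<bar> * (heat2 1 y * heat2 t (x - y))) \<partial>lborel) = \<bar>h x\<bar> * heat2 (t + 1) x" for x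
    using heat2_conv[OF assms, of 1 x] assms by (simp add: abs_mult mult_ac)
  show "integrable lborel (\<lambda>x. \<integral>y. norm (case (x, y) of (x, y) \<Rightarrow> \<bar>h x\<bar> * (heat2 1 y * heat2 t (x - y))) \<partial>lborel)"
    unfolding prod.case * using h_heat2_integrable[of "t + 1"] assms by simp
  show "AE x in lborel. integrable lborel (\<lambda>y. case (x, y) of (x, y) \<Rightarrow> \<bar>h x\<bar> * (heat2 1 y * heat2 t (x - y)))"
    using heat2_conv_integrable[OF assms, of 1] by (simp add: mult_ac)
qed simp

section \<open>The heat flow of the test function and its pairing with h\<close>

definition smoothed :: "real \<Rightarrow> real^2 \<Rightarrow> real" where
  "smoothed t x = (\<integral>y. \<phi> y * heat2 t (x - y) \<partial>lborel)"

lemma smoothed_integrable: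
  assumes "0 < t" shows "integrable lborel (\<lambda>y. \<phi> y * heat2 t (x - y))"
proof (rule Bochner_Integration.integrable_bound)
  show "integrable lborel (\<lambda>y. M * (heat2 t (x - y) * heat2 1 y))"
    using heat2_conv_integrable[OF assms, of 1] by simp
  show "AE y in lborel. norm (\<phi> y * heat2 t (x - y)) \<le> norm (M * (heat2 t (x - y) * heat2 1 y))"
  proof (rule AE_I2)
    fix y
    have "\<bar>\<phi> y\<bar> * heat2 t (x - y) \<le> (M * heat2 1 y) * heat2 t (x - y)"
      using assms M by (intro mult_right_mono) auto
    then show "norm (\<phi> y * heat2 t (x - y)) \<le> norm (M * (heat2 t (x - y) * heat2 1 y))"
      using assms M by (simp add: abs_mult mult_ac)
  qed
qed simp

lemma abs_smoothed_le:
  assumes "0 < t" shows "\<bar>smoothed t x\<bar> \<le> M * heat2 (t + 1) x"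
proof -
  have "\<bar>smoothed t x\<bar> \<le> (\<integral>y. \<bar>\<phi> y * heat2 t (x - y)\<bar> \<partial>lborel)"
    unfolding smoothed_def by (rule integral_abs_bound)
  also have "\<dots> \<le> (\<integral>y. M * (heat2 t (x - y) * heat2 1 y) \<partial>lborel)"
  proof (rule integral_mono)
    show "integrable lborel (\<lambda>y. \<bar>\<phi> y * heat2 t (x - y)\<bar>)"
      using smoothed_integrable[OF assms] by (rule integrable_abs)
    show "integrable lborel (\<lambda>y. M * (heat2 t (x - y) * heat2 1 y))"
      using heat2_conv_integrable[OF assms, of 1] by simp
    fix y
    have "\<bar>\<phi> y\<bar> * heat2 t (x - y) \<le> (M * heat2 1 y) * heat2 t (x - y)"
      using assms M by (intro mult_right_mono) auto
    then show "\<bar>\<phi> y * heat2 t (x - y)\<bar> \<le> M * (heat2 t (x - y) * heat2 1 y)"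
      using assms M by (simp add: abs_mult mult_ac)
  qed
  also have "\<dots> = M * heat2 (t + 1) x"
    using heat2_conv[OF assms, of 1 x] by simp
  finally show ?thesis .
qed

lemma smoothed_meas [measurable]: "smoothed t \<in> borel_measurable borel"
  unfolding smoothed_def[abs_def] by measurable

text \<open>Approximate identity: continuity of \<open>\<phi>\<close> at x handles the ball of
  radius d, and outside it \<open>heat2_tail\<close> leaves a term of order s / d^2.\<close>

lemma smoothed_tendsto:
  assumes t: "t \<longlonglongrightarrow> 0" "\<And>n. 0 < t n"
  shows "(\<lambda>n. smoothed (t n) x) \<longlonglongrightarrow> \<phi> x"
proof -
  \<comment> \<open>The maximum of \<open>heat2 1\<close> is \<open>1 / (4 * pi)\<close>, so B
    bounds \<open>\<phi>\<close> everywhere.\<close>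
  define B where "B = M / (4 * pi)"
  have B: "\<bar>\<phi> v\<bar> \<le> B" for v
  proof -
    have "heat 1 u \<le> 1 / sqrt (4 * pi)" for u by (simp add: heat_def divide_right_mono)
    then have "heat2 1 v \<le> 1 / sqrt (4 * pi) * (1 / sqrt (4 * pi))"
      unfolding heat2_def by (intro mult_mono) auto
    also have "\<dots> = 1 / (4 * pi)" by simp
    finally have "M * heat2 1 v \<le> M * (1 / (4 * pi))" by (rule mult_left_mono[OF _ M(1)])
    with M(2)[of v] show ?thesis by (simp add: B_def)
  qed
  show ?thesis
  proof (rule LIMSEQ_I)
    fix e :: real assume e: "0 < e"
    have "isCont \<phi> x" using phi_cont by (simp add: continuous_on_eq_continuous_at)
    then obtain d where d: "0 < d" "\<And>y. dist y x < d \<Longrightarrow> \<bar>\<phi> y - \<phi> x\<bar> < e/2"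
      using e unfolding continuous_at_eps_delta dist_real_def by (metis half_gt_zero)
    have *: "\<bar>smoothed s x - \<phi> x\<bar> \<le> e/2 + 32 * B * s / d^2" if s: "0 < s" for s
    proof -
      have "smoothed s x - \<phi> x = (\<integral>y. \<phi> y * heat2 s (x - y) - \<phi> x * heat2 s (x - y) \<partial>lborel)"
        unfolding smoothed_def
        using smoothed_integrable[OF s] heat2_integrable[OF s] heat2_integral[OF s]
        by (subst Bochner_Integration.integral_diff) auto
      also have "\<bar>\<dots>\<bar> \<le> (\<integral>y. \<bar>\<phi> y * heat2 s (x - y) - \<phi> x * heat2 s (x - y)\<bar> \<partial>lborel)"
        by (rule integral_abs_bound)
      also have "\<dots> \<le> (\<integral>y. e/2 * heat2 s (x - y) + 2 * B * (16 * s / d^2) * heat2 (2 * s) (x - y) \<partial>lborel)"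
      proof (rule integral_mono)
        show "integrable lborel (\<lambda>y. \<bar>\<phi> y * heat2 s (x - y) - \<phi> x * heat2 s (x - y)\<bar>)"
          using smoothed_integrable[OF s] heat2_integrable[OF s]
          by (intro integrable_abs Bochner_Integration.integrable_diff integrable_mult_right) auto
        show "integrable lborel (\<lambda>y. e/2 * heat2 s (x - y) + 2 * B * (16 * s / d^2) * heat2 (2 * s) (x - y))"
          using heat2_integrable s by (intro Bochner_Integration.integrable_add integrable_mult_right) auto
        fix y
        have B0: "0 \<le> B" using B[of 0] by linarith
        have eq: "\<bar>\<phi> y * heat2 s (x - y) - \<phi> x * heat2 s (x - y)\<bar> = \<bar>\<phi> y - \<phi> x\<bar> * heat2 s (x - y)"
          using s by (simp add: abs_mult flip: left_diff_distrib)
        show "\<bar>\<phi> y * heat2 s (x - y) - \<phi> x * heat2 s (x - y)\<bar>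
           \<le> e/2 * heat2 s (x - y) + 2 * B * (16 * s / d^2) * heat2 (2 * s) (x - y)"
        proof (cases "dist y x < d")
          case True
          then have "\<bar>\<phi> y - \<phi> x\<bar> * heat2 s (x - y) \<le> e/2 * heat2 s (x - y)"
            using d(2)[OF True] s by (intro mult_right_mono) auto
          moreover have "0 \<le> 2 * B * (16 * s / d^2) * heat2 (2 * s) (x - y)" using B0 s by simp
          ultimately show ?thesis unfolding eq by linarith
        next
          case False
          have "\<bar>\<phi> y - \<phi> x\<bar> * heat2 s (x - y) \<le> (2 * B) * (16 * s / d^2 * heat2 (2 * s) (x - y))"
          proof (rule mult_mono)
            show "\<bar>\<phi> y - \<phi> x\<bar> \<le> 2 * B" using B[of x] B[of y] by linarith
            show "heat2 s (x - y) \<le> 16 * s / d^2 * heat2 (2 * s) (x - y)"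
              using False by (intro heat2_tail s d) (simp add: dist_norm norm_minus_commute)
          qed (use B0 s in auto)
          moreover have "0 \<le> e/2 * heat2 s (x - y)" using e s by simp
          ultimately show ?thesis unfolding eq by (simp add: mult.assoc)
        qed
      qed
      also have "\<dots> = e/2 + 32 * B * s / d^2"
        using heat2_integrable heat2_integral s
        by (subst Bochner_Integration.integral_add) auto
      finally show ?thesis .
    qed
    have "(\<lambda>n. 32 * B * t n / d^2) \<longlonglongrightarrow> 32 * B * 0 / d^2"
      by (intro tendsto_intros t) (use d in auto)
    then have "\<forall>\<^sub>F n in sequentially. 32 * B * t n / d^2 < e/2"
      using e by (intro order_tendstoD(2)) auto
    then have "\<forall>\<^sub>F n in sequentially. norm (smoothed (t n) x - \<phi> x) < e"
    proof eventually_elim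
      case (elim n)
      with *[OF t(2)[of n]] show ?case by simp
    qed
    then show "\<exists>no. \<forall>n\<ge>no. norm (smoothed (t n) x - \<phi> x) < e"
      by (simp add: eventually_sequentially)
  qed
qed


definition h_pairing :: "real \<Rightarrow> real" where
  "h_pairing t = (\<integral>x. h x * smoothed t x \<partial>lborel)"

text \<open>Since \<open>smoothed t\<close> is dominated by a multiple of the weight for all
  positive t, dominated convergence applies at time 0. As h need not be integrable, the limit at
  infinity uses the factor \<open>t powr (-1/2)\<close> that the kernel retains after the weight has
  been split off.\<close>

lemma h_pairing_limits:
  shows "(\<lambda>n. h_pairing (1 / real (Suc n))) \<longlonglongrightarrow> (\<integral>x. h x * \<phi> x \<partial>lborel)"
    and "(\<lambda>n. h_pairing (real (Suc n))) \<longlonglongrightarrow> 0"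
proof -
  have bound: "\<bar>h x * smoothed t x\<bar> \<le> M * (\<bar>h x\<bar> * weight x)" if "0 < t" for t x
  proof -
    have "\<bar>smoothed t x\<bar> \<le> M * weight x"
      using abs_smoothed_le[OF that, of x] mult_left_mono[OF heat2_le_weight'[of "t + 1" x] M(1)] that by simp
    then have "\<bar>h x\<bar> * \<bar>smoothed t x\<bar> \<le> \<bar>h x\<bar> * (M * weight x)"
      by (rule mult_left_mono) simp
    then show ?thesis by (simp add: abs_mult mult_ac)
  qed
  have dom: "integrable lborel (\<lambda>x. M * (\<bar>h x\<bar> * weight x))"
    using h_weight_integrable by simp
  show "(\<lambda>n. h_pairing (1 / real (Suc n))) \<longlonglongrightarrow> (\<integral>x. h x * \<phi> x \<partial>lborel)"
    unfolding h_pairing_def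
  proof (rule integral_dominated_convergence[OF _ _ dom])
    have "(\<lambda>n. 1 / real (Suc n)) \<longlonglongrightarrow> 0" by (rule LIMSEQ_Suc[OF lim_1_over_n])
    then show "AE x in lborel. (\<lambda>n. h x * smoothed (1 / real (Suc n)) x) \<longlonglongrightarrow> h x * \<phi> x"
      by (intro AE_I2 tendsto_mult tendsto_const smoothed_tendsto) auto
    show "AE x in lborel. norm (h x * smoothed (1 / real (Suc n)) x) \<le> M * (\<bar>h x\<bar> * weight x)" for n
      using bound[of "1 / real (Suc n)"] by simp
  qed simp_all
  define I where "I = (\<integral>x. M * (\<bar>h x\<bar> * weight x) \<partial>lborel)"
  have "\<bar>h_pairing t\<bar> \<le> t powr (-1/2) * I" if t: "1 \<le> t" for t
  proof -
    have "\<bar>h_pairing t\<bar> \<le> (\<integral>x. \<bar>h x * smoothed t x\<bar> \<partial>lborel)"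
      unfolding h_pairing_def by (rule integral_abs_bound)
    also have "\<dots> \<le> (\<integral>x. t powr (-1/2) * (M * (\<bar>h x\<bar> * weight x)) \<partial>lborel)"
    proof (rule integral_mono)
      show "integrable lborel (\<lambda>x. \<bar>h x * smoothed t x\<bar>)"
        by (rule Bochner_Integration.integrable_bound[OF dom])
           (use bound[of t] t in \<open>auto intro: order_trans[OF _ abs_ge_self]\<close>)
      fix x
      have "\<bar>smoothed t x\<bar> \<le> M * ((t + 1) powr (-1/2) * weight x)"
        using abs_smoothed_le[of t x] mult_left_mono[OF heat2_le_weight[of "t + 1" x] M(1)] t by simp
      also have "\<dots> \<le> M * (t powr (-1/2) * weight x)"
        using t M by (intro mult_left_mono mult_right_mono powr_mono2') (auto simp: less_imp_le)
      finally have "\<bar>h x\<bar> * \<bar>smoothed t x\<bar> \<le> \<bar>h x\<bar> * (M * (t powr (-1/2) * weight x))"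
        by (rule mult_left_mono) simp
      then show "\<bar>h x * smoothed t x\<bar> \<le> t powr (-1/2) * (M * (\<bar>h x\<bar> * weight x))"
        by (simp add: abs_mult mult_ac)
    qed (use dom in auto)
    finally show ?thesis by (simp add: I_def)
  qed
  then have "\<forall>\<^sub>F n in sequentially. norm (h_pairing (real (Suc n))) \<le> real (Suc n) powr (-1/2) * I"
    by (intro always_eventually) auto
  moreover have "(\<lambda>n. real (Suc n) powr (-1/2) * I) \<longlonglongrightarrow> 0" by real_asymp
  ultimately show "(\<lambda>n. h_pairing (real (Suc n))) \<longlonglongrightarrow> 0"
    by (rule Lim_null_comparison)
qed

text \<open>The time derivative falls on the kernel alone. The order of integration is then
  reversed, so that the inner integral over x is the one occurring in
  \<open>heat_eq\<close>.\<close>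

lemma h_pairing_diff:
  assumes "0 < a" "a \<le> b"
  shows "h_pairing b - h_pairing a
     = (LINT t:{a..b}|lborel. \<integral>y. \<phi> y * (\<integral>x. h x * heat2_time t (x - y) \<partial>lborel) \<partial>lborel)"
proof -
  let ?P = "lborel \<Otimes>\<^sub>M lborel :: ((real^2) \<times> (real^2)) measure"
  have le: "\<bar>h (fst z) * \<phi> (snd z) * k\<bar> \<le> c * (M * (\<bar>h (fst z)\<bar> * (heat2 1 (snd z) * l)))"
    if "\<bar>k\<bar> \<le> c * l" "0 \<le> c" "0 \<le> l" for z k c l
  proof -
    have "\<bar>\<phi> (snd z)\<bar> * \<bar>k\<bar> \<le> (M * heat2 1 (snd z)) * (c * l)"
      using that M by (intro mult_mono) auto
    then have "\<bar>h (fst z)\<bar> * (\<bar>\<phi> (snd z)\<bar> * \<bar>k\<bar>) \<le> \<bar>h (fst z)\<bar> * ((M * heat2 1 (snd z)) * (c * l))"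
      by (rule mult_left_mono) simp
    then show ?thesis by (simp add: abs_mult mult_ac)
  qed
  have dom: "integrable ?P (\<lambda>z. c * (M * (\<bar>h (fst z)\<bar> * (heat2 1 (snd z) * heat2 t (fst z - snd z)))))"
    if "0 < t" for t c
    using h_heat2_pair_integrable[OF that] by (simp add: case_prod_unfold)
  have int: "integrable ?P (\<lambda>z. h (fst z) * \<phi> (snd z) * heat2 t (fst z - snd z))" if "0 < t" for t
  proof (rule Bochner_Integration.integrable_bound[OF dom[OF that, of 1]])
    show "AE z in ?P. norm (h (fst z) * \<phi> (snd z) * heat2 t (fst z - snd z))
       \<le> norm (1 * (M * (\<bar>h (fst z)\<bar> * (heat2 1 (snd z) * heat2 t (fst z - snd z)))))"
    proof (rule AE_I2)
      fix z
      show "norm (h (fst z) * \<phi> (snd z) * heat2 t (fst z - snd z))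
       \<le> norm (1 * (M * (\<bar>h (fst z)\<bar> * (heat2 1 (snd z) * heat2 t (fst z - snd z)))))"
        unfolding real_norm_def
        by (rule order_trans[OF le abs_ge_self]) (use that in auto)
    qed
  qed measurable
  have int': "integrable ?P (\<lambda>z. h (fst z) * \<phi> (snd z) * heat2_time t (fst z - snd z))" if "0 < t" for t
  proof (rule Bochner_Integration.integrable_bound[OF dom[of "2 * t" "16 / t"]])
    show "AE z in ?P. norm (h (fst z) * \<phi> (snd z) * heat2_time t (fst z - snd z))
       \<le> norm (16 / t * (M * (\<bar>h (fst z)\<bar> * (heat2 1 (snd z) * heat2 (2 * t) (fst z - snd z)))))"
    proof (rule AE_I2)
      fix z
      show "norm (h (fst z) * \<phi> (snd z) * heat2_time t (fst z - snd z))
       \<le> norm (16 / t * (M * (\<bar>h (fst z)\<bar> * (heat2 1 (snd z) * heat2 (2 * t) (fst z - snd z)))))"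
        unfolding real_norm_def
        by (rule order_trans[OF le abs_ge_self]) (use abs_heat2_11_le(2)[OF that] that in auto)
    qed
  qed (use that in simp_all)
  have iter: "(\<integral>z. h (fst z) * \<phi> (snd z) * heat2 t (fst z - snd z) \<partial>?P) = h_pairing t" if "0 < t" for t
  proof -
    have "(\<integral>z. h (fst z) * \<phi> (snd z) * heat2 t (fst z - snd z) \<partial>?P)
       = (\<integral>x. (\<integral>y. h x * \<phi> y * heat2 t (x - y) \<partial>lborel) \<partial>lborel)"
      using lborel_pair.integral_fst'[OF int[OF that]] by simp
    then show ?thesis by (simp add: h_pairing_def smoothed_def mult.assoc)
  qed
  have iter': "(\<integral>z. h (fst z) * \<phi> (snd z) * heat2_time t (fst z - snd z) \<partial>?P)
     = (\<integral>y. \<phi> y * (\<integral>x. h x * heat2_time t (x - y) \<partial>lborel) \<partial>lborel)" if "0 < t" for t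
  proof -
    have "(\<integral>z. h (fst z) * \<phi> (snd z) * heat2_time t (fst z - snd z) \<partial>?P)
       = (\<integral>x. (\<integral>y. h x * \<phi> y * heat2_time t (x - y) \<partial>lborel) \<partial>lborel)"
      using lborel_pair.integral_fst'[OF int'[OF that]] by simp
    also have "\<dots> = (\<integral>y. (\<integral>x. h x * \<phi> y * heat2_time t (x - y) \<partial>lborel) \<partial>lborel)"
      by (rule lborel_pair.Fubini_integral[symmetric]) (use int'[OF that] in \<open>simp add: case_prod_unfold\<close>)
    also have "\<dots> = (\<integral>y. (\<integral>x. \<phi> y * (h x * heat2_time t (x - y)) \<partial>lborel) \<partial>lborel)"
      by (simp add: mult_ac)
    finally show ?thesis by simp
  qed
  have "h_pairing b - h_pairing a
    = (LINT t:{a..b}|lborel. \<integral>z. h (fst z) * \<phi> (snd z) * heat2_time t (fst z - snd z) \<partial>?P)"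
    unfolding iter[OF assms(1), symmetric] iter[OF less_le_trans[OF assms], symmetric]
  proof (rule integral_diff_eq_integral_derivative)
    show "sigma_finite_measure ?P" by (simp add: lborel_prod lborel.sigma_finite_measure_axioms)
    show "integrable ?P (\<lambda>z. 16 / a * (b / a)^2 * (M * (\<bar>h (fst z)\<bar> * (heat2 1 (snd z) * heat2 (2 * b) (fst z - snd z)))))"
      by (rule dom) (use assms in simp)
    fix t z assume t: "a \<le> t" "t \<le> b" 
    show "((\<lambda>t. h (fst z) * \<phi> (snd z) * heat2 t (fst z - snd z)) has_vector_derivative
            h (fst z) * \<phi> (snd z) * heat2_time t (fst z - snd z)) (at t)"
      using assms t heat2_deriv_time[of t]
      by (auto intro!: derivative_eq_intros simp flip: has_real_derivative_iff_has_vector_derivative)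
    \<comment> \<open>The majorant must not depend on t: time 2t is replaced by the fixed later time
      2b at the price of a factor bounded by \<open>(b / a)^2\<close>.\<close>
    have "\<bar>heat2_time t (fst z - snd z)\<bar> \<le> 16 / t * heat2 (2 * t) (fst z - snd z)"
      using abs_heat2_11_le(2) assms t by auto
    also have "\<dots> \<le> 16 / a * ((2 * b / (2 * t))^2 * heat2 (2 * b) (fst z - snd z))"
      using assms t by (intro mult_mono heat2_mono_time divide_left_mono) auto
    also have "(2 * b / (2 * t))^2 \<le> (b / a)^2"
      using assms t by (intro power_mono) (auto intro!: divide_left_mono)
    finally have *: "\<bar>heat2_time t (fst z - snd z)\<bar> \<le> 16 / a * (b / a)^2 * heat2 (2 * b) (fst z - snd z)"
      using assms by (simp add: mult_left_mono mult_right_mono divide_right_mono mult.assoc)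
    show "norm (h (fst z) * \<phi> (snd z) * heat2_time t (fst z - snd z))
      \<le> 16 / a * (b / a)^2 * (M * (\<bar>h (fst z)\<bar> * (heat2 1 (snd z) * heat2 (2 * b) (fst z - snd z))))"
      unfolding real_norm_def by (rule le[OF *]) (use assms in auto)
  next
    fix z :: "(real^2) \<times> (real^2)"
    show "continuous_on {a..b} (\<lambda>t. h (fst z) * \<phi> (snd z) * heat2_time t (fst z - snd z))"
      unfolding heat2_time_def heat_def ddheat_def using assms
      by (intro continuous_intros) auto
  qed (use assms int in \<open>auto\<close>)
  also have "\<dots> = (LINT t:{a..b}|lborel. \<integral>y. \<phi> y * (\<integral>x. h x * heat2_time t (x - y) \<partial>lborel) \<partial>lborel)"
    using assms by (intro set_lebesgue_integral_cong) (auto simp: iter')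
  finally show ?thesis .
qed

end

section \<open>The pairing with W on the frequency side\<close>

lemma integrable_pair_mult:
  fixes f :: "'a::euclidean_space \<Rightarrow> 'c::{real_normed_field, banach, second_countable_topology}"
    and g :: "'b::euclidean_space \<Rightarrow> 'c"
  assumes f: "integrable lborel f" and g: "integrable lborel g"
  shows "integrable (lborel \<Otimes>\<^sub>M lborel) (\<lambda>z. f (fst z) * g (snd z))"
proof (rule lborel_pair.Fubini_integrable)
  show "integrable lborel (\<lambda>x. \<integral>y. norm (f (fst (x, y)) * g (snd (x, y))) \<partial>lborel)"
    using f g by (auto simp: norm_mult)
  show "(\<lambda>z. f (fst z) * g (snd z)) \<in> borel_measurable (lborel \<Otimes>\<^sub>M lborel)"
    using borel_measurable_integrable[OF f] borel_measurable_integrable[OF g] by measurable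
qed (use f g in auto)

context riesz_setup
begin

text \<open>Up to sign this multiplier is the t-derivative of the damped symbol. The Gaussian makes
  the double integral absolutely convergent, so the integral over frequencies can be done first and
  gives the explicit kernel.\<close>

lemma phihat_heat_multiplier:
  assumes t: "0 < t"
  shows "(\<integral>\<xi>. of_real (- ((\<xi>$1)^2) * exp (- t * (norm \<xi>)^2)) * phihat \<xi> * cis (x \<bullet> \<xi>) \<partial>lborel)
    = of_real (4 * pi^2 * (\<integral>y. \<phi> y * heat2_11 t (x - y) \<partial>lborel))"
proof -
  define E where "E \<xi> = complex_of_real (- ((\<xi>$1)^2) * exp (- t * (norm \<xi>)^2))" for \<xi> :: "real^2"
  have [measurable]: "E \<in> borel_measurable borel" unfolding E_def by measurable
  have E: "integrable lborel E"
    using heat2_fourier_11(1)[OF t, of 0] by (simp add: E_def[abs_def])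
  have i: "integrable (lborel \<Otimes>\<^sub>M lborel) (\<lambda>(\<xi>, y). of_real (\<phi> y) * (E \<xi> * cis ((x - y) \<bullet> \<xi>)))"
  proof (rule Bochner_Integration.integrable_bound)
    show "integrable (lborel \<Otimes>\<^sub>M lborel) (\<lambda>z::(real^2)\<times>(real^2). E (fst z) * of_real (\<phi> (snd z)))"
      by (rule integrable_pair_mult[OF E]) (simp add: phi_integrable)
  qed (auto simp: norm_mult)
  have "(\<integral>\<xi>. E \<xi> * phihat \<xi> * cis (x \<bullet> \<xi>) \<partial>lborel)
    = (\<integral>\<xi>. (\<integral>y. of_real (\<phi> y) * (E \<xi> * cis ((x - y) \<bullet> \<xi>)) \<partial>lborel) \<partial>lborel)"
  proof (rule Bochner_Integration.integral_cong[OF refl])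
    fix \<xi>
    have "(\<integral>y. of_real (\<phi> y) * (E \<xi> * cis ((x - y) \<bullet> \<xi>)) \<partial>lborel)
      = (\<integral>y. (E \<xi> * cis (x \<bullet> \<xi>)) * (of_real (\<phi> y) * cis (- (y \<bullet> \<xi>))) \<partial>lborel)"
      by (intro Bochner_Integration.integral_cong refl)
         (simp add: inner_diff_left cis_mult mult_ac)
    also have "\<dots> = E \<xi> * phihat \<xi> * cis (x \<bullet> \<xi>)"
      unfolding fourier2_def integral_mult_right_zero by (simp only: mult_ac)
    finally show "E \<xi> * phihat \<xi> * cis (x \<bullet> \<xi>) = (\<integral>y. of_real (\<phi> y) * (E \<xi> * cis ((x - y) \<bullet> \<xi>)) \<partial>lborel)" ..
  qed
  also have "\<dots> = (\<integral>y. (\<integral>\<xi>. of_real (\<phi> y) * (E \<xi> * cis ((x - y) \<bullet> \<xi>)) \<partial>lborel) \<partial>lborel)"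
    by (rule lborel_pair.Fubini_integral[OF i, symmetric])
  also have "\<dots> = (\<integral>y. complex_of_real (\<phi> y * (4 * pi^2 * heat2_11 t (x - y))) \<partial>lborel)"
    using heat2_fourier_11(2)[OF t] by (simp only: integral_mult_right_zero E_def of_real_mult)
  also have "\<dots> = of_real (\<integral>y. \<phi> y * (4 * pi^2 * heat2_11 t (x - y)) \<partial>lborel)"
    by (rule integral_complex_of_real)
  also have "(\<integral>y. \<phi> y * (4 * pi^2 * heat2_11 t (x - y)) \<partial>lborel)
     = (\<integral>y. (4 * pi^2) * (\<phi> y * heat2_11 t (x - y)) \<partial>lborel)"
    by (simp only: mult_ac)
  finally show ?thesis by (simp only: E_def integral_mult_right_zero)
qed

text \<open>The normalising factor of the inverse Fourier transform is left out: at t = 0 this is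
  \<open>4 * pi^2\<close> times the pairing of W with \<open>riesz1_sq_test \<phi>\<close>.\<close>

definition W_pairing :: "real \<Rightarrow> complex" where
  "W_pairing t = (\<integral>z. of_real (W (fst z)) *
     (riesz1_sq_symbol (snd z) * of_real (exp (- t * (norm (snd z))^2)) * phihat (snd z) * cis (fst z \<bullet> snd z))
     \<partial>(lborel \<Otimes>\<^sub>M lborel))"

lemma W_phihat_integrable:
  "integrable (lborel \<Otimes>\<^sub>M lborel) (\<lambda>z. \<bar>W (fst z)\<bar> * norm (phihat (snd z)))"
  using W phihat_integrable by (intro integrable_pair_mult integrable_abs integrable_norm)

lemma norm_W_pairing_integrand_le:
  assumes "norm k \<le> c"
  shows "norm (of_real (W (fst z)) * (k * phihat (snd z) * cis (fst z \<bullet> snd z)))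
    \<le> c * (\<bar>W (fst z)\<bar> * norm (phihat (snd z)))"
proof -
  have "norm k * (\<bar>W (fst z)\<bar> * norm (phihat (snd z))) \<le> c * (\<bar>W (fst z)\<bar> * norm (phihat (snd z)))"
    using assms by (rule mult_right_mono) simp
  then show ?thesis by (simp add: norm_mult mult_ac)
qed

lemma norm_symbol_exp_le:
  assumes "0 \<le> t"
  shows "norm (riesz1_sq_symbol \<xi> * of_real (exp (- t * (norm \<xi>)^2))) \<le> 1"
proof -
  have "norm (riesz1_sq_symbol \<xi>) * exp (- t * (norm \<xi>)^2) \<le> 1 * 1"
    using assms by (intro mult_mono norm_riesz1_sq_symbol_le) auto
  then show ?thesis by (simp add: norm_mult)
qed

lemma W_pairing_integrand_integrable:
  assumes "0 \<le> t"
  shows "integrable (lborel \<Otimes>\<^sub>M lborel) (\<lambda>z. of_real (W (fst z)) *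
     (riesz1_sq_symbol (snd z) * of_real (exp (- t * (norm (snd z))^2)) * phihat (snd z) * cis (fst z \<bullet> snd z)))"
  by (rule Bochner_Integration.integrable_bound[OF W_phihat_integrable])
     (use norm_W_pairing_integrand_le[OF norm_symbol_exp_le[OF assms]] in auto)

text \<open>The damped symbol is bounded by 1, and both W and \<open>phihat\<close> are integrable,
  so one majorant independent of t serves both limits.\<close>

lemma W_pairing_limits:
  shows "(\<lambda>n. W_pairing (1 / real (Suc n))) \<longlonglongrightarrow>
      of_real (4 * pi^2) * (\<integral>x. of_real (W x) * riesz1_sq_test \<phi> x \<partial>lborel)"
    and "(\<lambda>n. W_pairing (real (Suc n))) \<longlonglongrightarrow> 0"
proof -
  have "(\<lambda>n. W_pairing (1 / real (Suc n))) \<longlonglongrightarrow> W_pairing 0"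
    unfolding W_pairing_def
  proof (rule integral_dominated_convergence[OF _ _ W_phihat_integrable])
    have "(\<lambda>n. 1 / real (Suc n)) \<longlonglongrightarrow> 0" by (rule LIMSEQ_Suc[OF lim_1_over_n])
    then show "AE z in lborel \<Otimes>\<^sub>M lborel. (\<lambda>n. of_real (W (fst z)) * (riesz1_sq_symbol (snd z) *
        of_real (exp (- (1 / real (Suc n)) * (norm (snd z))^2)) * phihat (snd z) * cis (fst z \<bullet> snd z)))
      \<longlonglongrightarrow> of_real (W (fst z)) * (riesz1_sq_symbol (snd z) * of_real (exp (- 0 * (norm (snd z))^2)) *
         phihat (snd z) * cis (fst z \<bullet> snd z))"
      by (intro AE_I2 tendsto_intros)
    show "AE z in lborel \<Otimes>\<^sub>M lborel. norm (of_real (W (fst z)) * (riesz1_sq_symbol (snd z) *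
        of_real (exp (- (1 / real (Suc n)) * (norm (snd z))^2)) * phihat (snd z) * cis (fst z \<bullet> snd z)))
      \<le> \<bar>W (fst z)\<bar> * norm (phihat (snd z))" for n
      using norm_W_pairing_integrand_le[OF norm_symbol_exp_le[of "1 / real (Suc n)"]] by auto
  qed simp_all
  also have "W_pairing 0 = (\<integral>x. (\<integral>\<xi>. of_real (W x) *
      (riesz1_sq_symbol \<xi> * phihat \<xi> * cis (x \<bullet> \<xi>)) \<partial>lborel) \<partial>lborel)"
    unfolding W_pairing_def
    using lborel_pair.integral_fst'[OF W_pairing_integrand_integrable[of 0]] by simp
  also have "\<dots> = of_real (4 * pi^2) * (\<integral>x. of_real (W x) * riesz1_sq_test \<phi> x \<partial>lborel)"
  proof -
    have "(\<integral>\<xi>. of_real (W x) * (riesz1_sq_symbol \<xi> * phihat \<xi> * cis (x \<bullet> \<xi>)) \<partial>lborel)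
       = of_real (4 * pi^2) * (of_real (W x) * riesz1_sq_test \<phi> x)" for x
      by (simp add: riesz1_sq_test_def)
    then show ?thesis by (simp only: integral_mult_right_zero)
  qed
  finally show "(\<lambda>n. W_pairing (1 / real (Suc n))) \<longlonglongrightarrow>
      of_real (4 * pi^2) * (\<integral>x. of_real (W x) * riesz1_sq_test \<phi> x \<partial>lborel)" .
  have "(\<lambda>n. W_pairing (real (Suc n))) \<longlonglongrightarrow> (\<integral>z. 0 \<partial>(lborel \<Otimes>\<^sub>M lborel :: ((real^2) \<times> (real^2)) measure))"
    unfolding W_pairing_def
  proof (rule integral_dominated_convergence[OF _ _ W_phihat_integrable])
    show "AE z in lborel \<Otimes>\<^sub>M lborel. (\<lambda>n. of_real (W (fst z)) * (riesz1_sq_symbol (snd z) *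
        of_real (exp (- real (Suc n) * (norm (snd z))^2)) * phihat (snd z) * cis (fst z \<bullet> snd z)))
      \<longlonglongrightarrow> 0"
    proof (rule AE_I2)
      fix z :: "(real^2) \<times> (real^2)"
      have "(\<lambda>n. riesz1_sq_symbol (snd z) * of_real (exp (- real (Suc n) * (norm (snd z))^2))) \<longlonglongrightarrow> 0"
      \<comment> \<open>The Gaussian factor does not decay at frequency zero, but the symbol has the
        value 0 there.\<close>
      proof (cases "snd z = 0")
        case True then show ?thesis by (simp add: riesz1_sq_symbol_eq)
      next
        case False
        then have "(norm (snd z))^2 > 0" by simp
        then have "(\<lambda>n. exp (- real (Suc n) * (norm (snd z))^2)) \<longlonglongrightarrow> 0" by real_asymp
        then have "(\<lambda>n. complex_of_real (exp (- real (Suc n) * (norm (snd z))^2))) \<longlonglongrightarrow> of_real 0"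
          by (rule tendsto_of_real)
        then show ?thesis unfolding of_real_0 by (rule tendsto_mult_right_zero)
      qed
      then show "(\<lambda>n. of_real (W (fst z)) * (riesz1_sq_symbol (snd z) *
        of_real (exp (- real (Suc n) * (norm (snd z))^2)) * phihat (snd z) * cis (fst z \<bullet> snd z))) \<longlonglongrightarrow> 0"
        by (rule tendsto_mult_right_zero[OF tendsto_mult_left_zero[OF tendsto_mult_left_zero]])
    qed
    show "AE z in lborel \<Otimes>\<^sub>M lborel. norm (of_real (W (fst z)) * (riesz1_sq_symbol (snd z) *
        of_real (exp (- real (Suc n) * (norm (snd z))^2)) * phihat (snd z) * cis (fst z \<bullet> snd z)))
      \<le> \<bar>W (fst z)\<bar> * norm (phihat (snd z))" for n
      using norm_W_pairing_integrand_le[OF norm_symbol_exp_le[of "real (Suc n)"]] by auto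
  qed simp_all
  then show "(\<lambda>n. W_pairing (real (Suc n))) \<longlonglongrightarrow> 0" by simp
qed

text \<open>Fubini moves the kernel from \<open>\<phi>\<close> to W, where \<open>heat_eq\<close>
  exchanges the second derivative against W for the Laplacian against h. This is where the two sides
  of the identity meet.\<close>

lemma W_phi_heat_swap:
  assumes "0 < t"
  shows "(\<integral>x. W x * (\<integral>y. \<phi> y * heat2_11 t (x - y) \<partial>lborel) \<partial>lborel)
    = (\<integral>y. \<phi> y * (\<integral>x. h x * heat2_time t (x - y) \<partial>lborel) \<partial>lborel)"
proof -
  \<comment> \<open>The maximum of \<open>heat2 (2 * t)\<close> is \<open>1 / (8 * pi * t)\<close>.
    A bounded kernel leaves a multiple of the integrable product of W and \<open>\<phi>\<close> as
    majorant.\<close>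
  define c where "c = 8 / t * (1 / (8 * pi * t))"
  have c: "\<bar>heat2_11 t v\<bar> \<le> c" for v
  proof -
    have "heat (2 * t) u \<le> 1 / sqrt (4 * pi * (2 * t))" for u
      using assms by (simp add: heat_def divide_right_mono)
    then have "heat2 (2 * t) v \<le> 1 / sqrt (4 * pi * (2 * t)) * (1 / sqrt (4 * pi * (2 * t)))"
      unfolding heat2_def using assms by (intro mult_mono) auto
    also have "\<dots> = 1 / (8 * pi * t)" using assms by simp
    finally have "8 / t * heat2 (2 * t) v \<le> c"
      unfolding c_def using assms by (intro mult_left_mono) auto
    with abs_heat2_11_le(1)[OF assms, of v] show ?thesis by linarith
  qed
  have i: "integrable (lborel \<Otimes>\<^sub>M lborel) (\<lambda>(x, y). W x * (\<phi> y * heat2_11 t (x - y)))"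
  proof (rule Bochner_Integration.integrable_bound)
    show "integrable (lborel \<Otimes>\<^sub>M lborel) (\<lambda>z::(real^2)\<times>(real^2). c * (W (fst z) * \<phi> (snd z)))"
      using integrable_pair_mult[OF W phi_integrable] by simp
    show "AE z in lborel \<Otimes>\<^sub>M lborel. norm (case z of (x, y) \<Rightarrow> W x * (\<phi> y * heat2_11 t (x - y)))
       \<le> norm (c * (W (fst z) * \<phi> (snd z)))"
    proof (rule AE_I2)
      fix z :: "(real^2) \<times> (real^2)"
      obtain x y where z: "z = (x, y)" by (cases z)
      have "\<bar>W x * \<phi> y\<bar> * \<bar>heat2_11 t (x - y)\<bar> \<le> \<bar>W x * \<phi> y\<bar> * \<bar>c\<bar>"
        using c[of "x - y"] by (intro mult_left_mono) auto
      then show "norm (case z of (x, y) \<Rightarrow> W x * (\<phi> y * heat2_11 t (x - y)))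
        \<le> norm (c * (W (fst z) * \<phi> (snd z)))"
        by (simp add: z abs_mult mult_ac)
    qed
  qed simp
  have "(\<integral>x. W x * (\<integral>y. \<phi> y * heat2_11 t (x - y) \<partial>lborel) \<partial>lborel)
     = (\<integral>x. (\<integral>y. W x * (\<phi> y * heat2_11 t (x - y)) \<partial>lborel) \<partial>lborel)" by simp
  also have "\<dots> = (\<integral>y. (\<integral>x. W x * (\<phi> y * heat2_11 t (x - y)) \<partial>lborel) \<partial>lborel)"
    by (rule lborel_pair.Fubini_integral[OF i, symmetric])
  also have "\<dots> = (\<integral>y. (\<integral>x. \<phi> y * (W x * heat2_11 t (x - y)) \<partial>lborel) \<partial>lborel)"
    by (simp only: mult_ac)
  also have "\<dots> = (\<integral>y. \<phi> y * (\<integral>x. W x * heat2_11 t (x - y) \<partial>lborel) \<partial>lborel)" by simp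
  finally show ?thesis using heat_eq[OF assms] by simp
qed

text \<open>The t-derivative of the damped symbol is minus the multiplier of
  \<open>phihat_heat_multiplier\<close>. This is the origin of the minus sign, and hence of the
  representative \<open>- h\<close> for the Riesz transform.\<close>

lemma W_pairing_diff:
  assumes "0 < a" "a \<le> b"
  shows "W_pairing b - W_pairing a = - of_real (4 * pi^2 * (h_pairing b - h_pairing a))"
proof -
  let ?P = "lborel \<Otimes>\<^sub>M lborel :: ((real^2) \<times> (real^2)) measure"
  let ?D = "\<lambda>t z. complex_of_real (W (fst z)) * (of_real (((snd z)$1)^2 * exp (- t * (norm (snd z))^2))
      * phihat (snd z) * cis (fst z \<bullet> snd z))"
  have Dle: "norm (?D t z) \<le> 1 / a * (\<bar>W (fst z)\<bar> * norm (phihat (snd z)))" if "a \<le> t" for t z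
  proof (rule norm_W_pairing_integrand_le)
    define n where "n = (norm (snd z))^2"
    have "a * n \<le> exp (a * n)" using exp_ge_add_one_self[of "a * n"] by linarith
    also have "\<dots> \<le> exp (t * n)" using that by (simp add: n_def mult_right_mono)
    finally have "n * exp (- t * n) \<le> 1 / a"
      using assms by (simp add: exp_minus field_simps)
    moreover have "((snd z)$1)^2 * exp (- t * n) \<le> n * exp (- t * n)"
      unfolding n_def by (intro mult_right_mono vec_nth_sq_le_norm_sq) simp
    ultimately have "((snd z)$1)^2 * exp (- t * n) \<le> 1 / a" by (rule order_trans[rotated])
    then show "norm (complex_of_real (((snd z)$1)^2 * exp (- t * (norm (snd z))^2))) \<le> 1 / a"
      unfolding norm_of_real n_def by (simp add: abs_mult)
  qed
  have Dint: "integrable ?P (?D t)" if "a \<le> t" for t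
    by (rule Bochner_Integration.integrable_bound[where f="\<lambda>z. 1 / a * (\<bar>W (fst z)\<bar> * norm (phihat (snd z)))"])
       (use W_phihat_integrable Dle[OF that] assms in auto)
  have inner: "(\<integral>z. ?D t z \<partial>?P)
     = of_real (- 4 * pi^2 * (\<integral>y. \<phi> y * (\<integral>x. h x * heat2_time t (x - y) \<partial>lborel) \<partial>lborel))" if t: "a \<le> t" for t
  proof -
    have t0: "0 < t" using assms t by simp
    have "(\<integral>z. ?D t z \<partial>?P) = (\<integral>x. (\<integral>\<xi>. ?D t (x, \<xi>) \<partial>lborel) \<partial>lborel)"
      using lborel_pair.integral_fst'[OF Dint[OF t]] by simp
    also have "\<dots> = (\<integral>x. complex_of_real (- 4 * pi^2 * (W x * (\<integral>y. \<phi> y * heat2_11 t (x - y) \<partial>lborel))) \<partial>lborel)"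
    proof (rule Bochner_Integration.integral_cong[OF refl])
      fix x
      have "(\<integral>\<xi>. ?D t (x, \<xi>) \<partial>lborel) = (\<integral>\<xi>. - of_real (W x) *
         (of_real (- ((\<xi>$1)^2) * exp (- t * (norm \<xi>)^2)) * phihat \<xi> * cis (x \<bullet> \<xi>)) \<partial>lborel)"
        by simp
      also have "\<dots> = - of_real (W x) * of_real (4 * pi^2 * (\<integral>y. \<phi> y * heat2_11 t (x - y) \<partial>lborel))"
        unfolding integral_mult_right_zero phihat_heat_multiplier[OF t0] ..
      finally show "(\<integral>\<xi>. ?D t (x, \<xi>) \<partial>lborel)
         = complex_of_real (- 4 * pi^2 * (W x * (\<integral>y. \<phi> y * heat2_11 t (x - y) \<partial>lborel)))"
        by simp
    qed
    also have "\<dots> = complex_of_real (- 4 * pi^2 * (\<integral>x. W x * (\<integral>y. \<phi> y * heat2_11 t (x - y) \<partial>lborel) \<partial>lborel))"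
      by (simp only: integral_complex_of_real integral_mult_right_zero)
    finally show ?thesis unfolding W_phi_heat_swap[OF t0] .
  qed
  have "W_pairing b - W_pairing a = (LINT t:{a..b}|lborel. \<integral>z. ?D t z \<partial>?P)"
    unfolding W_pairing_def
  proof (rule integral_diff_eq_integral_derivative)
    show "sigma_finite_measure ?P" by (simp add: lborel_prod lborel.sigma_finite_measure_axioms)
    show "integrable ?P (\<lambda>z. 1 / a * (\<bar>W (fst z)\<bar> * norm (phihat (snd z))))"
      using W_phihat_integrable by simp
    fix t z assume t: "a \<le> t" "t \<le> b"
    show "norm (?D t z) \<le> 1 / a * (\<bar>W (fst z)\<bar> * norm (phihat (snd z)))" by (rule Dle[OF t(1)])
    \<comment> \<open>Differentiating the Gaussian cancels the denominator of the symbol; at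
      frequency zero both sides vanish.\<close>
    have m: "riesz1_sq_symbol (snd z) * of_real (- ((norm (snd z))^2)) = of_real (((snd z)$1)^2)"
      by (cases "snd z = 0") (simp_all add: riesz1_sq_symbol_eq)
    have "((\<lambda>t. exp (- t * (norm (snd z))^2)) has_vector_derivative
       (- ((norm (snd z))^2) * exp (- t * (norm (snd z))^2))) (at t)"
      unfolding has_real_derivative_iff_has_vector_derivative[symmetric]
      by (auto intro!: derivative_eq_intros)
    then have "((\<lambda>t. complex_of_real (exp (- t * (norm (snd z))^2))) has_vector_derivative
       of_real (- ((norm (snd z))^2) * exp (- t * (norm (snd z))^2))) (at t)"
      by (rule bounded_linear.has_vector_derivative[OF bounded_linear_of_real])
    then have "((\<lambda>t. (of_real (W (fst z)) * riesz1_sq_symbol (snd z) * phihat (snd z) * cis (fst z \<bullet> snd z))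
         * complex_of_real (exp (- t * (norm (snd z))^2))) has_vector_derivative
       (of_real (W (fst z)) * riesz1_sq_symbol (snd z) * phihat (snd z) * cis (fst z \<bullet> snd z))
         * of_real (- ((norm (snd z))^2) * exp (- t * (norm (snd z))^2))) (at t)"
      by (rule has_vector_derivative_mult_right)
    moreover have "(of_real (W (fst z)) * riesz1_sq_symbol (snd z) * phihat (snd z) * cis (fst z \<bullet> snd z))
         * of_real (- ((norm (snd z))^2) * exp (- t * (norm (snd z))^2)) = ?D t z"
      unfolding of_real_mult m[symmetric] by (simp only: mult_ac)
    ultimately show "((\<lambda>t. of_real (W (fst z)) * (riesz1_sq_symbol (snd z) *
        of_real (exp (- t * (norm (snd z))^2)) * phihat (snd z) * cis (fst z \<bullet> snd z))) has_vector_derivative ?D t z) (at t)"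
      by (simp only: mult_ac)
  next
    fix z :: "(real^2) \<times> (real^2)"
    show "continuous_on {a..b} (\<lambda>t. ?D t z)" by (intro continuous_intros)
  qed (use assms W_pairing_integrand_integrable in auto)
  also have "\<dots> = (LINT t:{a..b}|lborel. complex_of_real (- 4 * pi^2 *
      (\<integral>y. \<phi> y * (\<integral>x. h x * heat2_time t (x - y) \<partial>lborel) \<partial>lborel)))"
    by (intro set_lebesgue_integral_cong allI impI inner) simp_all
  also have "\<dots> = complex_of_real (LINT t:{a..b}|lborel. - 4 * pi^2 *
      (\<integral>y. \<phi> y * (\<integral>x. h x * heat2_time t (x - y) \<partial>lborel) \<partial>lborel))"
    by (rule set_integral_complex_of_real)
  also have "\<dots> = complex_of_real (- 4 * pi^2 * (LINT t:{a..b}|lborel.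
      (\<integral>y. \<phi> y * (\<integral>x. h x * heat2_time t (x - y) \<partial>lborel) \<partial>lborel)))"
    by (simp only: set_integral_mult_right)
  finally show ?thesis unfolding h_pairing_diff[OF assms, symmetric] by simp
qed

text \<open>\<open>Q\<close> does not depend on \<open>t\<close> and vanishes at infinity; its value at \<open>0\<close> is the difference of the two sides.\<close>

lemma riesz_pairing:
  "(\<integral>x. complex_of_real (- h x * \<phi> x) \<partial>lborel) = (\<integral>x. of_real (W x) * riesz1_sq_test \<phi> x \<partial>lborel)"
proof -
  define Q where "Q t = W_pairing t + of_real (4 * pi^2 * h_pairing t)" for t
  have Q: "Q b = Q a" if "0 < a" "a \<le> b" for a b
    using W_pairing_diff[OF that] by (simp add: Q_def algebra_simps)
  have "Q (1 / real (Suc n)) = Q (real (Suc n))" for n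
  proof (rule Q[symmetric])
    have "1 / real (Suc n) \<le> 1" by simp
    also have "1 \<le> real (Suc n)" by simp
    finally show "1 / real (Suc n) \<le> real (Suc n)" .
  qed simp
  moreover have "(\<lambda>n. Q (real (Suc n))) \<longlonglongrightarrow> 0 + of_real (4 * pi^2 * 0)"
    unfolding Q_def by (intro tendsto_intros W_pairing_limits h_pairing_limits)
  moreover have "(\<lambda>n. Q (1 / real (Suc n))) \<longlonglongrightarrow>
     of_real (4 * pi^2) * (\<integral>x. of_real (W x) * riesz1_sq_test \<phi> x \<partial>lborel)
       + of_real (4 * pi^2 * (\<integral>x. h x * \<phi> x \<partial>lborel))"
    unfolding Q_def by (intro tendsto_intros W_pairing_limits h_pairing_limits)
  ultimately have "of_real (4 * pi^2) * (\<integral>x. of_real (W x) * riesz1_sq_test \<phi> x \<partial>lborel)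
       + of_real (4 * pi^2 * (\<integral>x. h x * \<phi> x \<partial>lborel)) = 0"
    by (simp add: LIMSEQ_unique)
  then have "of_real (4 * pi^2) * ((\<integral>x. of_real (W x) * riesz1_sq_test \<phi> x \<partial>lborel)
       + of_real (\<integral>x. h x * \<phi> x \<partial>lborel)) = 0"
    by (simp add: algebra_simps)
  then have "(\<integral>x. of_real (W x) * riesz1_sq_test \<phi> x \<partial>lborel) + of_real (\<integral>x. h x * \<phi> x \<partial>lborel) = 0"
    by simp
  then show ?thesis
    by (simp only: integral_complex_of_real mult_minus_left Bochner_Integration.integral_minus of_real_minus)
       (simp add: add_eq_0_iff2)
qed

end

text \<open>In Fourier terms the hypothesis relates \<open>\<xi>\<^sub>1\<^sup>2\<close> times the
  transform of W to \<open>\<bar>\<xi>\<bar>\<^sup>2\<close> times that of h, which leaves h free at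
  frequency zero: a constant could be added. The bound by the spike excludes this, through the decay
  of the heat flow paired with h.\<close>

theorem is_riesz1_sq_of_heat_identity:
  assumes W: "integrable lborel W"
    and h [measurable]: "h \<in> borel_measurable borel"
    and h_le: "\<And>v. \<bar>h v\<bar> \<le> C * spike v"
    and heat_eq: "\<And>t y. 0 < t \<Longrightarrow>
       (\<integral>x. W x * heat2_11 t (x - y) \<partial>lborel) = (\<integral>x. h x * heat2_time t (x - y) \<partial>lborel)"
  shows "is_riesz1_sq W (\<lambda>v. - h v)"
  unfolding is_riesz1_sq_def
proof (intro conjI allI impI)
  show "(\<lambda>v. - h v) \<in> borel_measurable lborel" by simp
next
  fix \<phi> assume test: "test_fun2 \<phi>"
  obtain M where "0 \<le> M" "\<And>v. \<bar>\<phi> v\<bar> \<le> M * heat2 1 v"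
    using test_fun2_gaussian_bound[OF test] by blast
  then interpret riesz_setup W h \<phi> C M
    using assms test by unfold_locales
  show "(\<integral>x. complex_of_real (- h x * \<phi> x) \<partial>lborel) = (\<integral>x. of_real (W x) * riesz1_sq_test \<phi> x \<partial>lborel)"
    by (rule riesz_pairing)
next
  fix K :: "(real^2) set" assume K: "compact K"
  then obtain R where R: "\<And>v. v \<in> K \<Longrightarrow> norm v \<le> R"
    using compact_imp_bounded bounded_iff by metis
  \<comment> \<open>A lower bound for the weight on K, which converts weighted integrability into
    local integrability.\<close>
  define c where "c = ((1 + R) powr (-1/2))^2"
  have "indicat_real K v * \<bar>h v\<bar> * c \<le> \<bar>C * (spike v * weight v)\<bar>" for v
  proof (cases "v \<in> K")
    case True
    have w: "(1 + R) powr (-1/2) \<le> weight1 (v$i)" for i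
      unfolding weight1_def using component_le_norm_cart[of v i] R[OF True]
      by (intro powr_mono2') auto
    have "c \<le> weight v" unfolding c_def weight_def power2_eq_square using w
      by (intro mult_mono) (auto simp: less_imp_le)
    then have "\<bar>h v\<bar> * c \<le> (C * spike v) * weight v"
      using h_le[of v] order_trans[OF abs_ge_zero h_le[of v]] by (intro mult_mono) (auto simp: c_def)
    then show ?thesis unfolding mult.assoc[of C] using True abs_ge_self order_trans by fastforce
  qed simp
  then have star: "indicat_real K v * \<bar>h v\<bar> * c \<le> \<bar>C * (spike v * weight v)\<bar>" for v .
  \<comment> \<open>The radius R is arbitrary when K is empty, so positivity is claimed only in the
    presence of a point of K.\<close>
  have c: "c > 0" if "v \<in> K" for v
  proof -
    have "1 + R > 0" using R[OF that] norm_ge_zero[of v] by linarith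
    then show ?thesis unfolding c_def by simp
  qed
  have le: "indicat_real K v * \<bar>h v\<bar> \<le> \<bar>C * (spike v * weight v) / c\<bar>" for v
  proof (cases "v \<in> K")
    case True
    with star[of v] c[OF True] show ?thesis
      unfolding abs_divide by (simp add: pos_le_divide_eq)
  qed simp
  show "set_integrable lborel K (\<lambda>v. - h v)"
    unfolding set_integrable_def
  proof (rule Bochner_Integration.integrable_bound)
    show "integrable lborel (\<lambda>v. C * (spike v * weight v) / c)"
      using integrable_spike_weight by simp
    have "K \<in> sets borel" using K by (simp add: compact_imp_closed)
    then show "(\<lambda>v. indicat_real K v *\<^sub>R - h v) \<in> borel_measurable lborel" by measurable
  qed (use le in \<open>auto simp: abs_mult\<close>)
qed

section \<open>Integration by parts against the heat kernel\<close>

text \<open>The formula for \<open>ddheat\<close>, solved for \<open>z^2 * heat s z\<close>, reduces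
  this to \<open>abs_ddheat_le\<close>.\<close>

lemma square_heat_le:
  assumes "0 < s"
  shows "z^2 * heat s z \<le> 16 * s * heat (2 * s) z + 2 * s * heat s z"
proof -
  have "z^2 * heat s z = 4 * s^2 * ddheat s z + 2 * s * heat s z"
    using assms by (simp add: ddheat_def field_simps power2_eq_square)
  moreover have "4 * s^2 * ddheat s z \<le> 4 * s^2 * (4 / s * heat (2 * s) z)"
    using abs_ddheat_le[OF assms, of z] by (intro mult_left_mono) auto
  ultimately show ?thesis using assms by (simp add: power2_eq_square)
qed

text \<open>The growth factor is recentred at a, where it is at most
  \<open>(1 + \<bar>a\<bar>) * (2 + z^2)\<close> with z = x - a, and the square is absorbed by
  doubling the time.\<close>

lemma linear_heat_le:
  assumes "0 < s"
  shows "(1 + \<bar>x\<bar>) * heat s (x - a)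
    \<le> (1 + \<bar>a\<bar>) * (2 + 2 * s) * heat s (x - a) + (1 + \<bar>a\<bar>) * (16 * s) * heat (2 * s) (x - a)"
proof -
  define z where "z = x - a"
  have "\<bar>z\<bar> \<le> 1 + z^2"
    using zero_le_power2[of "\<bar>z\<bar> - 1"] by (simp add: power2_eq_square algebra_simps)
  moreover have "1 + \<bar>x\<bar> \<le> (1 + \<bar>a\<bar>) * (1 + \<bar>z\<bar>)"
  proof -
    have "1 + \<bar>x\<bar> \<le> 1 + \<bar>a\<bar> + \<bar>z\<bar>" unfolding z_def by linarith
    also have "\<dots> \<le> 1 + \<bar>a\<bar> + \<bar>z\<bar> + \<bar>a\<bar> * \<bar>z\<bar>" by simp
    also have "\<dots> = (1 + \<bar>a\<bar>) * (1 + \<bar>z\<bar>)" by (simp add: algebra_simps)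
    finally show ?thesis .
  qed
  ultimately have "1 + \<bar>x\<bar> \<le> (1 + \<bar>a\<bar>) * (2 + z^2)"
    using mult_left_mono[of "1 + \<bar>z\<bar>" "2 + z^2" "1 + \<bar>a\<bar>"] by simp
  then have "(1 + \<bar>x\<bar>) * heat s z \<le> (1 + \<bar>a\<bar>) * (2 + z^2) * heat s z"
    using assms by (intro mult_right_mono) auto
  also have "\<dots> = (1 + \<bar>a\<bar>) * (2 * heat s z + z^2 * heat s z)" by (simp add: algebra_simps)
  also have "\<dots> \<le> (1 + \<bar>a\<bar>) * (2 * heat s z + (16 * s * heat (2 * s) z + 2 * s * heat s z))"
    using square_heat_le[OF assms, of z] by (intro mult_left_mono add_left_mono) auto
  finally show ?thesis by (simp add: z_def algebra_simps)
qed

lemma integrable_linear_heat: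
  assumes "0 < s"
  shows "integrable lborel (\<lambda>x. (1 + \<bar>x\<bar>) * heat s (x - a))"
proof (rule Bochner_Integration.integrable_bound)
  show "integrable lborel (\<lambda>x. (1 + \<bar>a\<bar>) * (2 + 2 * s) * heat s (x - a) + (1 + \<bar>a\<bar>) * (16 * s) * heat (2 * s) (x - a))"
    using assms by (intro Bochner_Integration.integrable_add integrable_mult_right heat_integrable) auto
  show "AE x in lborel. norm ((1 + \<bar>x\<bar>) * heat s (x - a)) \<le>
     norm ((1 + \<bar>a\<bar>) * (2 + 2 * s) * heat s (x - a) + (1 + \<bar>a\<bar>) * (16 * s) * heat (2 * s) (x - a))"
  proof (rule AE_I2)
    fix x
    have "0 \<le> (1 + \<bar>x\<bar>) * heat s (x - a)" using assms by simp
    with linear_heat_le[OF assms, of x a] show "norm ((1 + \<bar>x\<bar>) * heat s (x - a)) \<le>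
     norm ((1 + \<bar>a\<bar>) * (2 + 2 * s) * heat s (x - a) + (1 + \<bar>a\<bar>) * (16 * s) * heat (2 * s) (x - a))"
      by simp
  qed
qed simp

text \<open>In contrast to \<open>heat_decay\<close> this covers small times and shifted kernels,
  with a constant depending on both.\<close>

lemma heat_le_weight1:
  assumes "0 < s"
  obtains K where "\<And>x. heat s (x - a) \<le> K * weight1 x"
proof -
  define K where "K = (1 + \<bar>a\<bar>) * (2 + 2 * s) * (1 / sqrt (4 * pi * s)) + (1 + \<bar>a\<bar>) * (16 * s) * (1 / sqrt (4 * pi * (2 * s)))"
  have "heat s (x - a) \<le> K * weight1 x" for x
  proof -
    have h: "heat r z \<le> 1 / sqrt (4 * pi * r)" if "0 < r" for r z
      using that by (simp add: heat_def divide_right_mono)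
    have "(1 + \<bar>a\<bar>) * (2 + 2 * s) * heat s (x - a) + (1 + \<bar>a\<bar>) * (16 * s) * heat (2 * s) (x - a) \<le> K"
      unfolding K_def using assms by (intro add_mono mult_left_mono h) auto
    with linear_heat_le[OF assms, of x a] have "(1 + \<bar>x\<bar>) * heat s (x - a) \<le> K" by linarith
    then have "heat s (x - a) \<le> K * (1 + \<bar>x\<bar>) powr (-1)"
      by (simp add: powr_minus_divide field_simps)
    also have "\<dots> \<le> K * weight1 x"
      unfolding weight1_def K_def using assms by (intro mult_left_mono powr_mono) auto
    finally show ?thesis .
  qed
  then show ?thesis by (rule that)
qed

lemma integrable_spike1_heat:
  assumes "0 < s"
  shows "integrable lborel (\<lambda>x. spike1 x * heat s (x - a))"
proof -
  obtain K where K: "\<And>x. heat s (x - a) \<le> K * weight1 x" using heat_le_weight1[OF assms] by blast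
  show ?thesis
  proof (rule Bochner_Integration.integrable_bound)
    show "integrable lborel (\<lambda>x. K * (spike1 x * weight1 x))"
      using integrable_spike1_weight1 by simp
    have "spike1 x * heat s (x - a) \<le> K * (spike1 x * weight1 x)" for x
      using mult_left_mono[OF K[of x], of "spike1 x"] by (simp add: mult_ac)
    then show "AE x in lborel. norm (spike1 x * heat s (x - a)) \<le> norm (K * (spike1 x * weight1 x))"
      using assms by (intro AE_I2) (auto simp: intro: order_trans[OF _ abs_ge_self])
  qed simp
qed

lemma integrable_mult_ddheat:
  assumes t: "0 < t" and [measurable]: "k \<in> borel_measurable borel"
    and k: "integrable lborel (\<lambda>x. k x * heat (2 * t) (x - a))"
  shows "integrable lborel (\<lambda>x. k x * ddheat t (x - a))"
proof (rule Bochner_Integration.integrable_bound)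
  show "integrable lborel (\<lambda>x. 4 / t * (k x * heat (2 * t) (x - a)))" using k by simp
  have "\<bar>k x\<bar> * \<bar>ddheat t (x - a)\<bar> \<le> \<bar>k x\<bar> * (4 / t * heat (2 * t) (x - a))" for x
    by (intro mult_left_mono abs_ddheat_le t) simp
  then show "AE x in lborel. norm (k x * ddheat t (x - a)) \<le> norm (4 / t * (k x * heat (2 * t) (x - a)))"
    using t by (simp add: abs_mult mult_ac)
qed simp

text \<open>Two integrations by parts at once: \<open>f1 * heat - f * dheat\<close> has derivative
  \<open>f2 * heat - f * ddheat\<close> off X and tends to 0 at infinity. Continuity of
  \<open>f1\<close> across X rules out boundary terms there.\<close>

lemma heat_integration_by_parts:
  fixes f f1 f2 :: "real \<Rightarrow> real"
  assumes t: "0 < t" and X: "finite X"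
    and f: "\<And>x. (f has_real_derivative f1 x) (at x)"
    and f1: "\<And>x. x \<notin> X \<Longrightarrow> (f1 has_real_derivative f2 x) (at x)"
    and cont: "continuous_on UNIV f1"
    and [measurable]: "f2 \<in> borel_measurable borel"
    and fb: "\<And>x. \<bar>f x\<bar> \<le> A * (1 + \<bar>x\<bar>)"
    and f1b: "\<And>x. \<bar>f1 x\<bar> \<le> B" and f2b: "\<And>x. \<bar>f2 x\<bar> \<le> B"
  shows "(\<integral>x. f2 x * heat t (x - a) \<partial>lborel) = (\<integral>x. f x * ddheat t (x - a) \<partial>lborel)"
proof -
  have cf: "continuous_on UNIV f" using f by (meson DERIV_continuous_on has_field_derivative_at_within)
  then have [measurable]: "f \<in> borel_measurable borel" by (rule borel_measurable_continuous_onI)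
  have A: "A \<ge> 0" using fb[of 0] by simp
  have i1: "integrable lborel (\<lambda>x. f2 x * heat t (x - a))"
  proof (rule Bochner_Integration.integrable_bound)
    show "integrable lborel (\<lambda>x. B * heat t (x - a))" using heat_integrable[OF t] by simp
    show "AE x in lborel. norm (f2 x * heat t (x - a)) \<le> norm (B * heat t (x - a))"
      using t by (intro AE_I2) (auto simp: abs_mult intro!: mult_right_mono order_trans[OF f2b abs_ge_self])
  qed simp
  have i2: "integrable lborel (\<lambda>x. f x * ddheat t (x - a))"
  proof (rule integrable_mult_ddheat[OF t])
    show "integrable lborel (\<lambda>x. f x * heat (2 * t) (x - a))"
    proof (rule Bochner_Integration.integrable_bound)
      show "integrable lborel (\<lambda>x. A * ((1 + \<bar>x\<bar>) * heat (2 * t) (x - a)))"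
        using integrable_linear_heat t by simp
      have "\<bar>f x\<bar> * heat (2 * t) (x - a) \<le> (A * (1 + \<bar>x\<bar>)) * heat (2 * t) (x - a)" for x
        using t by (intro mult_right_mono fb) auto
      then show "AE x in lborel. norm (f x * heat (2 * t) (x - a)) \<le> norm (A * ((1 + \<bar>x\<bar>) * heat (2 * t) (x - a)))"
        using t A by (simp add: abs_mult mult_ac)
    qed simp
  qed simp
  have d: "((\<lambda>x. heat t (x - a)) has_real_derivative dheat t (x - a)) (at x)"
    "((\<lambda>x. dheat t (x - a)) has_real_derivative ddheat t (x - a)) (at x)" for x
  proof -
    have e: "((\<lambda>x. x - a) has_real_derivative 1) (at x)" by (auto intro!: derivative_eq_intros)
    show "((\<lambda>x. heat t (x - a)) has_real_derivative dheat t (x - a)) (at x)"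
      "((\<lambda>x. dheat t (x - a)) has_real_derivative ddheat t (x - a)) (at x)"
      using DERIV_chain2[OF heat_deriv(1)[OF t] e] DERIV_chain2[OF heat_deriv(2)[OF t] e] by simp_all
  qed
  have "(\<integral>x. f2 x * heat t (x - a) - f x * ddheat t (x - a) \<partial>lborel) = 0"
  proof (rule integral_derivative_eq_0[OF X])
    show "((\<lambda>x. f1 x * heat t (x - a) - f x * dheat t (x - a)) has_vector_derivative
        f2 x * heat t (x - a) - f x * ddheat t (x - a)) (at x)" if "x \<notin> X" for x
      unfolding has_real_derivative_iff_has_vector_derivative[symmetric]
      by (rule DERIV_cong[OF DERIV_diff[OF DERIV_mult[OF f1[OF that] d(1)] DERIV_mult[OF f d(2)]]]) simp
    show "continuous_on UNIV (\<lambda>x. f1 x * heat t (x - a) - f x * dheat t (x - a))"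
      unfolding heat_def dheat_def using t by (intro continuous_intros cf cont) auto
    show "integrable lborel (\<lambda>x. f2 x * heat t (x - a) - f x * ddheat t (x - a))"
      using i1 i2 by simp
    have bd: "norm (f1 x * heat t (x - a) - f x * dheat t (x - a))
       \<le> B * heat t (x - a) + A * (1 + \<bar>x\<bar>) * \<bar>dheat t (x - a)\<bar>" for x
    proof -
      have "\<bar>f1 x * heat t (x - a)\<bar> \<le> B * heat t (x - a)"
        using f1b[of x] t by (simp add: abs_mult mult_right_mono)
      moreover have "\<bar>f x * dheat t (x - a)\<bar> \<le> A * (1 + \<bar>x\<bar>) * \<bar>dheat t (x - a)\<bar>"
        unfolding abs_mult by (intro mult_right_mono fb) simp
      ultimately show ?thesis unfolding real_norm_def by linarith
    qed
    have "((\<lambda>x. B * heat t (x - a) + A * (1 + \<bar>x\<bar>) * \<bar>dheat t (x - a)\<bar>) \<longlongrightarrow> 0) at_top"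
      "((\<lambda>x. B * heat t (x - a) + A * (1 + \<bar>x\<bar>) * \<bar>dheat t (x - a)\<bar>) \<longlongrightarrow> 0) at_bot"
      unfolding heat_def dheat_def using t by real_asymp+
    then show "((\<lambda>x. f1 x * heat t (x - a) - f x * dheat t (x - a)) \<longlongrightarrow> 0) at_top"
      "((\<lambda>x. f1 x * heat t (x - a) - f x * dheat t (x - a)) \<longlongrightarrow> 0) at_bot"
      using bd by (auto elim!: Lim_null_comparison[rotated])
  qed
  then show ?thesis using i1 i2 by simp
qed

text \<open>A majorant of product form reduces integrability in the plane to one variable at a time.
  This is the reason for using products of one-dimensional spikes and weights in place of radial
  functions.\<close>

lemma integrable_product_bound:
  fixes k :: "real \<Rightarrow> real \<Rightarrow> real" and m p q :: "real \<Rightarrow> real" and C :: real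
  assumes [measurable]: "(\<lambda>p. k (fst p) (snd p)) \<in> borel_measurable (borel \<Otimes>\<^sub>M borel)"
    "p \<in> borel_measurable borel" "q \<in> borel_measurable borel"
    and k: "\<And>x y. \<bar>k x y\<bar> \<le> C * (m x * m y)"
    and p: "integrable lborel (\<lambda>x. m x * p x)" and q: "integrable lborel (\<lambda>y. m y * q y)"
  shows "integrable (lborel \<Otimes>\<^sub>M lborel) (\<lambda>(x, y). k x y * (p x * q y))"
proof (rule Bochner_Integration.integrable_bound)
  show "integrable (lborel \<Otimes>\<^sub>M lborel) (\<lambda>z. C * ((m (fst z) * p (fst z)) * (m (snd z) * q (snd z))))"
    using integrable_pair_mult[OF p q] by simp
  show "AE z in lborel \<Otimes>\<^sub>M lborel. norm (case z of (x, y) \<Rightarrow> k x y * (p x * q y))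
     \<le> norm (C * ((m (fst z) * p (fst z)) * (m (snd z) * q (snd z))))"
  proof (rule AE_I2)
    fix z :: "real \<times> real"
    obtain x y where z: "z = (x, y)" by (cases z)
    have "\<bar>k x y\<bar> \<le> \<bar>C * (m x * m y)\<bar>" using k[of x y] by linarith
    then have "\<bar>k x y\<bar> * \<bar>p x * q y\<bar> \<le> \<bar>C * (m x * m y)\<bar> * \<bar>p x * q y\<bar>"
      by (rule mult_right_mono) simp
    then show "norm (case z of (x, y) \<Rightarrow> k x y * (p x * q y))
     \<le> norm (C * ((m (fst z) * p (fst z)) * (m (snd z) * q (snd z))))"
      by (simp add: z abs_mult mult_ac)
  qed
qed simp

lemma integral_real2_iterated:
  fixes F :: "real \<Rightarrow> real \<Rightarrow> real"
  assumes i: "integrable (lborel \<Otimes>\<^sub>M lborel) (\<lambda>(x, y). F x y)"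
  shows "(\<integral>v. F ((v::real^2)$1) (v$2) \<partial>lborel) = (\<integral>x. \<integral>y. F x y \<partial>lborel \<partial>lborel)"
    and "(\<integral>v. F ((v::real^2)$1) (v$2) \<partial>lborel) = (\<integral>y. \<integral>x. F x y \<partial>lborel \<partial>lborel)"
    and "integrable lborel (\<lambda>v::real^2. F (v$1) (v$2))"
proof -
  have m: "(\<lambda>(x, y). F x y) \<in> borel_measurable (borel \<Otimes>\<^sub>M borel)"
    using borel_measurable_integrable[OF i] by simp
  have [measurable]: "(\<lambda>v::real^2. F (v$1) (v$2)) \<in> borel_measurable borel"
    using measurable_compose[of "\<lambda>v::real^2. (v$1, v$2)" borel, OF _ m] by simp
  show "(\<integral>v. F ((v::real^2)$1) (v$2) \<partial>lborel) = (\<integral>x. \<integral>y. F x y \<partial>lborel \<partial>lborel)"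
    using lborel_pair.integral_fst'[OF i]
    by (subst integral_vec2) (simp_all add: vec2_def case_prod_unfold lborel_prod)
  then show "(\<integral>v. F ((v::real^2)$1) (v$2) \<partial>lborel) = (\<integral>y. \<integral>x. F x y \<partial>lborel \<partial>lborel)"
    using lborel_pair.Fubini_integral[OF i] by simp
  show "integrable lborel (\<lambda>v::real^2. F (v$1) (v$2))"
    using i by (subst integrable_vec2_iff) (simp_all add: vec2_def case_prod_unfold lborel_prod)
qed

text \<open>Regularity is asked along the lines parallel to the axes that miss the origin, because
  the first derivatives of the intended potential blow up there. The bound B may depend on the line,
  and the two omitted lines correspond to null sets of the outer variable.\<close>

locale potential =
  fixes u u1 u11 u2 u22 :: "real \<Rightarrow> real \<Rightarrow> real" and C :: real
  assumes u_meas [measurable]: "(\<lambda>p. u (fst p) (snd p)) \<in> borel_measurable borel"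
    and u11_meas [measurable]: "(\<lambda>p. u11 (fst p) (snd p)) \<in> borel_measurable borel"
    and u22_meas [measurable]: "(\<lambda>p. u22 (fst p) (snd p)) \<in> borel_measurable borel"
    and u_le: "\<And>x y. \<bar>u x y\<bar> \<le> C * ((1 + \<bar>x\<bar>) * (1 + \<bar>y\<bar>))"
    and u11_le: "\<And>x y. \<bar>u11 x y\<bar> \<le> C * (spike1 x * spike1 y)"
    and u22_le: "\<And>x y. \<bar>u22 x y\<bar> \<le> C * (spike1 x * spike1 y)"
    and horizontal: "\<And>y. y \<noteq> 0 \<Longrightarrow> (\<forall>x. ((\<lambda>x. u x y) has_real_derivative u1 x y) (at x)) \<and>
       continuous_on UNIV (\<lambda>x. u1 x y) \<and>
       (\<exists>X. finite X \<and> (\<forall>x. x \<notin> X \<longrightarrow> ((\<lambda>x. u1 x y) has_real_derivative u11 x y) (at x))) \<and>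
       (\<exists>B. \<forall>x. \<bar>u1 x y\<bar> \<le> B \<and> \<bar>u11 x y\<bar> \<le> B)"
    and vertical: "\<And>x. x \<noteq> 0 \<Longrightarrow> (\<forall>y. (u x has_real_derivative u2 x y) (at y)) \<and>
       continuous_on UNIV (u2 x) \<and>
       (\<exists>X. finite X \<and> (\<forall>y. y \<notin> X \<longrightarrow> (u2 x has_real_derivative u22 x y) (at y))) \<and>
       (\<exists>B. \<forall>y. \<bar>u2 x y\<bar> \<le> B \<and> \<bar>u22 x y\<bar> \<le> B)"
begin

lemma pot_meas_curried [measurable (raw)]:
  assumes [measurable]: "f \<in> borel_measurable M" "g \<in> borel_measurable M"
  shows "(\<lambda>z. u (f z) (g z)) \<in> borel_measurable M"
    "(\<lambda>z. u11 (f z) (g z)) \<in> borel_measurable M"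
    "(\<lambda>z. u22 (f z) (g z)) \<in> borel_measurable M"
  using measurable_compose[of "\<lambda>z. (f z, g z)" M borel, OF _ u_meas]
    measurable_compose[of "\<lambda>z. (f z, g z)" M borel, OF _ u11_meas]
    measurable_compose[of "\<lambda>z. (f z, g z)" M borel, OF _ u22_meas]
  by (auto simp: borel_prod[symmetric])

lemma
  assumes t: "0 < t"
  shows u11_heat_integrable: "integrable (lborel \<Otimes>\<^sub>M lborel) (\<lambda>(x, y). u11 x y * (heat t (x - a) * ddheat t (y - b)))"
    and u11_heat_integrable': "integrable (lborel \<Otimes>\<^sub>M lborel) (\<lambda>(x, y). u11 x y * (ddheat t (x - a) * heat t (y - b)))"
    and u22_heat_integrable: "integrable (lborel \<Otimes>\<^sub>M lborel) (\<lambda>(x, y). u22 x y * (ddheat t (x - a) * heat t (y - b)))"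
    and u_heat_integrable: "integrable (lborel \<Otimes>\<^sub>M lborel) (\<lambda>(x, y). u x y * (ddheat t (x - a) * ddheat t (y - b)))"
proof -
  have s: "integrable lborel (\<lambda>x. spike1 x * heat t (x - a))" "integrable lborel (\<lambda>x. spike1 x * ddheat t (x - a))" for a
    using integrable_spike1_heat t by (auto intro: integrable_mult_ddheat)
  have l: "integrable lborel (\<lambda>x. (1 + \<bar>x\<bar>) * ddheat t (x - a))" for a
    using integrable_linear_heat[of "2 * t"] t by (auto intro: integrable_mult_ddheat)
  show "integrable (lborel \<Otimes>\<^sub>M lborel) (\<lambda>(x, y). u11 x y * (heat t (x - a) * ddheat t (y - b)))"
    "integrable (lborel \<Otimes>\<^sub>M lborel) (\<lambda>(x, y). u11 x y * (ddheat t (x - a) * heat t (y - b)))"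
    "integrable (lborel \<Otimes>\<^sub>M lborel) (\<lambda>(x, y). u22 x y * (ddheat t (x - a) * heat t (y - b)))"
    by (rule integrable_product_bound[where m=spike1 and C=C]; simp add: s u11_le u22_le)+
  show "integrable (lborel \<Otimes>\<^sub>M lborel) (\<lambda>(x, y). u x y * (ddheat t (x - a) * ddheat t (y - b)))"
    by (rule integrable_product_bound[where m="\<lambda>x. 1 + \<bar>x\<bar>" and C=C]; simp add: l u_le)
qed

lemma horizontal_by_parts:
  assumes t: "0 < t" and y: "y \<noteq> 0"
  shows "(\<integral>x. u11 x y * heat t (x - a) \<partial>lborel) = (\<integral>x. u x y * ddheat t (x - a) \<partial>lborel)"
proof -
  obtain X B where X: "finite X" "\<And>x. x \<notin> X \<Longrightarrow> ((\<lambda>x. u1 x y) has_real_derivative u11 x y) (at x)"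
      "\<And>x. \<bar>u1 x y\<bar> \<le> B" "\<And>x. \<bar>u11 x y\<bar> \<le> B"
    and d: "\<And>x. ((\<lambda>x. u x y) has_real_derivative u1 x y) (at x)" "continuous_on UNIV (\<lambda>x. u1 x y)"
    using horizontal[OF y] by blast
  show ?thesis
    by (rule heat_integration_by_parts[OF t X(1) d(1) X(2) d(2) _ _ X(3,4), where A="C * (1 + \<bar>y\<bar>)"])
       (use u_le[of _ y] in \<open>simp_all add: mult_ac\<close>)
qed

lemma vertical_by_parts:
  assumes t: "0 < t" and x: "x \<noteq> 0"
  shows "(\<integral>y. u22 x y * heat t (y - b) \<partial>lborel) = (\<integral>y. u x y * ddheat t (y - b) \<partial>lborel)"
proof -
  obtain X B where X: "finite X" "\<And>y. y \<notin> X \<Longrightarrow> (u2 x has_real_derivative u22 x y) (at y)"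
      "\<And>y. \<bar>u2 x y\<bar> \<le> B" "\<And>y. \<bar>u22 x y\<bar> \<le> B"
    and d: "\<And>y. (u x has_real_derivative u2 x y) (at y)" "continuous_on UNIV (u2 x)"
    using vertical[OF x] by blast
  show ?thesis
    by (rule heat_integration_by_parts[OF t X(1) d(1) X(2) d(2) _ _ X(3,4), where A="C * (1 + \<bar>x\<bar>)"])
       (use u_le[of x] in \<open>simp_all add: mult_ac\<close>)
qed

text \<open>With G the kernel, vertical integration by parts turns \<open>u22 * G11\<close> into
  \<open>u * G1122\<close>, and horizontal integration by parts turns this into
  \<open>u11 * G22\<close>. Adding the integral of \<open>u11 * G11\<close> to both ends gives the
  Laplacian of u on the left and that of G on the right.\<close>

lemma heat_identity:
  assumes t: "0 < t"
  shows "(\<integral>v. (u11 (v$1) (v$2) + u22 (v$1) (v$2)) * heat2_11 t (v - w) \<partial>lborel)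
    = (\<integral>v. u11 (v$1) (v$2) * heat2_time t (v - w) \<partial>lborel)"
proof -
  define a b where "a = w$1" and "b = w$2"
  have "(\<integral>v. u22 ((v::real^2)$1) (v$2) * (ddheat t (v$1 - a) * heat t (v$2 - b)) \<partial>lborel)
     = (\<integral>x. \<integral>y. u22 x y * (ddheat t (x - a) * heat t (y - b)) \<partial>lborel \<partial>lborel)"
    by (rule integral_real2_iterated(1)[OF u22_heat_integrable[OF t]])
  also have "\<dots> = (\<integral>x. ddheat t (x - a) * (\<integral>y. u22 x y * heat t (y - b) \<partial>lborel) \<partial>lborel)"
    unfolding integral_mult_right_zero[symmetric] by (simp only: mult_ac)
  also have "\<dots> = (\<integral>x. ddheat t (x - a) * (\<integral>y. u x y * ddheat t (y - b) \<partial>lborel) \<partial>lborel)"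
  \<comment> \<open>Integration by parts fails to be available only on the line through the origin,
    a single value of x.\<close>
  proof (rule integral_cong_AE)
    show "AE x in lborel. ddheat t (x - a) * (\<integral>y. u22 x y * heat t (y - b) \<partial>lborel) = ddheat t (x - a) * (\<integral>y. u x y * ddheat t (y - b) \<partial>lborel)"
      using AE_lborel_singleton[of 0] by eventually_elim (simp add: vertical_by_parts[OF t])
  qed measurable
  also have "\<dots> = (\<integral>x. \<integral>y. u x y * (ddheat t (x - a) * ddheat t (y - b)) \<partial>lborel \<partial>lborel)"
    unfolding integral_mult_right_zero[symmetric] by (simp only: mult_ac)
  also have "\<dots> = (\<integral>y. \<integral>x. u x y * (ddheat t (x - a) * ddheat t (y - b)) \<partial>lborel \<partial>lborel)"
    by (rule lborel_pair.Fubini_integral[OF u_heat_integrable[OF t], symmetric])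
  also have "\<dots> = (\<integral>y. ddheat t (y - b) * (\<integral>x. u x y * ddheat t (x - a) \<partial>lborel) \<partial>lborel)"
    unfolding integral_mult_right_zero[symmetric] by (simp only: mult_ac)
  also have "\<dots> = (\<integral>y. ddheat t (y - b) * (\<integral>x. u11 x y * heat t (x - a) \<partial>lborel) \<partial>lborel)"
  proof (rule integral_cong_AE)
    show "AE y in lborel. ddheat t (y - b) * (\<integral>x. u x y * ddheat t (x - a) \<partial>lborel) = ddheat t (y - b) * (\<integral>x. u11 x y * heat t (x - a) \<partial>lborel)"
      using AE_lborel_singleton[of 0] by eventually_elim (simp add: horizontal_by_parts[OF t])
  qed measurable
  also have "\<dots> = (\<integral>y. \<integral>x. u11 x y * (heat t (x - a) * ddheat t (y - b)) \<partial>lborel \<partial>lborel)"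
    unfolding integral_mult_right_zero[symmetric] by (simp only: mult_ac)
  also have "\<dots> = (\<integral>v. u11 ((v::real^2)$1) (v$2) * (heat t (v$1 - a) * ddheat t (v$2 - b)) \<partial>lborel)"
    by (rule integral_real2_iterated(2)[OF u11_heat_integrable[OF t], symmetric])
  finally have eq: "(\<integral>v. u22 ((v::real^2)$1) (v$2) * (ddheat t (v$1 - a) * heat t (v$2 - b)) \<partial>lborel)
    = (\<integral>v. u11 ((v::real^2)$1) (v$2) * (heat t (v$1 - a) * ddheat t (v$2 - b)) \<partial>lborel)" .
  note i = integral_real2_iterated(3)[OF u22_heat_integrable[OF t, of a b]]
    integral_real2_iterated(3)[OF u11_heat_integrable[OF t, of a b]]
    integral_real2_iterated(3)[OF u11_heat_integrable'[OF t, of a b]]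
  show ?thesis
    unfolding heat2_11_def heat2_time_def vector_minus_component a_def[symmetric] b_def[symmetric]
      distrib_left distrib_right
    using i eq by simp
qed

end

section \<open>The potential\<close>

text \<open>A \<open>C\<^sup>1\<close> function that equals \<open>\<bar>s\<bar>\<close> for \<open>\<bar>s\<bar> \<ge> 1/4\<close> and \<open>2 s\<^sup>2 + 1/8\<close> for \<open>\<bar>s\<bar> \<le> 1/4\<close>.\<close>

definition smooth_abs :: "real \<Rightarrow> real" where
  "smooth_abs s = 2 * s^2 + 1/8 - 2 * (max 0 (s - 1/4))^2 - 2 * (max 0 (- s - 1/4))^2"

definition smooth_abs1 :: "real \<Rightarrow> real" where
  "smooth_abs1 s = 4 * s - 4 * max 0 (s - 1/4) + 4 * max 0 (- s - 1/4)"

definition smooth_abs2 :: "real \<Rightarrow> real" where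
  "smooth_abs2 s = (if \<bar>s\<bar> \<le> 1/4 then 4 else 0)"

text \<open>Among even quadratics, \<open>2 * s^2 + 1/8\<close> is the one that agrees with
  \<open>\<bar>s\<bar>\<close> in value and slope at 1/4 and -1/4.\<close>

lemma smooth_abs_inside: "\<bar>s\<bar> \<le> 1/4 \<Longrightarrow> smooth_abs s = 2 * s^2 + 1/8" "\<bar>s\<bar> \<le> 1/4 \<Longrightarrow> smooth_abs1 s = 4 * s"
  by (auto simp: smooth_abs_def smooth_abs1_def max_def)

lemma smooth_abs_outside: "1/4 \<le> \<bar>s\<bar> \<Longrightarrow> smooth_abs s = \<bar>s\<bar>" "1/4 \<le> \<bar>s\<bar> \<Longrightarrow> smooth_abs1 s = sgn s"
  by (auto simp: smooth_abs_def smooth_abs1_def max_def abs_if sgn_if power2_eq_square algebra_simps split: if_splits)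

text \<open>Squared positive parts are continuously differentiable, so writing
  \<open>smooth_abs\<close> through them spares any gluing of derivatives at the edges of the
  wedge.\<close>

lemma has_real_derivative_max_0_square:
  "((\<lambda>z::real. (max 0 z)^2) has_real_derivative 2 * max 0 x) (at x)"
proof (cases x "0::real" rule: linorder_cases)
  case less
  have "((\<lambda>z::real. 0) has_real_derivative 0) (at x)" by simp
  then have "((\<lambda>z::real. (max 0 z)^2) has_real_derivative 0) (at x)"
    by (rule has_field_derivative_transform_within_open[of _ _ _ "{..<0}"]) (use less in auto)
  with less show ?thesis by simp
next
  case greater
  have "((\<lambda>z::real. z^2) has_real_derivative 2 * x) (at x)" by (auto intro!: derivative_eq_intros)
  then have "((\<lambda>z::real. (max 0 z)^2) has_real_derivative 2 * x) (at x)"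
    by (rule has_field_derivative_transform_within_open[of _ _ _ "{0<..}"]) (use greater in auto)
  with greater show ?thesis by simp
next
  case equal
  have "((\<lambda>h::real. (max 0 h)^2 / h) \<longlongrightarrow> 0) (at 0)"
  proof (rule Lim_null_comparison)
    show "\<forall>\<^sub>F h::real in at 0. norm ((max 0 h)^2 / h) \<le> \<bar>h\<bar>"
      by (rule always_eventually) (auto simp: max_def power2_eq_square)
    show "((\<lambda>h::real. \<bar>h\<bar>) \<longlongrightarrow> 0) (at 0)" by (rule tendsto_rabs_zero) (rule tendsto_ident_at)
  qed
  with equal show ?thesis by (simp add: DERIV_def)
qed

lemma smooth_abs_deriv: "(smooth_abs has_real_derivative smooth_abs1 s) (at s)"
proof -
  have 1: "((\<lambda>s. (max 0 (s - 1/4))^2) has_real_derivative 2 * max 0 (s - 1/4) * 1) (at s)"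
    by (rule DERIV_chain2[OF has_real_derivative_max_0_square]) (auto intro!: derivative_eq_intros)
  have 2: "((\<lambda>s. (max 0 (- s - 1/4))^2) has_real_derivative 2 * max 0 (- s - 1/4) * (-1)) (at s)"
    by (rule DERIV_chain2[OF has_real_derivative_max_0_square]) (auto intro!: derivative_eq_intros)
  show ?thesis
    unfolding smooth_abs_def[abs_def] smooth_abs1_def by (rule derivative_eq_intros 1 2 refl | simp)+
qed

lemma smooth_abs1_deriv:
  assumes "\<bar>s\<bar> \<noteq> 1/4"
  shows "(smooth_abs1 has_real_derivative smooth_abs2 s) (at s)"
proof -
  consider "\<bar>s\<bar> < 1/4" | "1/4 < s" | "s < -1/4" using assms by linarith
  then show ?thesis
  proof cases
    case 1
    have "((\<lambda>s. 4 * s) has_real_derivative 4) (at s)" by (auto intro!: derivative_eq_intros)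
    then have "(smooth_abs1 has_real_derivative 4) (at s)"
      by (rule has_field_derivative_transform_within_open[of _ _ _ "{-1/4<..<1/4}"]) (use 1 in \<open>auto simp: smooth_abs_inside\<close>)
    with 1 show ?thesis by (simp add: smooth_abs2_def)
  next
    case 2
    have "((\<lambda>s. 1) has_real_derivative 0) (at s)" by simp
    then have "(smooth_abs1 has_real_derivative 0) (at s)"
      by (rule has_field_derivative_transform_within_open[of _ _ _ "{1/4<..}"]) (use 2 in \<open>auto simp: smooth_abs_outside\<close>)
    with 2 show ?thesis by (simp add: smooth_abs2_def)
  next
    case 3
    have "((\<lambda>s. -1) has_real_derivative 0) (at s)" by simp
    then have "(smooth_abs1 has_real_derivative 0) (at s)"
      by (rule has_field_derivative_transform_within_open[of _ _ _ "{..<-1/4}"]) (use 3 in \<open>auto simp: smooth_abs_outside\<close>)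
    with 3 show ?thesis by (simp add: smooth_abs2_def)
  qed
qed

lemma smooth_abs_ge: "1/8 \<le> smooth_abs s"
  by (cases "\<bar>s\<bar> \<le> 1/4") (auto simp: smooth_abs_inside smooth_abs_outside)

lemma smooth_abs_le: "\<bar>s\<bar> \<le> 1 \<Longrightarrow> smooth_abs s \<le> 1"
proof (cases "\<bar>s\<bar> \<le> 1/4")
  case True
  then have "s^2 \<le> (1/4)^2" by (metis abs_ge_zero power2_abs power_mono)
  with True show ?thesis by (simp add: smooth_abs_inside power2_eq_square)
qed (simp add: smooth_abs_outside)

lemma abs_smooth_abs1_le: "\<bar>smooth_abs1 s\<bar> \<le> 1"
  by (cases "\<bar>s\<bar> \<le> 1/4") (auto simp: smooth_abs_inside smooth_abs_outside sgn_if)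

section \<open>The angular profile\<close>

text \<open>With s = y / r, \<open>sqrt (2 * (r + \<bar>y\<bar>))\<close> is \<open>sqrt r\<close>
  times \<open>sqrt (2 + 2 * \<bar>s\<bar>)\<close>; this is the second factor with
  \<open>\<bar>s\<bar>\<close> smoothed.\<close>

definition ang :: "real \<Rightarrow> real" where "ang s = sqrt (2 + 2 * smooth_abs s)"
definition ang1 :: "real \<Rightarrow> real" where "ang1 s = smooth_abs1 s / ang s"
definition ang2 :: "real \<Rightarrow> real" where "ang2 s = smooth_abs2 s / ang s - (smooth_abs1 s)^2 / (ang s)^3"

lemma ang_sq: "(ang s)^2 = 2 + 2 * smooth_abs s"
  using smooth_abs_ge[of s] by (simp add: ang_def)

text \<open>The value 3/2 is attained at s = 0, since 2 + 2/8 = (3/2)^2.\<close>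

lemma ang_ge: "3/2 \<le> ang s"
  unfolding ang_def using smooth_abs_ge[of s] by (intro real_le_rsqrt) (simp add: power2_eq_square)

lemma ang_pos [simp]: "0 < ang s"
  using ang_ge[of s] by simp

lemma ang_neq_0 [simp]: "ang s \<noteq> 0"
  using ang_pos[of s] by (metis less_irrefl)

lemma ang_le: "\<bar>s\<bar> \<le> 1 \<Longrightarrow> ang s \<le> 2"
  unfolding ang_def using smooth_abs_le[of s] by (intro real_le_lsqrt) auto

lemma abs_ang1_le: "\<bar>ang1 s\<bar> \<le> 1"
  unfolding ang1_def abs_divide using abs_smooth_abs1_le[of s] ang_ge[of s] by (simp add: divide_le_eq)

lemma abs_ang2_le: "\<bar>ang2 s\<bar> \<le> 4"
proof -
  have "\<bar>smooth_abs2 s / ang s\<bar> \<le> 3"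
    using ang_ge[of s] by (simp add: smooth_abs2_def divide_le_eq)
  moreover have "\<bar>(smooth_abs1 s)^2 / (ang s)^3\<bar> \<le> 1"
  proof -
    have "(smooth_abs1 s)^2 \<le> 1" using abs_smooth_abs1_le[of s] by (simp add: abs_square_le_1)
    moreover have "1 \<le> (ang s)^3" using ang_ge[of s] by (intro one_le_power) simp
    moreover have "\<bar>(smooth_abs1 s)^2 / (ang s)^3\<bar> = (smooth_abs1 s)^2 / (ang s)^3"
      by (intro abs_of_nonneg divide_nonneg_pos) auto
    ultimately show ?thesis by (simp add: divide_le_eq)
  qed
  ultimately show ?thesis unfolding ang2_def by linarith
qed

lemma ang_deriv: "(ang has_real_derivative ang1 s) (at s)"
proof -
  have "((\<lambda>s. sqrt (2 + 2 * smooth_abs s)) has_real_derivative (inverse (sqrt (2 + 2 * smooth_abs s)) / 2 * (2 * smooth_abs1 s))) (at s)"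
    by (rule DERIV_chain2[OF DERIV_real_sqrt]) (use smooth_abs_ge[of s] in \<open>auto intro!: derivative_eq_intros smooth_abs_deriv\<close>)
  moreover have "inverse (sqrt (2 + 2 * smooth_abs s)) / 2 * (2 * smooth_abs1 s) = ang1 s"
    by (simp add: ang1_def ang_def) (simp only: divide_inverse mult.commute)
  moreover have "ang = (\<lambda>s. sqrt (2 + 2 * smooth_abs s))" by (simp add: ang_def fun_eq_iff)
  ultimately show ?thesis by simp
qed

lemma ang1_deriv:
  assumes "\<bar>s\<bar> \<noteq> 1/4"
  shows "(ang1 has_real_derivative ang2 s) (at s)"
proof -
  have "((\<lambda>s. smooth_abs1 s / ang s) has_real_derivative (smooth_abs2 s * ang s - smooth_abs1 s * ang1 s) / (ang s * ang s)) (at s)"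
    by (intro DERIV_divide smooth_abs1_deriv ang_deriv assms) simp
  moreover have "(smooth_abs2 s * ang s - smooth_abs1 s * ang1 s) / (ang s * ang s) = ang2 s"
    using ang_pos[of s] by (simp add: ang1_def ang2_def power2_eq_square power3_eq_cube field_simps)
  ultimately show ?thesis unfolding ang1_def[abs_def] by simp
qed

text \<open>The square of \<open>ang\<close> is a quadratic polynomial here, so \<open>ang2\<close>
  times the cube of \<open>ang\<close> is the constant
  \<open>4 * (ang s)^2 - 16 * s^2 = 9\<close>.\<close>

lemma ang_inside:
  assumes "\<bar>s\<bar> \<le> 1/4"
  shows "(ang s)^2 = 9/4 + 4 * s^2" "ang1 s = 4 * s / ang s" "ang2 s = 9 / (ang s)^3"
proof -
  show v: "(ang s)^2 = 9/4 + 4 * s^2" using assms by (simp add: ang_sq smooth_abs_inside)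
  show "ang1 s = 4 * s / ang s" using assms by (simp add: ang1_def smooth_abs_inside)
  have "ang2 s = (4 * (ang s)^2 - 16 * s^2) / (ang s)^3"
    using assms by (simp add: ang2_def smooth_abs_inside smooth_abs2_def divide_simps power2_eq_square power3_eq_cube)
  then show "ang2 s = 9 / (ang s)^3" unfolding v by simp
qed

lemma ang_outside:
  assumes "1/4 < \<bar>s\<bar>"
  shows "(ang s)^2 = 2 + 2 * \<bar>s\<bar>" "ang1 s = sgn s / ang s" "ang2 s = - 1 / (ang s)^3"
proof -
  show "(ang s)^2 = 2 + 2 * \<bar>s\<bar>" unfolding ang_sq using assms by (simp add: smooth_abs_outside)
  show "ang1 s = sgn s / ang s" "ang2 s = - 1 / (ang s)^3"
    using assms by (auto simp: ang1_def ang2_def smooth_abs_outside smooth_abs2_def sgn_if)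
qed

text \<open>The coordinates are the square root of the radius and the sine of the polar angle.\<close>

definition rho :: "real \<Rightarrow> real \<Rightarrow> real" where
  "rho x y = sqrt (sqrt (x^2 + y^2))"

definition slope :: "real \<Rightarrow> real \<Rightarrow> real" where
  "slope x y = y / (rho x y)^2"

lemma rho_sq: "(rho x y)^2 = sqrt (x^2 + y^2)"
  by (simp add: rho_def)

lemma rho_power4: "(rho x y)^4 = x^2 + y^2"
  using power_mult[of "rho x y" 2 2] by (simp add: rho_sq)

lemma rho_nonneg [simp]: "0 \<le> rho x y"
  by (simp add: rho_def)

lemma rho_pos: "x \<noteq> 0 \<or> y \<noteq> 0 \<Longrightarrow> 0 < rho x y"
  by (auto simp: rho_def sum_power2_gt_zero_iff)

lemma abs_slope_le: "\<bar>slope x y\<bar> \<le> 1"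
  unfolding slope_def rho_sq abs_divide using real_sqrt_ge_abs2[of y x]
  by (cases "x = 0 \<and> y = 0") (auto simp: divide_le_eq_1 sum_power2_gt_zero_iff)

lemma x_sq_eq:
  assumes "x \<noteq> 0 \<or> y \<noteq> 0"
  shows "x^2 = (rho x y)^4 * (1 - (slope x y)^2)"
proof -
  have "(rho x y)^4 * (slope x y)^2 = y^2"
    using rho_pos[OF assms] by (simp add: slope_def power_divide flip: power_mult)
  then show ?thesis by (simp add: right_diff_distrib rho_power4)
qed

lemma rho_deriv:
  assumes "x \<noteq> 0 \<or> y \<noteq> 0"
  shows "((\<lambda>x. rho x y) has_real_derivative x / (2 * (rho x y)^3)) (at x)"
    and "((\<lambda>y. rho x y) has_real_derivative y / (2 * (rho x y)^3)) (at y)"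
proof -
  have p: "0 < x^2 + y^2" using assms by (simp add: sum_power2_gt_zero_iff)
  have r: "0 < rho x y" by (rule rho_pos[OF assms])
  have e: "inverse (rho x y) / 2 * (inverse (sqrt (x^2 + y^2)) / 2 * (2 * z)) = z / (2 * (rho x y)^3)" for z
    using r unfolding rho_sq[symmetric] by (simp add: field_simps power2_eq_square power3_eq_cube)
  have "((\<lambda>x. sqrt (sqrt (x^2 + y^2))) has_real_derivative
     inverse (sqrt (sqrt (x^2 + y^2))) / 2 * (inverse (sqrt (x^2 + y^2)) / 2 * (2 * x))) (at x)"
    using p by (intro DERIV_chain2[OF DERIV_real_sqrt]) (auto intro!: derivative_eq_intros)
  then show "((\<lambda>x. rho x y) has_real_derivative x / (2 * (rho x y)^3)) (at x)"
    unfolding rho_def[symmetric] e .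
  have "((\<lambda>y. sqrt (sqrt (x^2 + y^2))) has_real_derivative
     inverse (sqrt (sqrt (x^2 + y^2))) / 2 * (inverse (sqrt (x^2 + y^2)) / 2 * (2 * y))) (at y)"
    using p by (intro DERIV_chain2[OF DERIV_real_sqrt]) (auto intro!: derivative_eq_intros)
  then show "((\<lambda>y. rho x y) has_real_derivative y / (2 * (rho x y)^3)) (at y)"
    unfolding rho_def[symmetric] e .
qed

lemma slope_deriv:
  assumes "x \<noteq> 0 \<or> y \<noteq> 0"
  shows "((\<lambda>x. slope x y) has_real_derivative - slope x y * x / (rho x y)^4) (at x)"
    and "((\<lambda>y. slope x y) has_real_derivative (1 - (slope x y)^2) / (rho x y)^2) (at y)"
proof -
  have r: "0 < rho x y" by (rule rho_pos[OF assms])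
  have "((\<lambda>x. y / (rho x y)^2) has_real_derivative
     - (y * (2 * rho x y * (x / (2 * (rho x y)^3)))) / ((rho x y)^2 * (rho x y)^2)) (at x)"
    using r by (auto intro!: derivative_eq_intros rho_deriv[OF assms])
  moreover have "- (y * (2 * rho x y * (x / (2 * (rho x y)^3)))) / ((rho x y)^2 * (rho x y)^2)
     = - slope x y * x / (rho x y)^4"
    using r by (simp add: slope_def field_simps power_numeral_reduce)
  ultimately show "((\<lambda>x. slope x y) has_real_derivative - slope x y * x / (rho x y)^4) (at x)"
    unfolding slope_def by simp
  have "((\<lambda>y. y / (rho x y)^2) has_real_derivative
     ((rho x y)^2 - y * (2 * rho x y * (y / (2 * (rho x y)^3)))) / ((rho x y)^2 * (rho x y)^2)) (at y)"
    using r by (auto intro!: derivative_eq_intros rho_deriv[OF assms])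
  moreover have "((rho x y)^2 - y * (2 * rho x y * (y / (2 * (rho x y)^3)))) / ((rho x y)^2 * (rho x y)^2)
     = (1 - (slope x y)^2) / (rho x y)^2"
    using r by (simp add: slope_def field_simps power_numeral_reduce)
  ultimately show "((\<lambda>y. slope x y) has_real_derivative (1 - (slope x y)^2) / (rho x y)^2) (at y)"
    unfolding slope_def by simp
qed

section \<open>Derivatives of the function under the logarithm\<close>

definition polar_base :: "real \<Rightarrow> real \<Rightarrow> real" where
  "polar_base p s = 1 + p * ang s + p^2"

text \<open>The function under the logarithm is 1 + r plus \<open>p * ang s\<close>, which has
  degree 1/2 in (x, y). The functions named \<open>_ang\<close> are the angular factors in the
  derivatives of that last term; the remaining terms of \<open>base1\<close>, \<open>base2\<close>,
  \<open>base11\<close> and \<open>base22\<close> are derivatives of r.\<close>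

definition base1_ang :: "real \<Rightarrow> real" where
  "base1_ang s = ang s / 2 - s * ang1 s"

definition base11_ang :: "real \<Rightarrow> real" where
  "base11_ang s = (3 * s^2 - 1) / 4 * ang s + s * (1 - 2 * s^2) * ang1 s + s^2 * (1 - s^2) * ang2 s"

definition base22_ang :: "real \<Rightarrow> real" where
  "base22_ang s = (1/2 - 3/4 * s^2) * ang s - 2 * s * (1 - s^2) * ang1 s + (1 - s^2)^2 * ang2 s"

definition base1 :: "real \<Rightarrow> real \<Rightarrow> real" where
  "base1 x y = x / (rho x y)^2 + x / (rho x y)^3 * base1_ang (slope x y)"

definition base2 :: "real \<Rightarrow> real \<Rightarrow> real" where
  "base2 x y = slope x y + (slope x y * ang (slope x y) / 2 + (1 - (slope x y)^2) * ang1 (slope x y)) / rho x y"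

definition base11 :: "real \<Rightarrow> real \<Rightarrow> real" where
  "base11 x y = ((slope x y)^2 * rho x y + base11_ang (slope x y)) / (rho x y)^3"

definition base22 :: "real \<Rightarrow> real \<Rightarrow> real" where
  "base22 x y = ((1 - (slope x y)^2) * rho x y + base22_ang (slope x y)) / (rho x y)^3"

lemma polar_base_deriv:
  assumes "x \<noteq> 0 \<or> y \<noteq> 0"
  shows "((\<lambda>x. polar_base (rho x y) (slope x y)) has_real_derivative base1 x y) (at x)"
    and "((\<lambda>y. polar_base (rho x y) (slope x y)) has_real_derivative base2 x y) (at y)"
proof -
  have r: "0 < rho x y" by (rule rho_pos[OF assms])
  note d = rho_deriv[OF assms] slope_deriv[OF assms]
    DERIV_chain2[OF ang_deriv slope_deriv(1)[OF assms]] DERIV_chain2[OF ang_deriv slope_deriv(2)[OF assms]]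
  have "((\<lambda>x. 1 + rho x y * ang (slope x y) + (rho x y)^2) has_real_derivative
    x / (2 * (rho x y)^3) * ang (slope x y) + ang1 (slope x y) * (- slope x y * x / (rho x y)^4) * rho x y
    + 2 * rho x y * (x / (2 * (rho x y)^3))) (at x)"
    by (rule derivative_eq_intros d refl | simp)+
  moreover have "x / (2 * (rho x y)^3) * ang (slope x y) + ang1 (slope x y) * (- slope x y * x / (rho x y)^4) * rho x y
    + 2 * rho x y * (x / (2 * (rho x y)^3)) = base1 x y"
    using r by (simp add: base1_def base1_ang_def field_simps power_numeral_reduce)
  ultimately show "((\<lambda>x. polar_base (rho x y) (slope x y)) has_real_derivative base1 x y) (at x)"
    unfolding polar_base_def by simp
  have y: "y = slope x y * (rho x y)^2" using r by (simp add: slope_def)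
  have "((\<lambda>y. 1 + rho x y * ang (slope x y) + (rho x y)^2) has_real_derivative
    y / (2 * (rho x y)^3) * ang (slope x y) + ang1 (slope x y) * ((1 - (slope x y)^2) / (rho x y)^2) * rho x y
    + 2 * rho x y * (y / (2 * (rho x y)^3))) (at y)"
    by (rule derivative_eq_intros d refl | simp)+
  \<comment> \<open>The variable Y confines the substitution of \<open>s * p^2\<close> for y to the
    coefficients and keeps it away from the arguments of \<open>rho\<close> and
    \<open>slope\<close>.\<close>
  moreover have "Y / (2 * (rho x y)^3) * ang (slope x y) + ang1 (slope x y) * ((1 - (slope x y)^2) / (rho x y)^2) * rho x y
    + 2 * rho x y * (Y / (2 * (rho x y)^3)) = base2 x y" if "Y = slope x y * (rho x y)^2" for Y
    using r unfolding that by (simp add: base2_def field_simps power_numeral_reduce)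
  ultimately show "((\<lambda>y. polar_base (rho x y) (slope x y)) has_real_derivative base2 x y) (at y)"
    unfolding polar_base_def using y by simp
qed

text \<open>The functions f, g, w, z stand for \<open>rho\<close>, \<open>slope\<close> and the
  compositions of \<open>ang\<close> and \<open>ang1\<close> with \<open>slope\<close>. Kept opaque,
  they let the differentiation rules act on terms with the shapes of \<open>base1\<close> and
  \<open>base2\<close>.\<close>

lemma base_second_deriv_aux:
  fixes f g w z :: "real \<Rightarrow> real"
  assumes d: "(f has_real_derivative f') (at x)" "(g has_real_derivative g') (at x)"
    "(w has_real_derivative w') (at x)" "(z has_real_derivative z') (at x)" and f: "0 < f x"
  shows "((\<lambda>x. x / (f x)^2 + x / (f x)^3 * (w x / 2 - g x * z x)) has_real_derivative
     (1 / (f x)^2 - 2 * x * f' / (f x)^3) + (1 / (f x)^3 - 3 * x * f' / (f x)^4) * (w x / 2 - g x * z x)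
       + x / (f x)^3 * (w' / 2 - (g' * z x + g x * z'))) (at x)"
    and "((\<lambda>x. g x + (g x * w x / 2 + (1 - (g x)^2) * z x) / f x) has_real_derivative
     g' + ((g' * w x + g x * w') / 2 + (1 - (g x)^2) * z' - 2 * g x * g' * z x) / f x
       - (g x * w x / 2 + (1 - (g x)^2) * z x) * f' / (f x)^2) (at x)"
proof -
  have q2: "((\<lambda>x. x / (f x)^2) has_real_derivative 1 / (f x)^2 - 2 * x * f' / (f x)^3) (at x)"
  proof -
    have "((\<lambda>x. x / (f x)^2) has_real_derivative
        (1 * (f x)^2 - x * (2 * (f x * f'))) / ((f x)^2 * (f x)^2)) (at x)"
      using f by (intro DERIV_divide DERIV_ident DERIV_cong[OF DERIV_power[OF d(1), of 2]]) auto
    moreover have "(1 * F^2 - x * (2 * (F * f'))) / (F^2 * F^2) = 1 / F^2 - 2 * x * f' / F^3" if "0 < F" for F :: real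
      using that by (simp add: divide_simps) (simp add: power_numeral_reduce algebra_simps)
    ultimately show ?thesis using f by simp
  qed
  have q3: "((\<lambda>x. x / (f x)^3) has_real_derivative 1 / (f x)^3 - 3 * x * f' / (f x)^4) (at x)"
  proof -
    have "((\<lambda>x. x / (f x)^3) has_real_derivative
        (1 * (f x)^3 - x * (3 * ((f x)^2 * f'))) / ((f x)^3 * (f x)^3)) (at x)"
      using f by (intro DERIV_divide DERIV_ident DERIV_cong[OF DERIV_power[OF d(1), of 3]]) auto
    moreover have "(1 * F^3 - x * (3 * (F^2 * f'))) / (F^3 * F^3) = 1 / F^3 - 3 * x * f' / F^4" if "0 < F" for F :: real
      using that by (simp add: divide_simps) (simp add: power_numeral_reduce algebra_simps)
    ultimately show ?thesis using f by simp
  qed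
  have a: "((\<lambda>x. w x / 2 - g x * z x) has_real_derivative w' / 2 - (g' * z x + g x * z')) (at x)"
    using DERIV_diff[OF DERIV_cdivide[OF d(3), of 2] DERIV_mult[OF d(2,4)]] by (simp add: mult.commute add.commute)
  show "((\<lambda>x. x / (f x)^2 + x / (f x)^3 * (w x / 2 - g x * z x)) has_real_derivative
     (1 / (f x)^2 - 2 * x * f' / (f x)^3) + (1 / (f x)^3 - 3 * x * f' / (f x)^4) * (w x / 2 - g x * z x)
       + x / (f x)^3 * (w' / 2 - (g' * z x + g x * z'))) (at x)"
    by (rule DERIV_cong[OF DERIV_add[OF q2 DERIV_mult[OF q3 a]]]) simp_all
  have b: "((\<lambda>x. g x * w x / 2 + (1 - (g x)^2) * z x) has_real_derivative
      (g' * w x + g x * w') / 2 + (1 - (g x)^2) * z' - 2 * g x * g' * z x) (at x)"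
    by (rule derivative_eq_intros d refl | simp)+
  show "((\<lambda>x. g x + (g x * w x / 2 + (1 - (g x)^2) * z x) / f x) has_real_derivative
     g' + ((g' * w x + g x * w') / 2 + (1 - (g x)^2) * z' - 2 * g x * g' * z x) / f x
       - (g x * w x / 2 + (1 - (g x)^2) * z x) * f' / (f x)^2) (at x)"
    by (rule DERIV_cong[OF DERIV_add[OF d(2) DERIV_divide[OF b d(1)]]])
       (use f in \<open>simp_all add: diff_divide_distrib power2_eq_square\<close>)
qed

lemma base_second_deriv:
  assumes "x \<noteq> 0 \<or> y \<noteq> 0" "\<bar>slope x y\<bar> \<noteq> 1/4"
  shows "((\<lambda>x. base1 x y) has_real_derivative base11 x y) (at x)"
    and "((\<lambda>y. base2 x y) has_real_derivative base22 x y) (at y)"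
proof -
  define p s where "p = rho x y" and "s = slope x y"
  have r: "0 < p" using rho_pos[OF assms(1)] by (simp add: p_def)
  have x2: "x * x = p^4 * (1 - s^2)" using x_sq_eq[OF assms(1)] by (simp add: power2_eq_square p_def s_def)
  have y: "y = s * p^2" using r by (simp add: slope_def p_def s_def)
  note r' = rho_pos[OF assms(1)]
  have d1: "((\<lambda>x. base1 x y) has_real_derivative
     (1 / p^2 - 2 * x * (x / (2 * p^3)) / p^3) + (1 / p^3 - 3 * x * (x / (2 * p^3)) / p^4) * (ang s / 2 - s * ang1 s)
       + x / p^3 * (ang1 s * (- s * x / p^4) / 2 - ((- s * x / p^4) * ang1 s + s * (ang2 s * (- s * x / p^4))))) (at x)"
    unfolding base1_def base1_ang_def p_def s_def
    by (rule base_second_deriv_aux(1)[OF rho_deriv(1)[OF assms(1)] slope_deriv(1)[OF assms(1)]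
       DERIV_chain2[OF ang_deriv slope_deriv(1)[OF assms(1)]]
       DERIV_chain2[OF ang1_deriv[OF assms(2)] slope_deriv(1)[OF assms(1)]] r'])
  have e1: "(1 / p^2 - 2 * x * (x / (2 * p^3)) / p^3) + (1 / p^3 - 3 * x * (x / (2 * p^3)) / p^4) * (ang s / 2 - s * ang1 s)
       + x / p^3 * (ang1 s * (- s * x / p^4) / 2 - ((- s * x / p^4) * ang1 s + s * (ang2 s * (- s * x / p^4))))
     = (1 / p^2 - (x * x) / p^6) + (1 / p^3 - 3/2 * (x * x) / p^7) * (ang s / 2 - s * ang1 s) + (x * x) / p^7 * (s * ang1 s / 2 + s^2 * ang2 s)"
    using r by (simp add: field_simps power_numeral_reduce)
  have e2: "(1 / p^2 - X / p^6) + (1 / p^3 - 3/2 * X / p^7) * (ang s / 2 - s * ang1 s) + X / p^7 * (s * ang1 s / 2 + s^2 * ang2 s) = base11 x y" if "X = p^4 * (1 - s^2)" for X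
    unfolding that base11_def base11_ang_def p_def[symmetric] s_def[symmetric]
    using r by (simp add: field_simps power_numeral_reduce)
  show "((\<lambda>x. base1 x y) has_real_derivative base11 x y) (at x)"
    using d1 unfolding e1 e2[OF x2] .
  have d2: "((\<lambda>y. base2 x y) has_real_derivative
     (1 - s^2) / p^2 + (((1 - s^2) / p^2 * ang s + s * (ang1 s * ((1 - s^2) / p^2))) / 2
       + (1 - s^2) * (ang2 s * ((1 - s^2) / p^2)) - 2 * s * ((1 - s^2) / p^2) * ang1 s) / p
       - (s * ang s / 2 + (1 - s^2) * ang1 s) * (y / (2 * p^3)) / p^2) (at y)"
    unfolding base2_def p_def s_def
    by (rule base_second_deriv_aux(2)[OF rho_deriv(2)[OF assms(1)] slope_deriv(2)[OF assms(1)]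
       DERIV_chain2[OF ang_deriv slope_deriv(2)[OF assms(1)]]
       DERIV_chain2[OF ang1_deriv[OF assms(2)] slope_deriv(2)[OF assms(1)]] r'])
  have e3: "(1 - s^2) / p^2 + (((1 - s^2) / p^2 * ang s + s * (ang1 s * ((1 - s^2) / p^2))) / 2
       + (1 - s^2) * (ang2 s * ((1 - s^2) / p^2)) - 2 * s * ((1 - s^2) / p^2) * ang1 s) / p
       - (s * ang s / 2 + (1 - s^2) * ang1 s) * (Y / (2 * p^3)) / p^2 = base22 x y" if "Y = s * p^2" for Y
    unfolding base22_def base22_ang_def p_def[symmetric] s_def[symmetric] that
    using r by (simp add: field_simps power_numeral_reduce)
  show "((\<lambda>y. base2 x y) has_real_derivative base22 x y) (at y)"
    using d2 unfolding e3[OF y] .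
qed

text \<open>The Laplacian of \<open>p * ang s\<close> is \<open>lap_ang s / p^3\<close>, and the
  squared length of its gradient is \<open>grad_ang s / p^2\<close>.\<close>

definition lap_ang :: "real \<Rightarrow> real" where
  "lap_ang s = ang s / 4 - s * ang1 s + (1 - s^2) * ang2 s"

definition grad_ang :: "real \<Rightarrow> real" where
  "grad_ang s = (ang s)^2 / 4 + (1 - s^2) * (ang1 s)^2"

lemma slope_sq_le: "(slope x y)^2 \<le> 1"
  using abs_slope_le[of x y] by (simp add: abs_square_le_1)

lemma polar_base_ge:
  assumes "0 \<le> p"
  shows "1 + p^2 \<le> polar_base p s" "p \<le> polar_base p s" "1 \<le> polar_base p s"
proof -
  have "p * (3/2) \<le> p * ang s" using assms ang_ge by (intro mult_left_mono) auto
  then show "1 + p^2 \<le> polar_base p s" "p \<le> polar_base p s" "1 \<le> polar_base p s"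
    using assms zero_le_power2[of p] by (simp_all add: polar_base_def, linarith+)
qed

lemma polar_base_pos: "0 \<le> p \<Longrightarrow> 0 < polar_base p s"
  using polar_base_ge(3)[of p s] by linarith

lemma base_ang_sum: "base11_ang s + base22_ang s = lap_ang s"
  by (simp add: base11_ang_def base22_ang_def lap_ang_def power2_eq_square field_simps)

text \<open>In the expanded square of the gradient of r + \<open>p * ang s\<close> the gradient of r
  has length 1, and the cross term is twice a radial derivative of a function of degree 1/2, hence
  \<open>ang s / p\<close>.\<close>

lemma base_gradient_squares:
  assumes "x \<noteq> 0 \<or> y \<noteq> 0" and p: "p = rho x y" and s: "s = slope x y"
  shows "(base1 x y)^2 = (1 - s^2) * (p + base1_ang s)^2 / p^2"
    and "(base1 x y)^2 + (base2 x y)^2 = (p^2 + p * ang s + grad_ang s) / p^2"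
proof -
  have r: "0 < p" using rho_pos[OF assms(1)] by (simp add: p)
  have "base1 x y = x / p^3 * (p + base1_ang s)"
    using r by (simp add: base1_def s p[symmetric] field_simps power2_eq_square power3_eq_cube)
  then have "(base1 x y)^2 = x^2 * (p + base1_ang s)^2 / p^6"
    by (simp add: power_mult_distrib power_divide flip: power_mult)
  also have "x^2 = p^4 * (1 - s^2)" using x_sq_eq[OF assms(1)] by (simp add: p s)
  also have "p^4 * (1 - s^2) * (p + base1_ang s)^2 / p^6 = (1 - s^2) * (p + base1_ang s)^2 / p^2"
  proof -
    have "q * a * b / (q * d) = a * b / d" if "q \<noteq> 0" for q a b d :: real
      using that by simp
    from this[of "p^4" "1 - s^2" "(p + base1_ang s)^2" "p^2"] show ?thesis
      using r by (simp flip: power_add)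
  qed
  finally show 1: "(base1 x y)^2 = (1 - s^2) * (p + base1_ang s)^2 / p^2" .
  have "base2 x y = (s * p + (s * ang s / 2 + (1 - s^2) * ang1 s)) / p"
    using r by (simp add: base2_def s p[symmetric] field_simps)
  then have 2: "(base2 x y)^2 = (s * p + (s * ang s / 2 + (1 - s^2) * ang1 s))^2 / p^2"
    by (simp add: power_divide)
  have "(1 - s^2) * (p + base1_ang s)^2 + (s * p + (s * ang s / 2 + (1 - s^2) * ang1 s))^2 = p^2 + p * ang s + grad_ang s"
    unfolding base1_ang_def grad_ang_def by (simp add: power2_eq_square field_simps)
  then show "(base1 x y)^2 + (base2 x y)^2 = (p^2 + p * ang s + grad_ang s) / p^2"
    unfolding 1 2 by (simp flip: add_divide_distrib)
qed

lemma abs_base_ang_le: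
  assumes s: "\<bar>s\<bar> \<le> 1"
  shows "\<bar>base11_ang s\<bar> \<le> 6" "\<bar>base22_ang s\<bar> \<le> 7"
proof -
  have s2: "0 \<le> s^2" "s^2 \<le> 1" using s by (auto simp: abs_square_le_1)
  have s3: "\<bar>3 * s^2 - 1\<bar> \<le> 2" "\<bar>1 - 2 * s^2\<bar> \<le> 1" "\<bar>1/2 - 3/4 * s^2\<bar> \<le> 1/2" "\<bar>1 - s^2\<bar> \<le> 1"
    using s2 by linarith+
  have ang: "\<bar>ang s\<bar> \<le> 2" using ang_le[OF s] by (simp add: abs_of_pos)
  have a: "\<bar>(3 * s^2 - 1) / 4 * ang s\<bar> \<le> 1/2 * 2"
    unfolding abs_mult using s3 ang by (intro mult_mono) auto
  have b: "\<bar>s * (1 - 2 * s^2) * ang1 s\<bar> \<le> 1 * 1 * 1"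
    unfolding abs_mult using s3 s abs_ang1_le by (intro mult_mono) auto
  have c: "\<bar>s^2 * (1 - s^2) * ang2 s\<bar> \<le> 1 * 1 * 4"
    unfolding abs_mult using s2 abs_ang2_le by (intro mult_mono) auto
  show "\<bar>base11_ang s\<bar> \<le> 6" using a b c unfolding base11_ang_def by linarith
  have a: "\<bar>(1/2 - 3/4 * s^2) * ang s\<bar> \<le> 1/2 * 2"
    unfolding abs_mult using s3 ang by (intro mult_mono) auto
  have b: "\<bar>2 * s * (1 - s^2) * ang1 s\<bar> \<le> 2 * 1 * 1"
    unfolding abs_mult using s3 s abs_ang1_le by (intro mult_mono) auto
  have c: "\<bar>(1 - s^2)^2 * ang2 s\<bar> \<le> 1 * 4"
    unfolding abs_mult using s2 abs_ang2_le by (intro mult_mono) (auto simp: abs_square_le_1)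
  show "\<bar>base22_ang s\<bar> \<le> 7" using a b c unfolding base22_ang_def by linarith
qed

text \<open>Each first derivative is bounded by the length of the gradient, whose square is at most
  \<open>(p + 2)^2 / p^2\<close> because \<open>ang\<close> and \<open>grad_ang\<close> are at most
  2.\<close>

lemma abs_base_deriv_le:
  assumes xy: "x \<noteq> 0 \<or> y \<noteq> 0" and p: "p = rho x y"
  shows "\<bar>base1 x y\<bar> \<le> (p + 2) / p" "\<bar>base2 x y\<bar> \<le> (p + 2) / p"
    "\<bar>base11 x y\<bar> \<le> (p + 7) / p^3" "\<bar>base22 x y\<bar> \<le> (p + 7) / p^3"
proof -
  define s where "s = slope x y"
  have r: "0 < p" using rho_pos[OF xy] by (simp add: p)
  have s: "\<bar>s\<bar> \<le> 1" "0 \<le> s^2" "s^2 \<le> 1" using abs_slope_le slope_sq_le by (auto simp: s_def)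
  have G: "grad_ang s \<le> 2"
  proof -
    have "(ang s)^2 \<le> 2^2" using ang_le[OF s(1)] by (intro power_mono) (auto simp: less_imp_le)
    moreover have "(1 - s^2) * (ang1 s)^2 \<le> 1 * 1"
      using s abs_ang1_le[of s] by (intro mult_mono) (auto simp: abs_square_le_1)
    ultimately show ?thesis unfolding grad_ang_def by simp
  qed
  have "p^2 + p * ang s + grad_ang s \<le> p^2 + p * 2 + 2"
    using ang_le[OF s(1)] r G by (intro add_mono mult_left_mono) auto
  also have "\<dots> \<le> (p + 2)^2" using r by (simp add: power2_eq_square algebra_simps)
  finally have "(base1 x y)^2 + (base2 x y)^2 \<le> ((p + 2) / p)^2"
    unfolding base_gradient_squares(2)[OF xy p s_def] by (simp add: power_divide divide_right_mono)
  then have "\<bar>base1 x y\<bar>^2 \<le> ((p + 2) / p)^2" "\<bar>base2 x y\<bar>^2 \<le> ((p + 2) / p)^2"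
    using zero_le_power2[of "base1 x y"] zero_le_power2[of "base2 x y"] unfolding power2_abs by linarith+
  then show "\<bar>base1 x y\<bar> \<le> (p + 2) / p" "\<bar>base2 x y\<bar> \<le> (p + 2) / p"
    using r by (auto intro: power2_le_imp_le)
  have "0 \<le> s^2 * p" "s^2 * p \<le> 1 * p" using r s by (auto intro: mult_right_mono)
  then have "\<bar>s^2 * p + base11_ang s\<bar> \<le> p + 7" "\<bar>(1 - s^2) * p + base22_ang s\<bar> \<le> p + 7"
    using abs_base_ang_le[OF s(1)] unfolding left_diff_distrib by linarith+
  then show "\<bar>base11 x y\<bar> \<le> (p + 7) / p^3" "\<bar>base22 x y\<bar> \<le> (p + 7) / p^3"
    using r unfolding base11_def base22_def abs_divide s_def[symmetric] p[symmetric]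
    by (simp_all add: divide_right_mono)
qed

text \<open>Where \<open>smooth_abs s = \<bar>s\<bar>\<close>, this is \<open>\<bar>1 + sqrt (- i (x + i \<bar>y\<bar>))\<bar>\<^sup>2\<close>, so that \<open>pot\<close> is harmonic there.\<close>

definition base :: "real \<Rightarrow> real \<Rightarrow> real" where "base x y = polar_base (rho x y) (slope x y)"

definition pot :: "real \<Rightarrow> real \<Rightarrow> real" where "pot x y = ln (base x y) / 2"
definition pot1 :: "real \<Rightarrow> real \<Rightarrow> real" where "pot1 x y = base1 x y / base x y / 2"
definition pot2 :: "real \<Rightarrow> real \<Rightarrow> real" where "pot2 x y = base2 x y / base x y / 2"
text \<open>The value \<open>0\<close> on the axes keeps these bounded by a multiple of the spike everywhere.\<close>

definition pot11 :: "real \<Rightarrow> real \<Rightarrow> real" where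
  "pot11 x y = (if x = 0 \<or> y = 0 then 0 else (base11 x y / base x y - (base1 x y / base x y)^2) / 2)"
definition pot22 :: "real \<Rightarrow> real \<Rightarrow> real" where
  "pot22 x y = (if x = 0 \<or> y = 0 then 0 else (base22 x y / base x y - (base2 x y / base x y)^2) / 2)"

lemma base_pos [simp]: "0 < base x y" "base x y \<noteq> 0"
  using polar_base_pos[of "rho x y" "slope x y"] by (auto simp: base_def)

section \<open>Size and regularity of the potential\<close>

text \<open>The power \<open>p^3\<close> has the right order at the origin. At infinity the second
  derivatives decay like 1 / p^4, so a bound homogeneous in r of degree -3/2 holds
  throughout.\<close>

lemma second_quotient_bound:
  fixes p S a b :: real
  assumes p: "0 < p" and S: "1 + p^2 \<le> S" "p \<le> S" "1 \<le> S"
    and a: "\<bar>a\<bar> \<le> (p + 2) / p" and b: "\<bar>b\<bar> \<le> (p + 7) / p^3"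
  shows "\<bar>(b / S - (a / S)^2) / 2\<bar> \<le> 8 / p^3"
proof -
  have p3: "0 < p^3" using p by simp
  have "(p + 7) / p^3 / S \<le> 8 / p^3"
  proof -
    have "(p + 7) / S \<le> 8" using S by (simp add: divide_le_eq)
    then have "(p + 7) / S / p^3 \<le> 8 / p^3" using p3 by (intro divide_right_mono) auto
    then show ?thesis by (simp add: mult.commute)
  qed
  moreover have "\<bar>b / S\<bar> \<le> (p + 7) / p^3 / S"
    unfolding abs_divide using divide_right_mono[OF b, of S] S by simp
  ultimately have 1: "\<bar>b / S\<bar> \<le> 8 / p^3" by linarith
  have "(a / S)^2 \<le> ((p + 2) / p / S)^2"
  proof -
    have "\<bar>a / S\<bar> \<le> (p + 2) / p / S"
      unfolding abs_divide using divide_right_mono[OF a, of S] S by simp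
    then have "\<bar>a / S\<bar>^2 \<le> ((p + 2) / p / S)^2" by (rule power_mono) simp
    then show ?thesis unfolding power2_abs .
  qed
  also have "\<dots> \<le> 8 / p^3"
  proof -
    \<comment> \<open>Completes the square in \<open>7 * p^2 - 4 * p + 4\<close>, the difference of
      the two sides of the next inequality.\<close>
    have "0 \<le> 7 * (p - 2/7)^2" by simp
    then have "(p + 2)^2 \<le> 8 * (1 + p^2)" using p by (simp add: power2_eq_square algebra_simps)
    also have "\<dots> \<le> 8 * S" using S by simp
    finally have "p * (p + 2)^2 \<le> S * (8 * S)" using S p by (intro mult_mono) auto
    then have "p * (p + 2)^2 / (p^3 * S^2) \<le> 8 * S^2 / (p^3 * S^2)"
      using p3 S by (intro divide_right_mono) (auto simp: power2_eq_square)
    moreover have "p * (p + 2)^2 / (p^3 * S^2) = ((p + 2) / p / S)^2"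
      using p S by (simp add: power_divide power3_eq_cube power2_eq_square)
    moreover have "8 * S^2 / (p^3 * S^2) = 8 / p^3" using S by simp
    ultimately show ?thesis by simp
  qed
  finally have 2: "(a / S)^2 \<le> 8 / p^3" .
  have "0 \<le> (a / S)^2" by simp
  with 1 2 have "\<bar>b / S - (a / S)^2\<bar> \<le> 2 * (8 / p^3)" by linarith
  then show ?thesis by simp
qed

lemma pot_second_le:
  assumes "x \<noteq> 0 \<or> y \<noteq> 0"
  shows "\<bar>pot11 x y\<bar> \<le> 8 / (rho x y)^3" "\<bar>pot22 x y\<bar> \<le> 8 / (rho x y)^3"
proof -
  have r: "0 < rho x y" by (rule rho_pos[OF assms])
  note b = second_quotient_bound[OF r polar_base_ge[OF less_imp_le[OF r], of "slope x y"], folded base_def]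
  show "\<bar>pot11 x y\<bar> \<le> 8 / (rho x y)^3" "\<bar>pot22 x y\<bar> \<le> 8 / (rho x y)^3"
    unfolding pot11_def pot22_def
    using b[OF abs_base_deriv_le(1,3)[OF assms refl]] b[OF abs_base_deriv_le(2,4)[OF assms refl]] r by auto
qed

text \<open>Here \<open>(rho x y)^4\<close> is r^2, which dominates
  \<open>\<bar>x\<bar> * \<bar>y\<bar>\<close>; raising to the power -3/4 gives r^(-3/2) on the
  left. The new singularities along the axes are harmless because 3/4 < 1.\<close>

lemma rho_spike:
  assumes "x \<noteq> 0" "y \<noteq> 0"
  shows "1 / (rho x y)^3 \<le> spike1 x * spike1 y"
proof -
  have r: "0 < rho x y" using assms by (simp add: rho_pos)
  have "0 \<le> (\<bar>x\<bar> - \<bar>y\<bar>)^2 + \<bar>x\<bar> * \<bar>y\<bar>" by simp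
  then have le: "\<bar>x\<bar> * \<bar>y\<bar> \<le> (rho x y)^4"
    by (simp add: rho_power4 power2_eq_square algebra_simps)
  have "1 / (rho x y)^3 = ((rho x y)^4) powr (-3/4)"
  proof -
    have "((rho x y)^4) powr (-3/4) = (rho x y powr 4) powr (-3/4)"
      using powr_realpow[OF r, of 4] by simp
    also have "\<dots> = rho x y powr (- 3)" unfolding powr_powr by simp
    also have "\<dots> = 1 / (rho x y)^3"
      using powr_realpow[OF r, of 3] unfolding powr_minus_divide by simp
    finally show ?thesis ..
  qed
  also have "\<dots> \<le> (\<bar>x\<bar> * \<bar>y\<bar>) powr (-3/4)"
    using le assms by (intro powr_mono2') auto
  also have "\<dots> = spike1 x * spike1 y" by (simp add: spike1_def powr_mult)
  finally show ?thesis .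
qed

lemma pot_second_le_spike:
  "\<bar>pot11 x y\<bar> \<le> 8 * (spike1 x * spike1 y)" "\<bar>pot22 x y\<bar> \<le> 8 * (spike1 x * spike1 y)"
proof -
  have "\<bar>pot11 x y\<bar> \<le> 8 * (spike1 x * spike1 y) \<and> \<bar>pot22 x y\<bar> \<le> 8 * (spike1 x * spike1 y)"
  proof (cases "x = 0 \<or> y = 0")
    case True then show ?thesis by (auto simp: pot11_def pot22_def)
  next
    case False
    then show ?thesis using pot_second_le[of x y] rho_spike[of x y] by auto
  qed
  then show "\<bar>pot11 x y\<bar> \<le> 8 * (spike1 x * spike1 y)" "\<bar>pot22 x y\<bar> \<le> 8 * (spike1 x * spike1 y)" by auto
qed

lemma abs_pot_le: "\<bar>pot x y\<bar> \<le> 8 * ((1 + \<bar>x\<bar>) * (1 + \<bar>y\<bar>))"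
proof -
  define p where "p = rho x y"
  have p: "0 \<le> p" by (simp add: p_def)
  have base1: "1 \<le> base x y" using polar_base_ge(3)[OF p] by (simp add: base_def p_def)
  have "\<bar>pot x y\<bar> \<le> base x y / 2"
    using base1 ln_le_minus_one[of "base x y"] by (simp add: pot_def)
  also have "base x y \<le> 1 + p * 2 + p^2"
    using p ang_le[OF abs_slope_le] by (simp add: base_def polar_base_def p_def mult_left_mono)
  also have "\<dots> \<le> 2 + 2 * p^2" using zero_le_power2[of "p - 1"] by (simp add: power2_eq_square algebra_simps)
  also have "p^2 \<le> \<bar>x\<bar> + \<bar>y\<bar>" unfolding p_def rho_sq by (rule sqrt_sum_squares_le_sum_abs)
  finally have "\<bar>pot x y\<bar> \<le> 1 + \<bar>x\<bar> + \<bar>y\<bar>" by simp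
  also have "\<dots> \<le> 8 * ((1 + \<bar>x\<bar>) * (1 + \<bar>y\<bar>))" by (simp add: algebra_simps)
  finally show ?thesis .
qed

lemma pot_deriv:
  assumes "x \<noteq> 0 \<or> y \<noteq> 0"
  shows "((\<lambda>x. pot x y) has_real_derivative pot1 x y) (at x)"
    and "((\<lambda>y. pot x y) has_real_derivative pot2 x y) (at y)"
proof -
  have "((\<lambda>x. ln (base x y) / 2) has_real_derivative (1 / base x y * base1 x y) / 2) (at x)"
    unfolding base_def by (intro DERIV_cdivide DERIV_chain2[OF DERIV_ln_divide] polar_base_deriv assms) (simp add: polar_base_pos)
  then show "((\<lambda>x. pot x y) has_real_derivative pot1 x y) (at x)" by (simp add: pot_def pot1_def)
  have "((\<lambda>y. ln (base x y) / 2) has_real_derivative (1 / base x y * base2 x y) / 2) (at y)"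
    unfolding base_def by (intro DERIV_cdivide DERIV_chain2[OF DERIV_ln_divide] polar_base_deriv assms) (simp add: polar_base_pos)
  then show "((\<lambda>y. pot x y) has_real_derivative pot2 x y) (at y)" by (simp add: pot_def pot2_def)
qed

lemma pot_second_deriv:
  assumes "x \<noteq> 0" "y \<noteq> 0" "\<bar>slope x y\<bar> \<noteq> 1/4"
  shows "((\<lambda>x. pot1 x y) has_real_derivative pot11 x y) (at x)"
    and "((\<lambda>y. pot2 x y) has_real_derivative pot22 x y) (at y)"
proof -
  have xy: "x \<noteq> 0 \<or> y \<noteq> 0" using assms by simp
  have q: "(a * S - b * b) / (S * S) / 2 = (a / S - (b / S)^2) / 2" if "S \<noteq> 0" for a b S :: real
    using that by (simp add: diff_divide_distrib power2_eq_square)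
  have "((\<lambda>x. base1 x y / base x y / 2) has_real_derivative
      (base11 x y * base x y - base1 x y * base1 x y) / (base x y * base x y) / 2) (at x)"
    using base_pos(2) unfolding base_def by (intro DERIV_cdivide DERIV_divide polar_base_deriv base_second_deriv xy assms)
  then show "((\<lambda>x. pot1 x y) has_real_derivative pot11 x y) (at x)"
    unfolding pot1_def q[OF base_pos(2)] using assms by (simp add: pot11_def)
  have "((\<lambda>y. base2 x y / base x y / 2) has_real_derivative
      (base22 x y * base x y - base2 x y * base2 x y) / (base x y * base x y) / 2) (at y)"
    using base_pos(2) unfolding base_def by (intro DERIV_cdivide DERIV_divide polar_base_deriv base_second_deriv xy assms)
  then show "((\<lambda>y. pot2 x y) has_real_derivative pot22 x y) (at y)"
    unfolding pot2_def q[OF base_pos(2)] using assms by (simp add: pot22_def)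
qed

lemma continuous_ang: "continuous_on A ang" "continuous_on A ang1"
proof -
  have "continuous_on A smooth_abs1" unfolding smooth_abs1_def[abs_def] by (intro continuous_intros)
  moreover show "continuous_on A ang" using ang_deriv by (meson DERIV_continuous_on has_field_derivative_at_within)
  ultimately show "continuous_on A ang1" unfolding ang1_def[abs_def] by (intro continuous_intros) auto
qed

lemma continuous_pot_first:
  assumes f: "continuous_on A f" and g: "continuous_on A g" and ne: "\<And>t. t \<in> A \<Longrightarrow> f t \<noteq> 0 \<or> g t \<noteq> 0"
  shows "continuous_on A (\<lambda>t. pot1 (f t) (g t))" "continuous_on A (\<lambda>t. pot2 (f t) (g t))"
proof -
  have r: "continuous_on A (\<lambda>t. rho (f t) (g t))" unfolding rho_def by (intro continuous_intros f g)
  have r0: "rho (f t) (g t) \<noteq> 0" if "t \<in> A" for t using rho_pos[OF ne[OF that]] by simp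
  have s: "continuous_on A (\<lambda>t. slope (f t) (g t))"
    unfolding slope_def using r0 by (intro continuous_intros f g r) auto
  note v = continuous_on_compose2[OF continuous_ang(1)[of UNIV] s, simplified]
    continuous_on_compose2[OF continuous_ang(2)[of UNIV] s, simplified]
  have S: "continuous_on A (\<lambda>t. base (f t) (g t))" unfolding base_def polar_base_def by (intro continuous_intros r s v)
  show "continuous_on A (\<lambda>t. pot1 (f t) (g t))"
    unfolding pot1_def base1_def base1_ang_def using r0 by (intro continuous_intros f g r s v S) auto
  show "continuous_on A (\<lambda>t. pot2 (f t) (g t))"
    unfolding pot2_def base2_def using r0 by (intro continuous_intros f g r s v S) auto
qed

lemma abs_pot_first_le:
  assumes "x \<noteq> 0 \<or> y \<noteq> 0"
  shows "\<bar>pot1 x y\<bar> \<le> 1 + 2 / rho x y" "\<bar>pot2 x y\<bar> \<le> 1 + 2 / rho x y"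
proof -
  have r: "0 < rho x y" by (rule rho_pos[OF assms])
  have S: "1 \<le> base x y" using polar_base_ge(3)[OF less_imp_le[OF r]] by (simp add: base_def)
  have *: "\<bar>a / base x y / 2\<bar> \<le> 1 + 2 / rho x y" if "\<bar>a\<bar> \<le> (rho x y + 2) / rho x y" for a
  proof -
    have "\<bar>a / base x y / 2\<bar> \<le> \<bar>a\<bar> / 1" unfolding abs_divide divide_divide_eq_left using S by (intro divide_left_mono) auto
    also have "\<dots> \<le> 1 + 2 / rho x y" using that r by (simp add: add_divide_distrib)
    finally show ?thesis .
  qed
  show "\<bar>pot1 x y\<bar> \<le> 1 + 2 / rho x y" "\<bar>pot2 x y\<bar> \<le> 1 + 2 / rho x y"
    unfolding pot1_def pot2_def by (intro * abs_base_deriv_le assms refl)+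
qed

text \<open>On a line parallel to an axis and missing the origin, the edges of the wedge become the
  roots of a quadratic, so only finitely many exceptional points occur.\<close>

lemma slope_quarter_iff:
  assumes "x \<noteq> 0 \<or> y \<noteq> 0"
  shows "\<bar>slope x y\<bar> = 1/4 \<longleftrightarrow> x^2 = 15 * y^2"
proof -
  have p: "0 < x^2 + y^2" using assms by (simp add: sum_power2_gt_zero_iff)
  have "\<bar>slope x y\<bar> = 1/4 \<longleftrightarrow> (slope x y)^2 = (1/4)^2"
    by (auto simp: power2_eq_iff)
  also have "(slope x y)^2 = y^2 / (x^2 + y^2)"
    by (simp add: slope_def rho_sq power_divide)
  also have "y^2 / (x^2 + y^2) = (1/4)^2 \<longleftrightarrow> x^2 = 15 * y^2"
    using p by (simp add: field_simps power2_eq_square) (auto simp: algebra_simps)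
  finally show ?thesis .
qed

lemma finite_square_eq: "finite {x::real. x^2 = c}"
proof (rule finite_subset)
  show "{x. x^2 = c} \<subseteq> {sqrt c, - sqrt c}" by auto
qed simp

lemma pot_measurable [measurable]:
  "(\<lambda>p. pot (fst p) (snd p)) \<in> borel_measurable borel"
  "(\<lambda>p. pot11 (fst p) (snd p)) \<in> borel_measurable borel"
  "(\<lambda>p. pot22 (fst p) (snd p)) \<in> borel_measurable borel"
  unfolding pot_def pot11_def pot22_def base_def polar_base_def base11_def base22_def base1_def base2_def base11_ang_def base22_ang_def base1_ang_def
    ang1_def ang2_def ang_def smooth_abs_def smooth_abs1_def smooth_abs2_def slope_def rho_def borel_prod[symmetric]
  by measurable

section \<open>The Laplacian of the potential and its support\<close>

interpretation pot: potential pot pot1 pot11 pot2 pot22 8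
proof
  fix y :: real assume y: "y \<noteq> 0"
  \<comment> \<open>The edges of the wedge, together with the axis point, where \<open>pot11\<close>
    has its conventional value.\<close>
  have fin: "finite ({x. x^2 = 15 * y^2} \<union> {0})" using finite_square_eq by simp
  \<comment> \<open>The line keeps a positive distance from the origin, which makes the bounds in
    terms of \<open>rho\<close> uniform along it.\<close>
  have low: "sqrt \<bar>y\<bar> \<le> rho x y" for x
    unfolding rho_def using real_sqrt_ge_abs2[of y x] by (rule real_sqrt_le_mono)
  have y0: "0 < sqrt \<bar>y\<bar>" using y by simp
  show "(\<forall>x. ((\<lambda>x. pot x y) has_real_derivative pot1 x y) (at x)) \<and>
       continuous_on UNIV (\<lambda>x. pot1 x y) \<and>
       (\<exists>X. finite X \<and> (\<forall>x. x \<notin> X \<longrightarrow> ((\<lambda>x. pot1 x y) has_real_derivative pot11 x y) (at x))) \<and>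
       (\<exists>B. \<forall>x. \<bar>pot1 x y\<bar> \<le> B \<and> \<bar>pot11 x y\<bar> \<le> B)"
  proof (intro conjI allI)
    show "((\<lambda>x. pot x y) has_real_derivative pot1 x y) (at x)" for x by (rule pot_deriv) (use y in simp)
    show "continuous_on UNIV (\<lambda>x. pot1 x y)" by (rule continuous_pot_first) (use y in \<open>auto intro: continuous_intros\<close>)
    show "\<exists>X. finite X \<and> (\<forall>x. x \<notin> X \<longrightarrow> ((\<lambda>x. pot1 x y) has_real_derivative pot11 x y) (at x))"
      by (intro exI[of _ "{x. x^2 = 15 * y^2} \<union> {0}"] conjI fin allI impI pot_second_deriv)
         (use y slope_quarter_iff[of _ y] in blast)+
    have "\<bar>pot1 x y\<bar> \<le> 1 + 2 / sqrt \<bar>y\<bar> + 8 / (sqrt \<bar>y\<bar>)^3 \<and> \<bar>pot11 x y\<bar> \<le> 1 + 2 / sqrt \<bar>y\<bar> + 8 / (sqrt \<bar>y\<bar>)^3" for x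
      using abs_pot_first_le(1)[of x y] pot_second_le(1)[of x y] y y0 low[of x]
        divide_left_mono[OF low[of x], of 2] divide_left_mono[OF power_mono[OF low[of x], of 3], of 8]
      by (smt (verit, best) divide_nonneg_pos mult_pos_pos zero_less_power real_sqrt_ge_zero)
    then show "\<exists>B. \<forall>x. \<bar>pot1 x y\<bar> \<le> B \<and> \<bar>pot11 x y\<bar> \<le> B" by blast
  qed
next
  fix x :: real assume x: "x \<noteq> 0"
  have "{y. x^2 = 15 * y^2} = {y. y^2 = x^2 / 15}" by auto
  then have "finite {y. x^2 = 15 * y^2}" using finite_square_eq[of "x^2 / 15"] by (simp only:)
  then have fin: "finite ({y. x^2 = 15 * y^2} \<union> {0})" by simp
  have low: "sqrt \<bar>x\<bar> \<le> rho x y" for y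
    unfolding rho_def using real_sqrt_ge_abs1[of x y] by (rule real_sqrt_le_mono)
  have x0: "0 < sqrt \<bar>x\<bar>" using x by simp
  show "(\<forall>y. (pot x has_real_derivative pot2 x y) (at y)) \<and>
       continuous_on UNIV (pot2 x) \<and>
       (\<exists>X. finite X \<and> (\<forall>y. y \<notin> X \<longrightarrow> (pot2 x has_real_derivative pot22 x y) (at y))) \<and>
       (\<exists>B. \<forall>y. \<bar>pot2 x y\<bar> \<le> B \<and> \<bar>pot22 x y\<bar> \<le> B)"
  proof (intro conjI allI)
    show "(pot x has_real_derivative pot2 x y) (at y)" for y by (rule pot_deriv) (use x in simp)
    show "continuous_on UNIV (pot2 x)" by (rule continuous_pot_first) (use x in \<open>auto intro: continuous_intros\<close>)
    show "\<exists>X. finite X \<and> (\<forall>y. y \<notin> X \<longrightarrow> (pot2 x has_real_derivative pot22 x y) (at y))"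
      by (intro exI[of _ "{y. x^2 = 15 * y^2} \<union> {0}"] conjI fin allI impI pot_second_deriv)
         (use x slope_quarter_iff[of x] in blast)+
    have "\<bar>pot2 x y\<bar> \<le> 1 + 2 / sqrt \<bar>x\<bar> + 8 / (sqrt \<bar>x\<bar>)^3 \<and> \<bar>pot22 x y\<bar> \<le> 1 + 2 / sqrt \<bar>x\<bar> + 8 / (sqrt \<bar>x\<bar>)^3" for y
      using abs_pot_first_le(2)[of x y] pot_second_le(2)[of x y] x x0 low[of y]
        divide_left_mono[OF low[of y], of 2] divide_left_mono[OF power_mono[OF low[of y], of 3], of 8]
      by (smt (verit, best) divide_nonneg_pos mult_pos_pos zero_less_power real_sqrt_ge_zero)
    then show "\<exists>B. \<forall>y. \<bar>pot2 x y\<bar> \<le> B \<and> \<bar>pot22 x y\<bar> \<le> B" by blast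
  qed
qed (use abs_pot_le pot_second_le_spike in auto)

definition pot_lap :: "real \<Rightarrow> real \<Rightarrow> real" where
  "pot_lap x y = pot11 x y + pot22 x y"

text \<open>The Laplacian of a logarithm is (base * Laplacian - squared gradient) / base^2. In the
  numerator the terms \<open>p^3\<close> and \<open>p^2 * ang s\<close> cancel, the first
  cancellation reflecting that \<open>log r\<close> is harmonic. What is left decays like p^(-5),
  that is r^(-5/2).\<close>

lemma pot_lap_eq:
  assumes "x \<noteq> 0" "y \<noteq> 0" and p: "p = rho x y" and s: "s = slope x y"
  shows "pot_lap x y = (lap_ang s + p * (1 + ang s * lap_ang s - grad_ang s) + p^2 * lap_ang s) / (2 * p^3 * (polar_base p s)^2)"
proof -
  have xy: "x \<noteq> 0 \<or> y \<noteq> 0" using assms by simp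
  have r: "0 < p" using rho_pos[OF xy] by (simp add: p)
  have S: "0 < polar_base p s" using polar_base_pos r by simp
  have "pot_lap x y = ((base11 x y + base22 x y) * base x y - ((base1 x y)^2 + (base2 x y)^2)) / (2 * (base x y)^2)"
    using assms(1,2) base_pos(2)[of x y] by (simp add: pot_lap_def pot11_def pot22_def field_simps power2_eq_square)
  also have "base x y = polar_base p s" by (simp add: base_def p s)
  also have "base11 x y + base22 x y = (p + lap_ang s) / p^3"
    unfolding base_ang_sum[symmetric] base11_def base22_def p[symmetric] s[symmetric]
    by (simp add: algebra_simps flip: add_divide_distrib)
  also have "((p + lap_ang s) / p^3 * polar_base p s - ((base1 x y)^2 + (base2 x y)^2)) / (2 * (polar_base p s)^2)
     = ((p + lap_ang s) * polar_base p s - p * (p^2 + p * ang s + grad_ang s)) / p^3 / (2 * (polar_base p s)^2)"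
    unfolding base_gradient_squares(2)[OF xy p s] using r
    by (simp add: diff_divide_distrib power2_eq_square power3_eq_cube)
  also have "(p + lap_ang s) * polar_base p s - p * (p^2 + p * ang s + grad_ang s) = lap_ang s + p * (1 + ang s * lap_ang s - grad_ang s) + p^2 * lap_ang s"
    unfolding polar_base_def by (simp add: power2_eq_square algebra_simps)
  finally show ?thesis by (simp add: mult_ac)
qed

section \<open>Signs outside and inside the wedge\<close>

text \<open>Here \<open>p * ang s\<close> is twice the real part of a holomorphic square root: it is
  harmonic, and its gradient has squared length 1 / r. With these two values the numerator in
  \<open>pot_lap_eq\<close> vanishes.\<close>

lemma outside_wedge:
  assumes "1/4 < \<bar>s\<bar>"
  shows "lap_ang s = 0" "grad_ang s = 1"
proof -
  define q where "q = ang s"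
  have q: "0 < q" "q^2 = 2 + 2 * \<bar>s\<bar>" "ang1 s = sgn s / q" "ang2 s = - 1 / q^3"
    using ang_outside[OF assms] by (auto simp: q_def)
  have s: "s \<noteq> 0" "s * sgn s = \<bar>s\<bar>" "(sgn s)^2 = 1" "s^2 = \<bar>s\<bar>^2" using assms by (auto simp: sgn_if)
  have "q^3 * lap_ang s = (q^2)^2 / 4 - \<bar>s\<bar> * q^2 - (1 - \<bar>s\<bar>^2)"
    unfolding lap_ang_def q(3,4) q_def[symmetric] s(2)[symmetric] s(4)[symmetric] using q(1)
    by (simp add: field_simps power_numeral_reduce)
  also have "\<dots> = 0" unfolding q(2) by (simp add: power2_eq_square field_simps)
  finally show "lap_ang s = 0" using q(1) by simp
  have "q^2 * grad_ang s = (q^2)^2 / 4 + (1 - \<bar>s\<bar>^2)"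
    unfolding grad_ang_def q(3) q_def[symmetric] power_divide s(3) s(4) using q(1)
    by (simp add: field_simps power_numeral_reduce)
  also have "\<dots> = q^2 * 1" unfolding q(2) by (simp add: power2_eq_square field_simps)
  finally show "grad_ang s = 1" using q(1) by (metis mult_cancel_left power_eq_0_iff less_irrefl)
qed

text \<open>Since \<open>q^2 = 9/4 + 4 * n\<close> with n = s^2, multiplying each quantity by a
  power of q leaves a polynomial in n on the interval from 0 to 1/16, settled by linear arithmetic
  from bounds on the powers of n. The first two claims serve the Laplacian, the last three the sign
  of \<open>pot11\<close>.\<close>

lemma inside_wedge:
  assumes "\<bar>s\<bar> \<le> 1/4"
  shows "0 < lap_ang s" "0 \<le> 1 + ang s * lap_ang s - grad_ang s"
    and "base11_ang s \<le> 0" "s^2 + ang s * base11_ang s \<le> 0" "1/2 \<le> base1_ang s"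
proof -
  define q n where "q = ang s" and "n = s^2"
  have n: "0 \<le> n" "n \<le> 1/16" 
    using power_mono[OF assms, of 2] by (auto simp: n_def power2_eq_square)
  have q: "0 < q" "q^2 = 9/4 + 4 * n" "ang1 s = 4 * s / q" "ang2 s = 9 / q^3"
    using ang_inside[OF assms] by (auto simp: q_def n_def)
  have nn: "n * n \<le> 1/16 * n" "0 \<le> n * n" using n mult_right_mono[OF n(2) n(1)] by auto
  have q4: "q^4 = (9/4 + 4 * n)^2" unfolding q(2)[symmetric] by simp
  have E: "q^3 * lap_ang s = q^4 / 4 - 4 * n * q^2 + 9 * (1 - n)"
    unfolding lap_ang_def q(3,4) q_def[symmetric] n_def using q(1)
    by (simp add: field_simps power_numeral_reduce)
  also have "\<dots> = 657/64 - 27/2 * n - 12 * (n * n)"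
    unfolding q4 q(2) by (simp add: power2_eq_square field_simps)
  also have "\<dots> > 0" using n nn by linarith
  finally show "0 < lap_ang s" using q(1) by (simp add: zero_less_mult_iff)
  have "q^2 * (1 + q * lap_ang s - grad_ang s) = q^2 + q^3 * lap_ang s - q^4 / 4 - 16 * n * (1 - n)"
    unfolding grad_ang_def q(3) q_def[symmetric] n_def using q(1)
    by (simp add: field_simps power_numeral_reduce)
  also have "\<dots> = q^2 - 4 * n * q^2 + 9 * (1 - n) - 16 * n * (1 - n)" unfolding E by simp
  also have "\<dots> = 45/4 - 30 * n" unfolding q(2) by (simp add: field_simps)
  also have "\<dots> \<ge> 0" using n by linarith
  finally show "0 \<le> 1 + ang s * lap_ang s - grad_ang s"
    unfolding q_def[symmetric] using q(1) by (simp add: zero_le_mult_iff)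
  have F: "q^3 * base11_ang s = (3 * n - 1) / 4 * q^4 + 4 * n * (1 - 2 * n) * q^2 + 9 * n * (1 - n)"
    unfolding base11_ang_def q(3,4) q_def[symmetric] n_def using q(1)
    by (simp add: field_simps power_numeral_reduce)
  have n3: "0 \<le> n * (n * n)" "n * (n * n) \<le> 1/16 * (n * n)" using mult_nonneg_nonneg[OF n(1) nn(2)] mult_right_mono[OF n(2) nn(2)] by auto
  have F': "q^3 * base11_ang s = - 81/64 + 1107/64 * n - 3/2 * (n * n) - 20 * (n * (n * n))"
    unfolding F q4 q(2) by (simp add: power2_eq_square field_simps)
  have "q^3 * base11_ang s \<le> 0" unfolding F' using n nn n3 by linarith
  then show "base11_ang s \<le> 0" using q(1) by (simp add: mult_le_0_iff)
  have "q^2 * (n + q * base11_ang s) = n * q^2 + q^3 * base11_ang s" by (simp add: power2_eq_square power3_eq_cube algebra_simps)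
  also have "\<dots> = - 81/64 + 1251/64 * n + 5/2 * (n * n) - 20 * (n * (n * n))"
    unfolding F' q(2) by (simp add: field_simps)
  \<comment> \<open>Close to an equality at the edge of the wedge: for n = 1/16 the linear term
    reaches 1251/1024, against 81/64 = 1296/1024.\<close>
  also have "\<dots> \<le> 0" using n nn n3 by linarith
  finally show "s^2 + ang s * base11_ang s \<le> 0"
    unfolding q_def[symmetric] n_def[symmetric] using q(1) by (simp add: mult_le_0_iff)
  have "q * base1_ang s = q^2 / 2 - 4 * n"
    unfolding base1_ang_def q(3) q_def[symmetric] n_def using q(1)
    by (simp add: field_simps power_numeral_reduce)
  also have "\<dots> \<ge> 1" unfolding q(2) using n by simp
  finally have "1 / q \<le> base1_ang s" using q(1) by (simp add: pos_divide_le_eq mult.commute)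
  moreover have "q \<le> 2" using ang_le[of s] assms by (simp add: q_def)
  then have "1 / 2 \<le> 1 / q" using q(1) by (intro divide_left_mono) auto
  ultimately show "1/2 \<le> base1_ang s" by linarith
qed

text \<open>After clearing denominators the sign is that of a cubic polynomial in p with
  coefficients depending on s alone, and in the wedge each coefficient is nonpositive.\<close>

lemma pot11_nonpos:
  assumes "\<bar>slope x y\<bar> \<le> 1/4"
  shows "pot11 x y \<le> 0"
proof (cases "x = 0 \<or> y = 0")
  case True then show ?thesis by (auto simp: pot11_def)
next
  case False
  then have xy: "x \<noteq> 0 \<or> y \<noteq> 0" by simp
  define p s where "p = rho x y" and "s = slope x y"
  have r: "0 < p" using rho_pos[OF xy] by (simp add: p_def)
  have s: "\<bar>s\<bar> \<le> 1/4" using assms by (simp add: s_def)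
  have s2: "0 \<le> s^2" "s^2 \<le> 1/16" using power_mono[OF s, of 2] by (auto simp: power2_eq_square)
  have S: "0 < polar_base p s" using polar_base_pos r by simp
  note w = inside_wedge[OF s]
  have "base11 x y * base x y \<le> (base1 x y)^2"
  proof -
    have "ang s \<le> 2" using ang_le[of s] s by simp
    then have t2: "ang s * s^2 \<le> 2 * (1/16)" using s2 by (intro mult_mono) auto
    have t1: "1/2 * (15/16) \<le> base1_ang s * (1 - s^2)" using w(5) s2 by (intro mult_mono) auto
    \<comment> \<open>Sorted by powers of p. The term of degree 2 is negative because
      \<open>t1\<close> makes the subtracted part at least 15/16 while \<open>t2\<close> bounds the
      positive part by 1/8; the last coefficient is 2 s^2 - 1.\<close>
    have "(s^2 * p + base11_ang s) * polar_base p s - p * ((1 - s^2) * (p + base1_ang s)^2)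
       = base11_ang s + p * (s^2 + ang s * base11_ang s - (1 - s^2) * (base1_ang s)^2)
         + p^2 * (ang s * s^2 + base11_ang s - 2 * (base1_ang s * (1 - s^2))) + p^3 * (s^2 - (1 - s^2))"
      unfolding polar_base_def by (simp add: power2_eq_square power3_eq_cube algebra_simps)
    also have "\<dots> \<le> 0 + 0 + 0 + 0"
      using r w(3,4) t1 t2 s2 by (intro add_mono mult_nonneg_nonpos) (auto intro: add_nonpos_nonpos diff_le_0_iff_le[THEN iffD2] order_trans)
    finally have "(s^2 * p + base11_ang s) * polar_base p s \<le> p * ((1 - s^2) * (p + base1_ang s)^2)" by simp
    then have "(s^2 * p + base11_ang s) * polar_base p s / p^3 \<le> p * ((1 - s^2) * (p + base1_ang s)^2) / p^3"
      using r by (intro divide_right_mono) auto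
    also have "p * ((1 - s^2) * (p + base1_ang s)^2) / p^3 = (base1 x y)^2"
      unfolding base_gradient_squares(1)[OF xy p_def s_def] using r by (simp add: power2_eq_square power3_eq_cube)
    finally show ?thesis by (simp add: base11_def base_def p_def s_def)
  qed
  then have "base11 x y * base x y / (base x y)^2 \<le> (base1 x y)^2 / (base x y)^2" by (rule divide_right_mono) simp
  then have "base11 x y / base x y \<le> (base1 x y / base x y)^2"
    using base_pos(2)[of x y] by (simp add: power_divide power2_eq_square)
  then show ?thesis by (simp add: pot11_def)
qed

lemma pot_lap_outside: "1/4 < \<bar>slope x y\<bar> \<Longrightarrow> pot_lap x y = 0"
proof -
  assume s: "1/4 < \<bar>slope x y\<bar>"
  show ?thesis
  proof (cases "x = 0 \<or> y = 0")
    case True then show ?thesis by (auto simp: pot_lap_def pot11_def pot22_def)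
  next
    case False
    then show ?thesis by (simp add: pot_lap_eq[OF _ _ refl refl] outside_wedge[OF s])
  qed
qed

lemma pot_lap_inside:
  assumes "\<bar>slope x y\<bar> \<le> 1/4" "x \<noteq> 0" "y \<noteq> 0"
  shows "0 < pot_lap x y"
proof -
  define p s where "p = rho x y" and "s = slope x y"
  have r: "0 < p" using rho_pos[of x y] assms by (simp add: p_def)
  have S: "0 < polar_base p s" using polar_base_pos r by simp
  have "0 < lap_ang s + p * (1 + ang s * lap_ang s - grad_ang s) + p^2 * lap_ang s"
    using inside_wedge(1,2)[of s] assms(1) r by (intro add_pos_pos add_pos_nonneg) (auto simp: s_def)
  then show ?thesis
    unfolding pot_lap_eq[OF assms(2,3) p_def s_def] using r S by simp
qed

lemma pot_lap_nonneg: "0 \<le> pot_lap x y"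
proof (cases "x = 0 \<or> y = 0")
  case True then show ?thesis by (auto simp: pot_lap_def pot11_def pot22_def)
next
  case False
  then show ?thesis
    using pot_lap_inside[of x y] pot_lap_outside[of x y] by (cases "\<bar>slope x y\<bar> \<le> 1/4") auto
qed

text \<open>The cancellation in \<open>pot_lap_eq\<close> gains a factor 1 / (1 + r) over the bound
  for the single second derivatives. Split into two square roots, one for each coordinate, it yields
  the product weight that makes the spike integrable.\<close>

lemma pot_lap_le: "pot_lap x y \<le> 14 * ((spike1 x * spike1 y) * (weight1 x * weight1 y))"
proof (cases "x = 0 \<or> y = 0")
  case True then show ?thesis by (auto simp: pot_lap_def pot11_def pot22_def spike1_def)
next
  case False
  then have xy: "x \<noteq> 0" "y \<noteq> 0" by auto
  define p s where "p = rho x y" and "s = slope x y"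
  have r: "0 < p" using rho_pos[of x y] xy by (simp add: p_def)
  have s: "\<bar>s\<bar> \<le> 1" "0 \<le> s^2" "s^2 \<le> 1" using abs_slope_le slope_sq_le by (auto simp: s_def)
  have E: "\<bar>lap_ang s\<bar> \<le> 13" using abs_base_ang_le[OF s(1)] base_ang_sum[of s] by linarith
  have "1 + ang s * lap_ang s - grad_ang s \<le> 27"
  proof -
    have "\<bar>ang s * lap_ang s\<bar> \<le> 2 * 13"
      unfolding abs_mult using ang_le[OF s(1)] E by (intro mult_mono) (auto simp: abs_of_pos)
    moreover have "0 \<le> grad_ang s" unfolding grad_ang_def using s by (intro add_nonneg_nonneg mult_nonneg_nonneg) auto
    ultimately show ?thesis by linarith
  qed
  then have "lap_ang s + p * (1 + ang s * lap_ang s - grad_ang s) + p^2 * lap_ang s \<le> 13 + p * 27 + p^2 * 13"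
    using E r by (intro add_mono mult_left_mono) auto
  also have "\<dots> \<le> 28 * (1 + p^2)"
    using zero_le_power2[of "p - 1"] r by (simp add: power2_eq_square algebra_simps)
  finally have "pot_lap x y \<le> 28 * (1 + p^2) / (2 * p^3 * (polar_base p s)^2)"
    unfolding pot_lap_eq[OF xy p_def s_def] using r by (intro divide_right_mono) auto
  also have "\<dots> \<le> 28 * (1 + p^2) / (2 * p^3 * (1 + p^2)^2)"
  proof -
    have "0 < 1 + p^2" using zero_le_power2[of p] by linarith
    then show ?thesis
      using r polar_base_ge(1)[of p s] polar_base_pos[of p s]
      by (intro divide_left_mono mult_left_mono power_mono mult_pos_pos zero_less_power) auto
  qed
  also have "\<dots> = 14 * (1 / p^3 * (1 / (1 + p^2)))"
  proof -
    have *: "28 * d / (2 * q * d^2) = 14 * (1 / q * (1 / d))" if "d \<noteq> 0" "q \<noteq> 0" for d q :: real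
      using that by (simp add: field_simps power2_eq_square)
    have "1 + p^2 \<noteq> 0" using zero_le_power2[of p] by linarith
    then show ?thesis by (rule *) (use r in simp)
  qed
  also have "\<dots> \<le> 14 * ((spike1 x * spike1 y) * (weight1 x * weight1 y))"
  proof (intro mult_left_mono mult_mono)
    show "1 / p^3 \<le> spike1 x * spike1 y" unfolding p_def by (rule rho_spike[OF xy])
    have "1 / (1 + p^2) = (1 + p^2) powr (-1/2) * (1 + p^2) powr (-1/2)"
      using zero_le_power2[of p] by (simp add: powr_minus_divide flip: powr_add)
    also have "\<dots> \<le> weight1 x * weight1 y"
      unfolding weight1_def p_def rho_sq using real_sqrt_ge_abs1[of x y] real_sqrt_ge_abs2[of y x]
      by (intro mult_mono powr_mono2') auto
    finally show "1 / (1 + p^2) \<le> weight1 x * weight1 y" .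
  qed (use zero_le_power2[of p] in auto)
  finally show ?thesis .
qed

theorem theorem3p2:
  shows "\<exists>W :: real^2 \<Rightarrow> real.
           integrable lborel W \<and> (\<forall>x. W x \<ge> 0) \<and> \<not> (AE x in lborel. W x = 0)
           \<and> (\<exists>g. is_riesz1_sq W g \<and> (AE x in lborel. x \<in> ess_support W \<longrightarrow> g x \<ge> 0))"
proof -
  define W where "W v = pot_lap (v$1) (v$2)" for v :: "real^2"
  define h where "h v = pot11 (v$1) (v$2)" for v :: "real^2"
  have [measurable]: "W \<in> borel_measurable borel" "h \<in> borel_measurable borel"
    unfolding W_def[abs_def] h_def[abs_def] pot_lap_def by measurable
  have W0: "0 \<le> W v" for v by (simp add: W_def pot_lap_nonneg)
  have Wi: "integrable lborel W"
  proof (rule Bochner_Integration.integrable_bound)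
    show "integrable lborel (\<lambda>v. 14 * (spike v * weight v))" using integrable_spike_weight by simp
    show "AE v in lborel. norm (W v) \<le> norm (14 * (spike v * weight v))"
      using pot_lap_le W0 by (auto simp: W_def spike_def weight_def abs_mult less_imp_le pot_lap_nonneg)
  qed simp
  have "is_riesz1_sq W (\<lambda>v. - h v)"
  proof (rule is_riesz1_sq_of_heat_identity[OF Wi])
    show "\<bar>h v\<bar> \<le> 8 * spike v" for v using pot_second_le_spike(1) by (simp add: h_def spike_def)
    show "(\<integral>x. W x * heat2_11 t (x - y) \<partial>lborel) = (\<integral>x. h x * heat2_time t (x - y) \<partial>lborel)" if "0 < t" for t y
      using pot.heat_identity[OF that, of y] by (simp add: W_def h_def pot_lap_def)
  qed simp
  \<comment> \<open>A point with \<open>h v > 0\<close> lies outside the closed wedge. The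
    complement is open away from the origin and W vanishes on it, so a whole ball around v misses
    the set where W is nonzero.\<close>
  moreover have "0 \<le> - h v" if "v \<in> ess_support W" for v
  proof (rule ccontr)
    assume neg: "\<not> 0 \<le> - h v"
    then have sl: "1/4 < \<bar>slope (v$1) (v$2)\<bar>" using pot11_nonpos[of "v$1" "v$2"] by (force simp: h_def)
    have ne: "v \<noteq> 0" using sl by (auto simp: slope_def)
    have eq: "1/4 < \<bar>slope (w$1) (w$2)\<bar> \<longleftrightarrow> norm w < 4 * \<bar>w$2\<bar>" if "w \<noteq> 0" for w :: "real^2"
    proof -
      have "(rho (w$1) (w$2))^2 = norm w"
        unfolding rho_sq norm_vec_def L2_set_def by (simp add: sum_2)
      then show ?thesis using that by (simp add: slope_def abs_divide field_simps)
    qed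
    have "open {w::real^2. norm w < 4 * \<bar>w$2\<bar>}"
      by (intro open_Collect_less continuous_intros)
    moreover have "v \<in> {w. norm w < 4 * \<bar>w$2\<bar>}" using eq[OF ne] sl by simp
    ultimately obtain e where e: "0 < e" "ball v e \<subseteq> {w. norm w < 4 * \<bar>w$2\<bar>}"
      by (meson open_contains_ball)
    have "W w = 0" if "w \<in> ball v e" for w
    proof -
      have w: "norm w < 4 * \<bar>w$2\<bar>" using that e by auto
      then have "w \<noteq> 0" by auto
      with w eq[of w] show ?thesis by (simp add: W_def pot_lap_outside)
    qed
    then have "{w \<in> ball v e. W w \<noteq> 0} = {}" by auto
    moreover have "0 < emeasure lborel {w \<in> ball v e. W w \<noteq> 0}"
      using that e(1) unfolding ess_support_def by blast
    ultimately show False by (metis emeasure_empty less_irrefl)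
  qed
  moreover have "\<not> (AE v in lborel. W v = 0)"
  proof
    assume "AE v in lborel. W v = 0"
    \<comment> \<open>On this box the radius exceeds 1 and y is below 1/8, so the slope is below 1/8
      as well; the box lies in the wedge and avoids both axes.\<close>
    define Q where "Q = box (vector [1, 0] :: real^2) (vector [2, 1/8])"
    have pos: "0 < W v" if "v \<in> Q" for v
    proof -
      have v: "1 < v$1" "0 < v$2" "v$2 < 1/8"
        using that unfolding Q_def mem_box Basis_vec2 by (auto simp: inner_axis)
      have "(v$1)^2 \<le> (v$1)^2 + (v$2)^2" by simp
      then have "1 \<le> (rho (v$1) (v$2))^2"
        unfolding rho_sq using v by (intro real_le_rsqrt) (smt (verit) one_power2 power_mono)
      then have "\<bar>slope (v$1) (v$2)\<bar> \<le> \<bar>v$2\<bar> / 1"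
        unfolding slope_def abs_divide by (intro divide_left_mono) auto
      then show ?thesis unfolding W_def using v by (intro pot_lap_inside) auto
    qed
    have "AE v in lborel. v \<notin> Q"
      using \<open>AE v in lborel. W v = 0\<close> by eventually_elim (use pos in force)
    then have "emeasure lborel Q = 0"
      by (subst (asm) AE_iff_measurable[of Q]) (auto simp: Q_def)
    moreover have "emeasure lborel Q = ennreal (1/8)"
      unfolding Q_def by (subst emeasure_lborel_box) (auto simp: Basis_vec2 inner_axis axis_eq_axis)
    ultimately show False by simp
  qed
  ultimately show ?thesis using Wi W0 by (intro exI[of _ W]) auto
qed

end
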